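(* Let $N\trianglelefteq G$. (a) For $(H,\Phi)\in\mathcal{X}(G)$ one has $s_{(H,\Phi)}^G\circ \mathrm{inf}_{G/N}^G = s_{(HN/N,\Phi_N)}^{G/N}$, where $\Phi_N:=\Phi\circ\nu^*\circ \alpha^*\in\mathrm{Hom}((HN/N)^*,\mathbb{K}^\times)$ with $\alpha\colon H/(H\cap N)\to HN/N$ denoting the canonical isomorphism and $\nu\colon H\to H/(H\cap N)$ denoting the canonical epimorphism. (b) For $(U/N,\Psi)\in \mathcal{X}(G/N)$ with $N\le U\le G$, one has $$\mathrm{inf}_{G/N}^G(e_{(U/N,\Psi)}^{G/N}) = \sum_{\substack{(H,\Phi)\in[G\backslash \mathcal{X}(G)] \\ (HN/N,\Phi_N) =_{G/N} (U/N,\Psi)}} e_{(H,\Phi)}^G.$$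
   Context: $A$ is a multiplicatively written abelian group; for a finite group $H$, $H^*:=\mathrm{Hom}(H,A)$ with pointwise multiplication; a homomorphism $f\colon H\to H'$ induces $f^*\colon H'^*\to H^*$, $\lambda\mapsto\lambda\circ f$. $G$ is a finite group such that $S^*$ is finite for all subquotients $S$ of $G$, and $\mathbb{K}$ is a field of characteristic $0$ which is a splitting field of $S^*$ for all subquotients $S$ of $G$. For a finite group $S$, $[U,\phi]_S$ denotes the $S$-conjugacy class of a pair $(U,\phi)$ with $U\le S$, $\phi\in U^*$, where ${}^g(U,\phi)=({}^gU,{}^g\phi)$, ${}^gU=gUg^{-1}$, $({}^g\phi)(x)=\phi(g^{-1}xg)$. $B^A_{\mathbb{K}}(S)$ is the $\mathbb{K}$-vector space with basis these classes and multiplication $[U,\phi]_S\cdot[V,\psi]_S=\sum_{g\in[U\backslash S/V]}[U\cap{}^gV,\phi|_{U\cap{}^gV}\cdot({}^g\psi)|_{U\cap{}^gV}]_S$. $\mathcal{X}(S)$ is the set of pairs $(H,\Phi)$ with $H\le S$, $\Phi\in\mathrm{Hom}(H^*,\mathbb{K}^\times)$, with $S$-action ${}^g(H,\Phi)=({}^gH,{}^g\Phi)$, ${}^g\Phi(\phi)=\Phi({}^{g^{-1}}\phi)$. $s^S_{(H,\Phi)}:=s^H_\Phi\circ\pi_H\circ\mathrm{res}^S_H\colon B^A_{\mathbb{K}}(S)\to\mathbb{K}$, where $\mathrm{res}^S_H([U,\phi]_S)=\sum_{g\in[H\backslash S/U]}[H\cap{}^gU,({}^g\phi)|_{H\cap{}^gU}]_H$,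 $\pi_H([U,\phi]_H)=\phi\in\mathbb{K}H^*$ if $U=H$ and $0$ otherwise, $s^H_\Phi\colon\mathbb{K}H^*\to\mathbb{K}$ the linear extension of $\Phi$. $e^S_{(H,\Phi)}\in B^A_{\mathbb{K}}(S)$ is the unique (primitive) idempotent with $s^S_{(K,\Psi)}(e^S_{(H,\Phi)})=1$ if $(K,\Psi)$ is $S$-conjugate to $(H,\Phi)$ and $0$ otherwise. Inflation $\mathrm{inf}^G_{G/N}\colon B^A_{\mathbb{K}}(G/N)\to B^A_{\mathbb{K}}(G)$ is the linear map $[U/N,\phi]_{G/N}\mapsto[U,\phi\circ\nu_U]_G$, with $\nu_U\colon U\to U/N$ the natural epimorphism. $[G\backslash X]$ denotes a set of representatives of the $G$-orbits of $X$; $x=_{G/N}y$ means $x$ and $y$ lie in the same $G/N$-orbit. *)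

theory Defs
  imports "HOL-Algebra.Coset" "HOL-Library.Poly_Mapping" "Jordan_Normal_Form.Matrix"
begin

section \<open>Dual groups and splitting fields\<close>

text \<open>
  Homomorphisms are taken to be extensional on the carrier of their domain, so that two of them
  are equal as soon as they agree there. A subgroup \<open>H\<close> of a group \<open>S\<close>, regarded as a group in its
  own right, is \<open>S\<lparr>carrier := H\<rparr>\<close>.
\<close>

definition ext_hom :: "('g, 'b) monoid_scheme \<Rightarrow> ('h, 'c) monoid_scheme \<Rightarrow> ('g \<Rightarrow> 'h) set" where
  "ext_hom G H = hom G H \<inter> extensional (carrier G)"

definition dual_group :: "('a, 'c) monoid_scheme \<Rightarrow> ('g, 'b) monoid_scheme \<Rightarrow> ('g \<Rightarrow> 'a) monoid" where
  "dual_group A H =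
     \<lparr>carrier = ext_hom H A,
      monoid.mult = (\<lambda>\<phi> \<psi>. \<lambda>x\<in>carrier H. \<phi> x \<otimes>\<^bsub>A\<^esub> \<psi> x),
      one = (\<lambda>x\<in>carrier H. \<one>\<^bsub>A\<^esub>)\<rparr>"

definition dual_map :: "('g, 'b) monoid_scheme \<Rightarrow> ('g \<Rightarrow> 'h) \<Rightarrow> ('h \<Rightarrow> 'a) \<Rightarrow> ('g \<Rightarrow> 'a)" where
  "dual_map H f \<phi> = compose (carrier H) \<phi> f"

definition field_units :: "'k::field monoid" where
  "field_units = \<lparr>carrier = UNIV - {0}, monoid.mult = (*), one = 1\<rparr>"

definition matrix_rep :: "('x, 'b) monoid_scheme \<Rightarrow> nat \<Rightarrow> ('x \<Rightarrow> 'k::field mat) \<Rightarrow> bool" where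
  "matrix_rep X n \<rho> \<longleftrightarrow>
     \<rho> \<in> carrier X \<rightarrow> carrier_mat n n \<and>
     \<rho> \<one>\<^bsub>X\<^esub> = 1\<^sub>m n \<and>
     (\<forall>x\<in>carrier X. \<forall>y\<in>carrier X. \<rho> (x \<otimes>\<^bsub>X\<^esub> y) = \<rho> x * \<rho> y)"

definition invariant_subspace ::
    "('x, 'b) monoid_scheme \<Rightarrow> nat \<Rightarrow> ('x \<Rightarrow> 'k::field mat) \<Rightarrow> 'k vec set \<Rightarrow> bool" where
  "invariant_subspace X n \<rho> W \<longleftrightarrow>
     W \<subseteq> carrier_vec n \<and> 0\<^sub>v n \<in> W \<and>
     (\<forall>v\<in>W. \<forall>w\<in>W. v + w \<in> W) \<and>
     (\<forall>c. \<forall>w\<in>W. c \<cdot>\<^sub>v w \<in> W) \<and>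
     (\<forall>x\<in>carrier X. \<forall>w\<in>W. \<rho> x *\<^sub>v w \<in> W)"

definition irreducible_rep :: "('x, 'b) monoid_scheme \<Rightarrow> nat \<Rightarrow> ('x \<Rightarrow> 'k::field mat) \<Rightarrow> bool" where
  "irreducible_rep X n \<rho> \<longleftrightarrow>
     matrix_rep X n \<rho> \<and> n > 0 \<and>
     (\<forall>W. invariant_subspace X n \<rho> W \<longrightarrow> W = {0\<^sub>v n} \<or> W = carrier_vec n)"

text \<open>
  \<open>K\<close> is a splitting field of a finite group \<open>X\<close> if \<open>End\<^sub>K\<^sub>X(V) = K\<close> for every simple
  \<open>KX\<close>-module \<open>V\<close>. Such \<open>V\<close> are finite dimensional, hence are given by matrix representations.
\<close>

definition splitting_field :: "'k::field itself \<Rightarrow> ('x, 'b) monoid_scheme \<Rightarrow> bool" where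
  "splitting_field _ X \<longleftrightarrow>
     (\<forall>n. \<forall>\<rho> :: 'x \<Rightarrow> 'k mat. irreducible_rep X n \<rho> \<longrightarrow>
        (\<forall>M\<in>carrier_mat n n. (\<forall>x\<in>carrier X. M * \<rho> x = \<rho> x * M) \<longrightarrow> (\<exists>c. M = c \<cdot>\<^sub>m 1\<^sub>m n)))"

section \<open>The algebra of monomial pairs\<close>

definition conj_set :: "('g, 'b) monoid_scheme \<Rightarrow> 'g \<Rightarrow> 'g set \<Rightarrow> 'g set" where
  "conj_set S g U = (\<lambda>x. g \<otimes>\<^bsub>S\<^esub> x \<otimes>\<^bsub>S\<^esub> inv\<^bsub>S\<^esub> g) ` U"

definition conj_char :: "('g, 'b) monoid_scheme \<Rightarrow> 'g \<Rightarrow> 'g set \<Rightarrow> ('g \<Rightarrow> 'a) \<Rightarrow> ('g \<Rightarrow> 'a)" where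
  "conj_char S g U \<phi> = (\<lambda>x\<in>conj_set S g U. \<phi> (inv\<^bsub>S\<^esub> g \<otimes>\<^bsub>S\<^esub> x \<otimes>\<^bsub>S\<^esub> g))"

type_synonym ('g, 'a) mpair = "'g set \<times> ('g \<Rightarrow> 'a)"

definition mpairs :: "('a, 'c) monoid_scheme \<Rightarrow> ('g, 'b) monoid_scheme \<Rightarrow> ('g, 'a) mpair set" where
  "mpairs A S = {(U, \<phi>). subgroup U S \<and> \<phi> \<in> carrier (dual_group A (S\<lparr>carrier := U\<rparr>))}"

definition mclass :: "('g, 'b) monoid_scheme \<Rightarrow> ('g, 'a) mpair \<Rightarrow> ('g, 'a) mpair set" where
  "mclass S p = {(conj_set S g (fst p), conj_char S g (fst p) (snd p)) | g. g \<in> carrier S}"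

text \<open>The vector space with basis the conjugacy classes of monomial pairs.\<close>

definition burnside :: "('a, 'c) monoid_scheme \<Rightarrow> ('g, 'b) monoid_scheme \<Rightarrow>
    (('g, 'a) mpair set \<Rightarrow>\<^sub>0 'k::field) set" where
  "burnside A S = {x. Poly_Mapping.keys x \<subseteq> mclass S ` mpairs A S}"

abbreviation bscale :: "'k::field \<Rightarrow> ('i \<Rightarrow>\<^sub>0 'k) \<Rightarrow> ('i \<Rightarrow>\<^sub>0 'k)" where
  "bscale a \<equiv> Poly_Mapping.map ((*) a)"

definition lin_ext :: "('i \<Rightarrow> ('j \<Rightarrow>\<^sub>0 'k)) \<Rightarrow> ('i \<Rightarrow>\<^sub>0 'k::field) \<Rightarrow> ('j \<Rightarrow>\<^sub>0 'k)" where
  "lin_ext f x = (\<Sum>c\<in>Poly_Mapping.keys x. bscale (Poly_Mapping.lookup x c) (f c))"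

definition lin_form :: "('i \<Rightarrow> 'k) \<Rightarrow> ('i \<Rightarrow>\<^sub>0 'k::field) \<Rightarrow> 'k" where
  "lin_form f x = (\<Sum>c\<in>Poly_Mapping.keys x. Poly_Mapping.lookup x c * f c)"

text \<open>
  The maps below are defined on basis elements by choosing a representative of each conjugacy
  class and of each double coset; their values do not depend on these choices.
\<close>

definition rep :: "'x set \<Rightarrow> 'x" where
  "rep X = (SOME x. x \<in> X)"

definition double_cosets :: "('g, 'b) monoid_scheme \<Rightarrow> 'g set \<Rightarrow> 'g set \<Rightarrow> 'g set set" where
  "double_cosets S U V = {(U #>\<^bsub>S\<^esub> g) <#>\<^bsub>S\<^esub> V | g. g \<in> carrier S}"

definition basis_mult :: "('a, 'c) monoid_scheme \<Rightarrow> ('g, 'b) monoid_scheme \<Rightarrow>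
    ('g, 'a) mpair set \<Rightarrow> ('g, 'a) mpair set \<Rightarrow> (('g, 'a) mpair set \<Rightarrow>\<^sub>0 'k::field)" where
  "basis_mult A S c d =
     (let (U, \<phi>) = rep c; (V, \<psi>) = rep d in
      \<Sum>D\<in>double_cosets S U V.
        let g = rep D; W = U \<inter> conj_set S g V in
        Poly_Mapping.single (mclass S (W, \<lambda>x\<in>W. \<phi> x \<otimes>\<^bsub>A\<^esub> conj_char S g V \<psi> x)) 1)"

definition bmult :: "('a, 'c) monoid_scheme \<Rightarrow> ('g, 'b) monoid_scheme \<Rightarrow>
    (('g, 'a) mpair set \<Rightarrow>\<^sub>0 'k::field) \<Rightarrow> (('g, 'a) mpair set \<Rightarrow>\<^sub>0 'k) \<Rightarrow>
    (('g, 'a) mpair set \<Rightarrow>\<^sub>0 'k)" where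
  "bmult A S x y = lin_ext (\<lambda>c. lin_ext (\<lambda>d. basis_mult A S c d) y) x"

section \<open>Species and idempotents\<close>

type_synonym ('g, 'a, 'k) spair = "'g set \<times> (('g \<Rightarrow> 'a) \<Rightarrow> 'k)"

definition spairs :: "('a, 'c) monoid_scheme \<Rightarrow> ('g, 'b) monoid_scheme \<Rightarrow>
    ('g, 'a, 'k::field) spair set" where
  "spairs A S =
     {(H, \<Phi>). subgroup H S \<and> \<Phi> \<in> ext_hom (dual_group A (S\<lparr>carrier := H\<rparr>)) field_units}"

definition conj_spair :: "('a, 'c) monoid_scheme \<Rightarrow> ('g, 'b) monoid_scheme \<Rightarrow> 'g \<Rightarrow>
    ('g, 'a, 'k::field) spair \<Rightarrow> ('g, 'a, 'k) spair" where
  "conj_spair A S g p =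
     (let K = conj_set S g (fst p) in
      (K, \<lambda>\<phi>\<in>carrier (dual_group A (S\<lparr>carrier := K\<rparr>)). snd p (conj_char S (inv\<^bsub>S\<^esub> g) K \<phi>)))"

definition spair_conjugate :: "('a, 'c) monoid_scheme \<Rightarrow> ('g, 'b) monoid_scheme \<Rightarrow>
    ('g, 'a, 'k::field) spair \<Rightarrow> ('g, 'a, 'k) spair \<Rightarrow> bool" where
  "spair_conjugate A S p q \<longleftrightarrow> (\<exists>g\<in>carrier S. q = conj_spair A S g p)"

definition spair_transversal :: "('a, 'c) monoid_scheme \<Rightarrow> ('g, 'b) monoid_scheme \<Rightarrow>
    ('g, 'a, 'k::field) spair set \<Rightarrow> bool" where
  "spair_transversal A S R \<longleftrightarrow>
     R \<subseteq> spairs A S \<and> (\<forall>p\<in>spairs A S. \<exists>!r. r \<in> R \<and> spair_conjugate A S p r)"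

definition res :: "('g, 'b) monoid_scheme \<Rightarrow> 'g set \<Rightarrow>
    (('g, 'a) mpair set \<Rightarrow>\<^sub>0 'k::field) \<Rightarrow> (('g, 'a) mpair set \<Rightarrow>\<^sub>0 'k)" where
  "res S H = lin_ext (\<lambda>c.
     let (U, \<phi>) = rep c in
     \<Sum>D\<in>double_cosets S H U.
       let g = rep D; W = H \<inter> conj_set S g U in
       Poly_Mapping.single (mclass (S\<lparr>carrier := H\<rparr>) (W, restrict (conj_char S g U \<phi>) W)) 1)"

definition proj_top :: "'g set \<Rightarrow> (('g, 'a) mpair set \<Rightarrow>\<^sub>0 'k::field) \<Rightarrow> (('g \<Rightarrow> 'a) \<Rightarrow>\<^sub>0 'k)" where
  "proj_top H = lin_ext (\<lambda>c.
     let (U, \<phi>) = rep c in if U = H then Poly_Mapping.single \<phi> 1 else 0)"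

definition species :: "('g, 'b) monoid_scheme \<Rightarrow> ('g, 'a, 'k::field) spair \<Rightarrow>
    (('g, 'a) mpair set \<Rightarrow>\<^sub>0 'k) \<Rightarrow> 'k" where
  "species S p = lin_form (snd p) \<circ> proj_top (fst p) \<circ> res S (fst p)"

definition idem :: "('a, 'c) monoid_scheme \<Rightarrow> ('g, 'b) monoid_scheme \<Rightarrow>
    ('g, 'a, 'k::field) spair \<Rightarrow> (('g, 'a) mpair set \<Rightarrow>\<^sub>0 'k)" where
  "idem A S p = (THE e. e \<in> burnside A S \<and> bmult A S e e = e \<and>
     (\<forall>q\<in>spairs A S. species S q e = (if spair_conjugate A S q p then 1 else 0)))"

section \<open>Inflation\<close>

text \<open>The subgroup \<open>U/N\<close> of \<open>G/N\<close>, for \<open>N \<le> U \<le> G\<close>.\<close>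

definition quot :: "('g, 'b) monoid_scheme \<Rightarrow> 'g set \<Rightarrow> 'g set \<Rightarrow> 'g set set" where
  "quot G U N = carrier (G\<lparr>carrier := U\<rparr> Mod N)"

text \<open>A subgroup \<open>P\<close> of \<open>G/N\<close> equals \<open>U/N\<close> for \<open>U = \<Union>P\<close>.\<close>

definition inflation :: "('g, 'b) monoid_scheme \<Rightarrow> 'g set \<Rightarrow>
    (('g set, 'a) mpair set \<Rightarrow>\<^sub>0 'k::field) \<Rightarrow> (('g, 'a) mpair set \<Rightarrow>\<^sub>0 'k)" where
  "inflation G N = lin_ext (\<lambda>c.
     let (P, \<phi>) = rep c; U = \<Union>P in
     Poly_Mapping.single (mclass G (U, dual_map (G\<lparr>carrier := U\<rparr>) (\<lambda>x. N #>\<^bsub>G\<^esub> x) \<phi>)) 1)"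

text \<open>
  The pair \<open>(HN/N, \<Phi>\<^sub>N)\<close>. The canonical isomorphism \<open>\<alpha> : H/(H \<inter> N) \<rightarrow> HN/N\<close>
  maps the coset \<open>X = (H \<inter> N)h\<close> to \<open>Nh = NX\<close>.
\<close>

definition spair_quot :: "('a, 'c) monoid_scheme \<Rightarrow> ('g, 'b) monoid_scheme \<Rightarrow> 'g set \<Rightarrow>
    ('g, 'a, 'k::field) spair \<Rightarrow> ('g set, 'a, 'k) spair" where
  "spair_quot A G N p =
     (let H = fst p; \<Phi> = snd p;
          HN_N = quot G (H <#>\<^bsub>G\<^esub> N) N;
          H_grp = G\<lparr>carrier := H\<rparr>;
          \<nu> = (\<lambda>h. (H \<inter> N) #>\<^bsub>G\<^esub> h);
          \<alpha> = (\<lambda>X. N <#>\<^bsub>G\<^esub> X)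
      in (HN_N,
          \<lambda>\<phi>\<in>carrier (dual_group A ((G Mod N)\<lparr>carrier := HN_N\<rparr>)).
            \<Phi> (dual_map H_grp \<nu> (dual_map (H_grp Mod (H \<inter> N)) \<alpha> \<phi>))))"

end

theory Submission
  imports Defs "HOL-Algebra.Multiplicative_Group" "Jordan_Normal_Form.Determinant"
begin

text \<open>
  The species of a basis element \<open>[U, \<phi>]\<close> at \<open>(H, \<Phi>)\<close> is an average: a double coset \<open>HgU\<close>
  contributes to \<open>\<pi>\<^sub>H (res [U, \<phi>])\<close> only if \<open>H \<le> gUg\<^sup>-\<^sup>1\<close>, and then it is the single coset \<open>gU\<close>
  with \<open>\<bar>U\<bar>\<close> elements. So the value is \<open>1/\<bar>U\<bar>\<close> times the sum of \<open>\<Phi> ((g\<phi>)|\<^sub>H)\<close> over all \<open>g\<close> in \<open>G\<close> with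
  \<open>H \<le> gUg\<^sup>-\<^sup>1\<close>, which involves no choice of representatives (\<open>species_eq_lin_form_mark\<close>,
  \<open>species_single\<close>). Most of the proof manipulates this sum by substitutions in the group.

  For part (a), let \<open>N \<le> U\<close> and let \<open>\<phi>\<close> come from \<open>U/N\<close>. Then \<open>H \<le> gUg\<^sup>-\<^sup>1\<close> holds exactly if \<open>HN/N\<close>
  lies in the conjugate of \<open>U/N\<close> by \<open>gN\<close>, and the summand at \<open>g\<close> is the summand at \<open>gN\<close> for the pair
  \<open>(HN/N, \<Phi>\<^sub>N)\<close> (\<open>local_value_inflate\<close>). Each coset of \<open>N\<close> is counted \<open>\<bar>N\<bar>\<close> times, and
  \<open>\<bar>U\<bar> = \<bar>N\<bar> \<bar>U/N\<bar>\<close>, so the averages agree (\<open>mark_inflate\<close>, \<open>species_inflation\<close>).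

  For part (b), elements of the algebra are determined by their species (\<open>species_separate\<close>), and by
  (a) both sides have species \<open>1\<close> at those \<open>(H, \<Phi>)\<close> for which \<open>(HN/N, \<Phi>\<^sub>N)\<close> is conjugate to
  \<open>(U/N, \<Psi>)\<close>, and species \<open>0\<close> at the others. This uses that the description which defines
  the idempotent of a pair determines a unique element (\<open>idem_characterization\<close>), for \<open>G\<close> as well as
  for \<open>G/N\<close>.
  Three facts give this. Species are multiplicative (\<open>species_bmult\<close>), so that an element whose
  species are \<open>0\<close> or \<open>1\<close> is idempotent as soon as species separate elements. Every indicator of an
  orbit is attained: Moebius inversion over the subgroups of \<open>U\<close> removes the proper inclusions
  \<open>H < gUg\<^sup>-\<^sup>1\<close> from the sum above (\<open>moebius_element_exists\<close>), and orthogonality of characters of \<open>H\<^sup>*\<close>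
  then isolates \<open>\<Phi>\<close> (\<open>orbit_indicator_exists\<close>). Finally species separate elements because the matrix
  of the coefficients of \<open>\<pi>\<^sub>H \<circ> res\<close> is triangular with respect to inclusion, and because the
  characters of \<open>H\<^sup>*\<close> recover an element of \<open>KH\<^sup>*\<close>.

  The last point is the one where the splitting field matters. It is used only through its consequence
  that the characters of a finite abelian group with values in it separate the points of the group
  (\<open>splitting_field_separates_points\<close>).
\<close>

section \<open>Restricting a matrix representation to an invariant subspace\<close>

text \<open>
  If there were more columns than rows, then \<open>Q\<close> could be padded by zero rows to a square matrix. Its
  determinant vanishes, so it has a nonzero kernel vector, which \<open>Q\<close> also annihilates.
\<close>

lemma injective_mat_cols_le_rows:
  fixes Q :: "'k::field mat"
  assumes Q: "Q \<in> carrier_mat n k" and inj: "\<And>c. c \<in> carrier_vec k \<Longrightarrow> Q *\<^sub>v c = 0\<^sub>v n \<Longrightarrow> c = 0\<^sub>v k"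
  shows "k \<le> n"
proof (rule ccontr)
  assume "\<not> k \<le> n"
  then have nk: "n < k" by simp
  define A where "A = mat k k (\<lambda>(i,j). if i < n then Q $$ (i,j) else 0)"
  have A: "A \<in> carrier_mat k k" by (simp add: A_def)
  have "transpose_mat A *\<^sub>v unit_vec k n = 0\<^sub>v k"
    using nk by (intro eq_vecI) (auto simp: A_def scalar_prod_def intro!: sum.neutral)
  moreover have "unit_vec k n \<noteq> (0\<^sub>v k :: 'k vec)" using nk by simp
  ultimately have "det (transpose_mat A) = 0"
    using det_0_iff_vec_prod_zero_field[of "transpose_mat A" k] A by (blast intro: transpose_carrier_mat[THEN iffD2] unit_vec_carrier)
  then have "det A = 0" using det_transpose[OF A] by simp
  then obtain v where v: "v \<in> carrier_vec k" "v \<noteq> 0\<^sub>v k" "A *\<^sub>v v = 0\<^sub>v k"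
    using det_0_iff_vec_prod_zero_field[OF A] by auto
  have "Q *\<^sub>v v = 0\<^sub>v n"
  proof (rule eq_vecI)
    fix i assume i: "i < dim_vec (0\<^sub>v n :: 'k vec)"
    have "(Q *\<^sub>v v) $ i = (A *\<^sub>v v) $ i"
      using i nk Q v(1) by (auto simp: A_def scalar_prod_def)
    then show "(Q *\<^sub>v v) $ i = 0\<^sub>v n $ i" using v(3) i nk by simp
  qed (use Q in auto)
  with inj v show False by blast
qed

lemma injective_square_mat_surj:
  fixes Q :: "'k::field mat"
  assumes Q: "Q \<in> carrier_mat n n" and inj: "\<And>c. c \<in> carrier_vec n \<Longrightarrow> Q *\<^sub>v c = 0\<^sub>v n \<Longrightarrow> c = 0\<^sub>v n"
  shows "(\<lambda>c. Q *\<^sub>v c) ` carrier_vec n = carrier_vec n"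
proof
  show "(\<lambda>c. Q *\<^sub>v c) ` carrier_vec n \<subseteq> carrier_vec n" using Q by auto
  have "det Q \<noteq> 0" using det_0_iff_vec_prod_zero_field[OF Q] inj by auto
  from det_non_zero_imp_unit[OF Q this, of undefined] obtain B where B: "B \<in> carrier_mat n n" "Q * B = 1\<^sub>m n"
    unfolding Units_def by (auto simp: ring_mat_def)
  show "carrier_vec n \<subseteq> (\<lambda>c. Q *\<^sub>v c) ` carrier_vec n"
  proof
    fix v :: "'k vec" assume v: "v \<in> carrier_vec n"
    have "v = Q *\<^sub>v (B *\<^sub>v v)" using Q B v by (simp flip: assoc_mult_mat_vec)
    then show "v \<in> (\<lambda>c. Q *\<^sub>v c) ` carrier_vec n" by (rule image_eqI) (use B v in auto)
  qed
qed

text \<open>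
  Bases are represented by injective matrices, whose columns are the basis vectors. Such a matrix with
  image in \<open>W\<close> can be enlarged by any vector of \<open>W\<close> outside its image, and this process stops because
  an injective matrix has at most as many columns as rows.
\<close>

lemma subspace_basis_matrix:
  fixes W :: "'k::field vec set"
  assumes W: "W \<subseteq> carrier_vec n" "0\<^sub>v n \<in> W" "\<And>v w. v \<in> W \<Longrightarrow> w \<in> W \<Longrightarrow> v + w \<in> W"
    "\<And>c w. w \<in> W \<Longrightarrow> c \<cdot>\<^sub>v w \<in> W"
    and proper: "W \<noteq> carrier_vec n"
  obtains k Q where "k < n" "Q \<in> carrier_mat n k"
    "\<And>c. c \<in> carrier_vec k \<Longrightarrow> Q *\<^sub>v c = 0\<^sub>v n \<Longrightarrow> c = 0\<^sub>v k"
    "W = (\<lambda>c. Q *\<^sub>v c) ` carrier_vec k"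
proof -
  define P where "P k Q \<longleftrightarrow> Q \<in> carrier_mat n k \<and> (\<forall>c\<in>carrier_vec k. Q *\<^sub>v c = 0\<^sub>v n \<longrightarrow> c = 0\<^sub>v k)
      \<and> (\<lambda>c. Q *\<^sub>v c) ` carrier_vec k \<subseteq> W" for k and Q :: "'k mat"
  have P0: "P 0 (0\<^sub>m n 0)"
  proof -
    have "0\<^sub>m n 0 *\<^sub>v c = (0\<^sub>v n :: 'k vec)" if "c \<in> carrier_vec 0" for c :: "'k vec"
      using that by (intro eq_vecI) (auto simp: scalar_prod_def)
    then show ?thesis unfolding P_def using W(2) by auto
  qed
  have "\<exists>k. (\<exists>Q. P k Q) \<and> \<not> (\<exists>Q. P (Suc k) Q)"
  proof (rule ccontr)
    assume *: "\<not> ?thesis"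
    have "\<exists>Q. P k Q" for k by (induction k) (use P0 * in blast)+
    from this[of "Suc n"] obtain Q where "P (Suc n) Q" ..
    then have "Suc n \<le> n" unfolding P_def by (intro injective_mat_cols_le_rows) auto
    then show False by simp
  qed
  then obtain k Q where PQ: "P k Q" and max: "\<And>Q'. \<not> P (Suc k) Q'" by blast
  from PQ have Q: "Q \<in> carrier_mat n k"
    and inj: "\<And>c. c \<in> carrier_vec k \<Longrightarrow> Q *\<^sub>v c = 0\<^sub>v n \<Longrightarrow> c = 0\<^sub>v k"
    and sub: "\<And>c. c \<in> carrier_vec k \<Longrightarrow> Q *\<^sub>v c \<in> W" unfolding P_def by auto
  have img: "W = (\<lambda>c. Q *\<^sub>v c) ` carrier_vec k"
  proof (rule ccontr)
    assume "\<not> ?thesis"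
    then obtain w where w: "w \<in> W" and notin: "w \<notin> (\<lambda>c. Q *\<^sub>v c) ` carrier_vec k" using sub by blast
    have wc: "w \<in> carrier_vec n" using w W(1) by auto
    define Q' where "Q' = mat n (Suc k) (\<lambda>(i,j). if j < k then Q $$ (i,j) else w $ i)"
    have Q': "Q' \<in> carrier_mat n (Suc k)" by (simp add: Q'_def)
    have split: "Q' *\<^sub>v c = Q *\<^sub>v vec_first c k + c $ k \<cdot>\<^sub>v w" if c: "c \<in> carrier_vec (Suc k)" for c
      using c Q wc by (intro eq_vecI) (auto simp: Q'_def scalar_prod_def vec_first_def mult.commute)
    have "P (Suc k) Q'" unfolding P_def
    proof (intro conjI ballI impI)
      show "Q' \<in> carrier_mat n (Suc k)" by fact
      show "(\<lambda>c. Q' *\<^sub>v c) ` carrier_vec (Suc k) \<subseteq> W"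
      proof
        fix v assume "v \<in> (\<lambda>c. Q' *\<^sub>v c) ` carrier_vec (Suc k)"
        then obtain c where c: "c \<in> carrier_vec (Suc k)" "v = Q' *\<^sub>v c" by blast
        have "Q *\<^sub>v vec_first c k \<in> W" by (rule sub) simp
        then show "v \<in> W" unfolding c(2) split[OF c(1)] using W(3,4) w by blast
      qed
      fix c assume c: "c \<in> carrier_vec (Suc k)" and z: "Q' *\<^sub>v c = 0\<^sub>v n"
      let ?d = "vec_first c k"
      have eq: "Q *\<^sub>v ?d + c $ k \<cdot>\<^sub>v w = 0\<^sub>v n" using split[OF c] z by simp
      have ck: "c $ k = 0"
      proof (rule ccontr)
        assume nz: "c $ k \<noteq> 0"
        have "w = (- inverse (c $ k)) \<cdot>\<^sub>v (Q *\<^sub>v ?d)"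
        proof (rule eq_vecI)
          fix i assume "i < dim_vec ((- inverse (c $ k)) \<cdot>\<^sub>v (Q *\<^sub>v ?d))"
          then have i: "i < n" using Q by simp
          have "(Q *\<^sub>v ?d) $ i + c $ k * w $ i = 0" using arg_cong[OF eq, of "\<lambda>v. v $ i"] i Q wc by simp
          then have "(Q *\<^sub>v ?d) $ i = - (c $ k * w $ i)" by (simp add: eq_neg_iff_add_eq_0)
          then show "w $ i = ((- inverse (c $ k)) \<cdot>\<^sub>v (Q *\<^sub>v ?d)) $ i"
            using i Q nz by simp
        qed (use wc Q in auto)
        also have "\<dots> = Q *\<^sub>v ((- inverse (c $ k)) \<cdot>\<^sub>v ?d)" using Q by (simp add: mult_mat_vec)
        finally show False using notin by auto
      qed
      have "Q *\<^sub>v ?d = 0\<^sub>v n"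
      proof (rule eq_vecI)
        fix i assume "i < dim_vec (0\<^sub>v n :: 'k vec)"
        then show "(Q *\<^sub>v ?d) $ i = 0\<^sub>v n $ i"
          using arg_cong[OF eq, of "\<lambda>v. v $ i"] ck Q wc by simp
      qed (use Q in auto)
      then have "?d = 0\<^sub>v k" using inj by simp
      then have "c $ i = 0" if "i < k" for i
      proof -
        from \<open>?d = 0\<^sub>v k\<close> have "?d $ i = 0\<^sub>v k $ i" by (rule arg_cong)
        then show ?thesis using that by (simp add: vec_first_def)
      qed
      with ck show "c = 0\<^sub>v (Suc k)" using c by (intro eq_vecI) (auto simp: less_Suc_eq)
    qed
    with max show False by blast
  qed
  have "k \<le> n" using injective_mat_cols_le_rows[OF Q inj] .
  moreover have "k \<noteq> n" using injective_square_mat_surj[of Q n] Q inj img proper by auto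
  ultimately show thesis using that[of k Q] Q inj img by auto
qed

text \<open>
  If the columns of \<open>Q\<close> form a basis of \<open>W\<close>, then \<open>\<rho> x * Q = Q * \<rho>' x\<close> says that \<open>\<rho>' x\<close> is the matrix
  of \<open>\<rho> x\<close> on \<open>W\<close>. Injectivity of \<open>Q\<close> makes it unique, hence multiplicative in \<open>x\<close>.
\<close>

lemma restrict_matrix_rep:
  fixes \<rho> :: "'x \<Rightarrow> 'k::field mat"
  assumes X: "group X" and rep: "matrix_rep X n \<rho>" and inv: "invariant_subspace X n \<rho> W"
    and proper: "W \<noteq> carrier_vec n"
  obtains k \<rho>' Q where "k < n" "matrix_rep X k \<rho>'" "Q \<in> carrier_mat n k"
    "W = (\<lambda>c. Q *\<^sub>v c) ` carrier_vec k" "\<And>x. x \<in> carrier X \<Longrightarrow> \<rho> x * Q = Q * \<rho>' x"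
proof -
  interpret X: group X by fact
  have WW: "W \<subseteq> carrier_vec n" "0\<^sub>v n \<in> W" "\<And>v w. v \<in> W \<Longrightarrow> w \<in> W \<Longrightarrow> v + w \<in> W"
    "\<And>c w. w \<in> W \<Longrightarrow> c \<cdot>\<^sub>v w \<in> W" and Wx: "\<And>x w. x \<in> carrier X \<Longrightarrow> w \<in> W \<Longrightarrow> \<rho> x *\<^sub>v w \<in> W"
    using inv unfolding invariant_subspace_def by auto
  obtain k Q where k: "k < n" and Q: "Q \<in> carrier_mat n k"
    and inj: "\<And>c. c \<in> carrier_vec k \<Longrightarrow> Q *\<^sub>v c = 0\<^sub>v n \<Longrightarrow> c = 0\<^sub>v k"
    and img: "W = (\<lambda>c. Q *\<^sub>v c) ` carrier_vec k"
    using subspace_basis_matrix[OF WW proper] by blast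
  have \<rho>: "\<rho> x \<in> carrier_mat n n" if "x \<in> carrier X" for x
    using rep that unfolding matrix_rep_def by auto
  have cancel: "B = C" if B: "B \<in> carrier_mat k k" and C: "C \<in> carrier_mat k k" and eq: "Q * B = Q * C" for B C
  proof (rule eq_matI)
    fix i j assume "i < dim_row C" "j < dim_col C"
    then have ij: "i < k" "j < k" using C by auto
    have "Q *\<^sub>v col B j = Q *\<^sub>v col C j" using eq ij Q B C by (metis carrier_matD(2) col_mult2)
    then have "Q *\<^sub>v (col B j - col C j) = 0\<^sub>v n"
      using Q B C ij by (subst mult_minus_distrib_mat_vec[of _ n k]) auto
    then have "col B j - col C j = 0\<^sub>v k"
      using B C ij by (intro inj) auto
    then have "(col B j - col C j) $ i = 0" using ij by simp
    then show "B $$ (i,j) = C $$ (i,j)" using ij B C by simp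
  qed (use B C in auto)
  have "\<exists>B. x \<in> carrier X \<longrightarrow> B \<in> carrier_mat k k \<and> \<rho> x * Q = Q * B" for x
  proof (cases "x \<in> carrier X")
    case x: True
    have "\<exists>c. c \<in> carrier_vec k \<and> \<rho> x *\<^sub>v col Q j = Q *\<^sub>v c" if j: "j < k" for j
    proof -
      have "col Q j = Q *\<^sub>v unit_vec k j" using Q j by (intro eq_vecI) (auto simp: scalar_prod_right_unit)
      then have "col Q j \<in> W" using img by simp
      from Wx[OF x this] show ?thesis using img by auto
    qed
    then obtain c where c: "\<And>j. j < k \<Longrightarrow> c j \<in> carrier_vec k \<and> \<rho> x *\<^sub>v col Q j = Q *\<^sub>v c j" by metis
    define B where "B = mat k k (\<lambda>(i,j). c j $ i)"
    have colB: "col B j = c j" if "j < k" for j using c[OF that] that by (intro eq_vecI) (auto simp: B_def)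
    have "\<rho> x * Q = Q * B"
    proof (rule eq_matI)
      fix i j assume "i < dim_row (Q * B)" "j < dim_col (Q * B)"
      then have ij: "i < n" "j < k" using Q by (auto simp: B_def)
      have "(\<rho> x * Q) $$ (i,j) = (\<rho> x *\<^sub>v col Q j) $ i" using ij Q \<rho>[OF x] by simp
      also have "\<dots> = (Q *\<^sub>v col B j) $ i" using c ij colB by simp
      also have "\<dots> = (Q * B) $$ (i,j)" using ij Q by (simp add: B_def)
      finally show "(\<rho> x * Q) $$ (i,j) = (Q * B) $$ (i,j)" .
    qed (use Q \<rho>[OF x] in \<open>auto simp: B_def\<close>)
    then show ?thesis by (intro exI[of _ B]) (simp add: B_def)
  qed auto
  then obtain \<rho>' where \<rho>': "\<And>x. x \<in> carrier X \<Longrightarrow> \<rho>' x \<in> carrier_mat k k \<and> \<rho> x * Q = Q * \<rho>' x"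
    by metis
  have "matrix_rep X k \<rho>'" unfolding matrix_rep_def
  proof (intro conjI ballI)
    show "\<rho>' \<in> carrier X \<rightarrow> carrier_mat k k" using \<rho>' by auto
    have "Q * \<rho>' \<one>\<^bsub>X\<^esub> = Q * 1\<^sub>m k" using \<rho>'[of "\<one>\<^bsub>X\<^esub>"] rep Q unfolding matrix_rep_def by auto
    then show "\<rho>' \<one>\<^bsub>X\<^esub> = 1\<^sub>m k" using cancel \<rho>' by auto
    fix x y assume x: "x \<in> carrier X" and y: "y \<in> carrier X"
    have "Q * \<rho>' (x \<otimes>\<^bsub>X\<^esub> y) = \<rho> x * \<rho> y * Q"
      using \<rho>'[of "x \<otimes>\<^bsub>X\<^esub> y"] x y rep unfolding matrix_rep_def by auto
    also have "\<dots> = \<rho> x * (\<rho> y * Q)" using \<rho> x y Q by (intro assoc_mult_mat) auto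
    also have "\<dots> = \<rho> x * (Q * \<rho>' y)" using \<rho>' y by simp
    also have "\<dots> = \<rho> x * Q * \<rho>' y"
      using assoc_mult_mat[OF \<rho>[OF x] Q, of "\<rho>' y" k] \<rho>'[OF y] by simp
    also have "\<dots> = Q * \<rho>' x * \<rho>' y" using \<rho>' x by simp
    also have "\<dots> = Q * (\<rho>' x * \<rho>' y)"
      using assoc_mult_mat[OF Q, of "\<rho>' x" k "\<rho>' y" k] \<rho>'[OF y] \<rho>'[OF x] by simp
    finally have eq: "Q * \<rho>' (x \<otimes>\<^bsub>X\<^esub> y) = Q * (\<rho>' x * \<rho>' y)" .
    have "\<rho>' (x \<otimes>\<^bsub>X\<^esub> y) \<in> carrier_mat k k" "\<rho>' x * \<rho>' y \<in> carrier_mat k k"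
      using \<rho>'[of x] \<rho>'[of y] \<rho>'[OF X.m_closed[OF x y]] x y by auto
    then show "\<rho>' (x \<otimes>\<^bsub>X\<^esub> y) = \<rho>' x * \<rho>' y" using eq by (rule cancel)
  qed
  then show thesis using that[of k \<rho>' Q] k Q img \<rho>' by simp
qed

section \<open>A splitting field has enough characters\<close>

definition separates_points :: "'k::field itself \<Rightarrow> ('x, 'b) monoid_scheme \<Rightarrow> bool" where
  "separates_points _ X \<longleftrightarrow>
     (\<forall>x\<in>carrier X. x \<noteq> \<one>\<^bsub>X\<^esub> \<longrightarrow> (\<exists>\<chi>\<in>ext_hom X (field_units :: 'k monoid). \<chi> x \<noteq> 1))"

lemma ext_hom_field_units_iff:
  "\<chi> \<in> ext_hom X (field_units :: 'k::field monoid) \<longleftrightarrow>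
     (\<forall>x\<in>carrier X. \<chi> x \<noteq> 0) \<and> (\<forall>x\<in>carrier X. \<forall>y\<in>carrier X. \<chi> (x \<otimes>\<^bsub>X\<^esub> y) = \<chi> x * \<chi> y) \<and>
     \<chi> \<in> extensional (carrier X)"
  unfolding ext_hom_def hom_def field_units_def by (auto simp: Pi_iff)

text \<open>
  The regular representation, by permutation matrices, is faithful.
\<close>

lemma regular_matrix_rep:
  fixes X :: "('x, 'b) monoid_scheme"
  assumes "group X" "finite (carrier X)" "x \<in> carrier X" "x \<noteq> \<one>\<^bsub>X\<^esub>"
  shows "\<exists>n. \<exists>\<rho> :: 'x \<Rightarrow> 'k::field mat. matrix_rep X n \<rho> \<and> \<rho> x \<noteq> 1\<^sub>m n"
proof -
  interpret X: group X by fact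
  define n where "n = card (carrier X)"
  obtain e where e: "bij_betw e {0..<n} (carrier X)"
    using ex_bij_betw_nat_finite[OF assms(2)] unfolding n_def by blast
  have ec: "e i \<in> carrier X" if "i < n" for i using e that by (auto simp: bij_betw_def)
  have einj: "e i = e j \<longleftrightarrow> i = j" if "i < n" "j < n" for i j
    using e that by (auto simp: bij_betw_def inj_on_def)
  have esurj: "\<exists>i<n. y = e i" if "y \<in> carrier X" for y
    using bij_betw_imp_surj_on[OF e] that by (metis atLeastLessThan_iff imageE)
  have n0: "0 < n" using assms(2) X.one_closed unfolding n_def by (auto simp: card_gt_0_iff)
  \<comment> \<open>The permutation matrices of left multiplication, for the enumeration \<open>e\<close> of \<open>X\<close>.\<close>
  define \<rho> :: "'x \<Rightarrow> 'k mat" where "\<rho> x = mat n n (\<lambda>(i,j). if e i = x \<otimes>\<^bsub>X\<^esub> e j then 1 else 0)" for x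
  have "matrix_rep X n \<rho>" unfolding matrix_rep_def
  proof (intro conjI ballI)
    show "\<rho> \<in> carrier X \<rightarrow> carrier_mat n n" by (simp add: \<rho>_def)
    show "\<rho> \<one>\<^bsub>X\<^esub> = 1\<^sub>m n" by (rule eq_matI) (auto simp: \<rho>_def ec einj)
    fix x y assume x: "x \<in> carrier X" and y: "y \<in> carrier X"
    show "\<rho> (x \<otimes>\<^bsub>X\<^esub> y) = \<rho> x * \<rho> y"
    proof (rule eq_matI)
      fix i j assume "i < dim_row (\<rho> x * \<rho> y)" "j < dim_col (\<rho> x * \<rho> y)"
      then have ij: "i < n" "j < n" by (auto simp: \<rho>_def)
      obtain l where l: "l < n" "y \<otimes>\<^bsub>X\<^esub> e j = e l" using esurj[of "y \<otimes>\<^bsub>X\<^esub> e j"] y ec[OF ij(2)] by auto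
      have "(\<rho> x * \<rho> y) $$ (i,j) = (\<Sum>k = 0..<n. (if e i = x \<otimes>\<^bsub>X\<^esub> e k then 1 else 0) * (if e k = e l then 1 else 0))"
        using ij by (simp add: \<rho>_def scalar_prod_def l)
      also have "\<dots> = (\<Sum>k = 0..<n. if k = l then (if e i = x \<otimes>\<^bsub>X\<^esub> e k then 1 else 0) else 0)"
        by (rule sum.cong) (auto simp: einj l)
      also have "\<dots> = (if e i = x \<otimes>\<^bsub>X\<^esub> e l then 1 else 0)" using l by simp
      also have "\<dots> = \<rho> (x \<otimes>\<^bsub>X\<^esub> y) $$ (i,j)"
        using ij x y ec by (simp add: \<rho>_def X.m_assoc l)
      finally show "\<rho> (x \<otimes>\<^bsub>X\<^esub> y) $$ (i,j) = (\<rho> x * \<rho> y) $$ (i,j)" by simp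
    qed (auto simp: \<rho>_def)
  qed
  moreover have "\<rho> x \<noteq> 1\<^sub>m n"
  proof
    assume "\<rho> x = 1\<^sub>m n"
    then have "\<rho> x $$ (0,0) = 1\<^sub>m n $$ (0,0)" by (rule arg_cong)
    then have "e 0 = x \<otimes>\<^bsub>X\<^esub> e 0" using n0 by (simp add: \<rho>_def split: if_splits)
    then show False using assms(3,4) ec[OF n0] by (simp add: X.l_cancel_one')
  qed
  ultimately show ?thesis by blast
qed

text \<open>
  Write \<open>T\<close> for the action of \<open>x\<close>. By minimality \<open>T\<close> is the identity on every proper invariant
  subspace. Since \<open>X\<close> is abelian, the image of \<open>T - 1\<close> is invariant. Were it proper, \<open>T\<close> would act
  unipotently, and a unipotent matrix of finite order is trivial in characteristic \<open>0\<close>. So \<open>T - 1\<close> is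
  onto, and a vector \<open>w = Tv - v\<close> of a proper invariant subspace is fixed by \<open>T\<close>, which by the same
  argument forces \<open>w = 0\<close>.
\<close>

lemma minimal_rep_irreducible:
  fixes \<rho> :: "'x \<Rightarrow> 'k::field_char_0 mat"
  assumes "comm_group X" "finite (carrier X)" and x: "x \<in> carrier X"
    and rep: "matrix_rep X n \<rho>" and nontriv: "\<rho> x \<noteq> 1\<^sub>m n"
    and min: "\<And>k (\<rho>' :: 'x \<Rightarrow> 'k mat). k < n \<Longrightarrow> matrix_rep X k \<rho>' \<Longrightarrow> \<rho>' x = 1\<^sub>m k"
  shows "irreducible_rep X n \<rho>"
proof -
  interpret X: comm_group X by fact
  have \<rho>: "\<rho> y \<in> carrier_mat n n" if "y \<in> carrier X" for y
    using rep that unfolding matrix_rep_def by auto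
  have mult: "\<rho> (y \<otimes>\<^bsub>X\<^esub> z) *\<^sub>v v = \<rho> y *\<^sub>v (\<rho> z *\<^sub>v v)"
    if "y \<in> carrier X" "z \<in> carrier X" "v \<in> carrier_vec n" for y z v
    using that rep assoc_mult_mat_vec[OF \<rho>[OF that(1)] \<rho>[OF that(2)] that(3)]
    unfolding matrix_rep_def by simp
  have proper_fixed: "\<rho> x *\<^sub>v w = w"
    if inv: "invariant_subspace X n \<rho> W" and "W \<noteq> carrier_vec n" and w: "w \<in> W" for W w
  proof -
    obtain k \<rho>' Q where k: "k < n" "matrix_rep X k \<rho>'" and Q: "Q \<in> carrier_mat n k"
      and W: "W = (\<lambda>c. Q *\<^sub>v c) ` carrier_vec k" and comm: "\<And>x. x \<in> carrier X \<Longrightarrow> \<rho> x * Q = Q * \<rho>' x"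
      using restrict_matrix_rep[OF X.group_axioms rep inv \<open>W \<noteq> carrier_vec n\<close>] by blast
    have "\<rho> x * Q = Q" using comm[OF x] min[OF k] Q by simp
    moreover obtain c where "c \<in> carrier_vec k" "w = Q *\<^sub>v c" using w W by blast
    ultimately show ?thesis using \<rho>[OF x] Q by (metis assoc_mult_mat_vec)
  qed
  \<comment> \<open>If \<open>T\<close> fixes \<open>w = Tv - v\<close>, then \<open>T\<^sup>j v = v + jw\<close>; for \<open>j\<close> the order of \<open>X\<close> this gives \<open>w = 0\<close>.\<close>
  have unipotent: "\<rho> x *\<^sub>v v = v"
    if v: "v \<in> carrier_vec n" and diff_fixed: "\<rho> x *\<^sub>v (\<rho> x *\<^sub>v v - v) = \<rho> x *\<^sub>v v - v" for v
  proof -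
    define w where "w = \<rho> x *\<^sub>v v - v"
    have w: "w \<in> carrier_vec n" using \<rho>[OF x] v by (simp add: w_def)
    have xv: "\<rho> x *\<^sub>v v = v + w" using \<rho>[OF x] v by (intro eq_vecI) (auto simp: w_def)
    have pow: "\<rho> (x [^]\<^bsub>X\<^esub> j) *\<^sub>v v = v + of_nat j \<cdot>\<^sub>v w" for j :: nat
    proof (induction j)
      case 0
      have "\<rho> (x [^]\<^bsub>X\<^esub> (0::nat)) *\<^sub>v v = v" using rep v unfolding matrix_rep_def by simp
      also have "\<dots> = v + of_nat 0 \<cdot>\<^sub>v w" using v w by (intro eq_vecI) auto
      finally show ?case .
    next
      case (Suc j)
      have "\<rho> (x [^]\<^bsub>X\<^esub> Suc j) *\<^sub>v v = \<rho> x *\<^sub>v (v + of_nat j \<cdot>\<^sub>v w)"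
        using x v Suc by (subst X.nat_pow_Suc2) (simp_all add: mult)
      also have "\<dots> = (v + w) + of_nat j \<cdot>\<^sub>v w"
        using \<rho>[OF x] v w xv diff_fixed[folded w_def]
        by (simp add: mult_add_distrib_mat_vec[of _ n n] mult_mat_vec[of _ n n])
      also have "\<dots> = v + of_nat (Suc j) \<cdot>\<^sub>v w" using v w by (intro eq_vecI) (auto simp: algebra_simps)
      finally show ?case .
    qed
    have "x [^]\<^bsub>X\<^esub> Coset.order X = \<one>\<^bsub>X\<^esub>" using x by (rule X.pow_order_eq_1)
    then have eq: "v = v + of_nat (Coset.order X) \<cdot>\<^sub>v w" using pow[of "Coset.order X"] rep v unfolding matrix_rep_def by simp
    have "Coset.order X \<noteq> 0" using X.order_gt_0_iff_finite assms(2) by simp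
    have "w $ i = 0" if "i < n" for i
      using arg_cong[OF eq, of "\<lambda>u. u $ i"] that v w \<open>Coset.order X \<noteq> 0\<close> by simp
    then have "v + w = v" using v w by (intro eq_vecI) auto
    with xv show ?thesis by simp
  qed
  define W0 where "W0 = (\<lambda>v. \<rho> x *\<^sub>v v - v) ` carrier_vec n"
  have W0c: "W0 \<subseteq> carrier_vec n" using \<rho>[OF x] by (auto simp: W0_def)
  have inv0: "invariant_subspace X n \<rho> W0" unfolding invariant_subspace_def
  proof (intro conjI ballI allI)
    show "W0 \<subseteq> carrier_vec n" by fact
    show "0\<^sub>v n \<in> W0" unfolding W0_def by (rule image_eqI[of _ _ "0\<^sub>v n"]) (use \<rho>[OF x] in auto)
    fix u assume "u \<in> W0"
    then obtain v where v: "v \<in> carrier_vec n" "u = \<rho> x *\<^sub>v v - v" by (auto simp: W0_def)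
    { fix u' assume "u' \<in> W0"
      then obtain v' where v': "v' \<in> carrier_vec n" "u' = \<rho> x *\<^sub>v v' - v'" by (auto simp: W0_def)
      have "u + u' = \<rho> x *\<^sub>v (v + v') - (v + v')"
        using v v' \<rho>[OF x] by (simp add: mult_add_distrib_mat_vec[of _ n n]) (intro eq_vecI, auto)
      then show "u + u' \<in> W0" using v v' by (auto simp: W0_def) }
    { fix c
      have "c \<cdot>\<^sub>v u = \<rho> x *\<^sub>v (c \<cdot>\<^sub>v v) - c \<cdot>\<^sub>v v"
        using v \<rho>[OF x] by (simp add: mult_mat_vec[of _ n n]) (intro eq_vecI, auto simp: algebra_simps)
      then show "c \<cdot>\<^sub>v u \<in> W0" using v by (auto simp: W0_def) }
    { fix y assume y: "y \<in> carrier X"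
      have "\<rho> y *\<^sub>v u = \<rho> y *\<^sub>v (\<rho> x *\<^sub>v v) - \<rho> y *\<^sub>v v"
        using v \<rho>[OF x] \<rho>[OF y] by (simp add: mult_minus_distrib_mat_vec[of _ n n])
      also have "\<rho> y *\<^sub>v (\<rho> x *\<^sub>v v) = \<rho> x *\<^sub>v (\<rho> y *\<^sub>v v)"
        using mult[OF y x v(1)] mult[OF x y v(1)] X.m_comm[OF x y] by simp
      finally show "\<rho> y *\<^sub>v u \<in> W0" using v \<rho>[OF y] by (auto simp: W0_def) }
  qed
  have not_fixed: "\<exists>v\<in>carrier_vec n. \<rho> x *\<^sub>v v \<noteq> v"
  proof (rule ccontr)
    assume *: "\<not> ?thesis"
    have "\<rho> x = 1\<^sub>m n"
    proof (rule eq_matI)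
      fix i j assume "i < dim_row (1\<^sub>m n :: 'k mat)" "j < dim_col (1\<^sub>m n :: 'k mat)"
      then have ij: "i < n" "j < n" by auto
      have "\<rho> x *\<^sub>v unit_vec n j = unit_vec n j" using * by (meson unit_vec_carrier)
      then have "(\<rho> x *\<^sub>v unit_vec n j) $ i = unit_vec n j $ i" by simp
      then show "\<rho> x $$ (i, j) = 1\<^sub>m n $$ (i, j)" using ij \<rho>[OF x] by (simp add: scalar_prod_right_unit)
    qed (use \<rho>[OF x] in auto)
    with nontriv show False by simp
  qed
  have W0: "W0 = carrier_vec n"
  proof (rule ccontr)
    assume ne: "W0 \<noteq> carrier_vec n"
    have "\<rho> x *\<^sub>v v = v" if v: "v \<in> carrier_vec n" for v
    proof -
      have "\<rho> x *\<^sub>v v - v \<in> W0" using v unfolding W0_def by (rule imageI)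
      then show ?thesis using unipotent[OF v] proper_fixed[OF inv0 ne] by blast
    qed
    with not_fixed show False by blast
  qed
  have "n > 0" using nontriv \<rho>[OF x] by (intro gr0I) (auto intro!: eq_matI)
  moreover have "W = {0\<^sub>v n} \<or> W = carrier_vec n" if inv: "invariant_subspace X n \<rho> W" for W
  proof (rule ccontr)
    assume "\<not> ?thesis"
    then obtain w where w: "w \<in> W" "w \<noteq> 0\<^sub>v n" and proper: "W \<noteq> carrier_vec n"
      using inv unfolding invariant_subspace_def by blast
    have wc: "w \<in> carrier_vec n" using w(1) inv unfolding invariant_subspace_def by blast
    have fixed: "\<rho> x *\<^sub>v w = w" by (rule proper_fixed[OF inv proper w(1)])
    obtain v where v: "v \<in> carrier_vec n" "w = \<rho> x *\<^sub>v v - v" 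
      using wc W0 unfolding W0_def by blast
    have "\<rho> x *\<^sub>v v = v" using unipotent[OF v(1)] fixed v(2) by simp
    then have "w = 0\<^sub>v n" using v by (simp)
    with w show False by simp
  qed
  ultimately show ?thesis unfolding irreducible_rep_def using rep by blast
qed

text \<open>
  In an irreducible representation of an abelian group the group itself commutes with the action, so
  over a splitting field it acts by scalars. Applied to a representation of minimal dimension in which
  \<open>x\<close> acts nontrivially, this yields a character that is nontrivial at \<open>x\<close>.
\<close>

theorem splitting_field_separates_points:
  fixes X :: "('x, 'b) monoid_scheme"
  assumes "comm_group X" "finite (carrier X)" and split: "splitting_field TYPE('k::field_char_0) X"
  shows "separates_points TYPE('k) X"
  unfolding separates_points_def
proof (intro ballI impI)
  interpret X: comm_group X by fact
  fix x assume x: "x \<in> carrier X" "x \<noteq> \<one>\<^bsub>X\<^esub>"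
  define P where "P n \<longleftrightarrow> (\<exists>\<rho> :: 'x \<Rightarrow> 'k mat. matrix_rep X n \<rho> \<and> \<rho> x \<noteq> 1\<^sub>m n)" for n
  have "\<exists>n. P n" using regular_matrix_rep[OF X.group_axioms assms(2) x] unfolding P_def .
  then have "P (LEAST n. P n)" by (rule LeastI_ex)
  then obtain n and \<rho> :: "'x \<Rightarrow> 'k mat" where n: "n = (LEAST n. P n)"
    and rep: "matrix_rep X n \<rho>" and nontriv: "\<rho> x \<noteq> 1\<^sub>m n" unfolding P_def by blast
  have "\<rho>' x = 1\<^sub>m k" if "k < n" "matrix_rep X k \<rho>'" for k and \<rho>' :: "'x \<Rightarrow> 'k mat"
    using not_less_Least[of k P] that unfolding n P_def by blast
  then have "irreducible_rep X n \<rho>"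
    using minimal_rep_irreducible[OF assms(1,2) x(1) rep nontriv] by blast
  have \<rho>: "\<rho> y \<in> carrier_mat n n" if "y \<in> carrier X" for y
    using rep that unfolding matrix_rep_def by auto
  have mult: "\<rho> (y \<otimes>\<^bsub>X\<^esub> z) = \<rho> y * \<rho> z" if "y \<in> carrier X" "z \<in> carrier X" for y z
    using rep that unfolding matrix_rep_def by auto
  have "n > 0" using nontriv \<rho>[OF x(1)] by (intro gr0I) (auto intro!: eq_matI)
  have "\<exists>c. y \<in> carrier X \<longrightarrow> \<rho> y = c \<cdot>\<^sub>m 1\<^sub>m n" for y
  proof (cases "y \<in> carrier X")
    case y: True
    have "\<forall>z\<in>carrier X. \<rho> y * \<rho> z = \<rho> z * \<rho> y"
      using mult y X.m_comm by metis
    then show ?thesis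
      using split \<open>irreducible_rep X n \<rho>\<close> \<rho>[OF y] unfolding splitting_field_def by blast
  qed auto
  then obtain c where c: "\<And>y. y \<in> carrier X \<Longrightarrow> \<rho> y = c y \<cdot>\<^sub>m 1\<^sub>m n" by metis
  have c00: "\<rho> y $$ (0,0) = c y" if "y \<in> carrier X" for y using c[OF that] \<open>n > 0\<close> by simp
  have cmult: "c (y \<otimes>\<^bsub>X\<^esub> z) = c y * c z" if yz: "y \<in> carrier X" "z \<in> carrier X" for y z
  proof -
    have "\<rho> y * \<rho> z = (c y * c z) \<cdot>\<^sub>m 1\<^sub>m n"
      unfolding c[OF yz(1)] c[OF yz(2)] by (intro eq_matI) auto
    then have "c (y \<otimes>\<^bsub>X\<^esub> z) = ((c y * c z) \<cdot>\<^sub>m 1\<^sub>m n) $$ (0,0)"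
      using c00[of "y \<otimes>\<^bsub>X\<^esub> z"] mult[OF yz] yz by simp
    then show ?thesis using \<open>n > 0\<close> by simp
  qed
  have c1: "c \<one>\<^bsub>X\<^esub> = 1" using c00[of "\<one>\<^bsub>X\<^esub>"] rep \<open>n > 0\<close> unfolding matrix_rep_def by simp
  have "c y \<noteq> 0" if "y \<in> carrier X" for y
    using cmult[of y "inv\<^bsub>X\<^esub> y"] c1 that by auto
  then have "restrict c (carrier X) \<in> ext_hom X field_units"
    using cmult by (auto simp: ext_hom_field_units_iff)
  moreover have "c x \<noteq> 1" using c[OF x(1)] nontriv by (auto intro!: eq_matI)
  ultimately show "\<exists>\<chi>\<in>ext_hom X (field_units :: 'k monoid). \<chi> x \<noteq> 1" using x(1) by (intro bexI[of _ "restrict c (carrier X)"]) auto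
qed

lemma separates_points_inj_hom:
  assumes "group X" "group Y" and f: "f \<in> hom X Y" and inj: "inj_on f (carrier X)"
    and sep: "separates_points TYPE('k::field) Y"
  shows "separates_points TYPE('k) X"
  unfolding separates_points_def
proof (intro ballI impI)
  interpret X: group X by fact
  interpret Y: group Y by fact
  interpret f: group_hom X Y f by unfold_locales (rule f)
  fix x assume x: "x \<in> carrier X" "x \<noteq> \<one>\<^bsub>X\<^esub>"
  have "f x \<noteq> f \<one>\<^bsub>X\<^esub>" using inj x X.one_closed by (meson inj_onD)
  then have "f x \<noteq> \<one>\<^bsub>Y\<^esub>" by simp
  then obtain \<chi> where \<chi>: "\<chi> \<in> ext_hom Y (field_units :: 'k monoid)" "\<chi> (f x) \<noteq> 1"
    using sep x(1) unfolding separates_points_def by (meson f.hom_closed)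
  have "(\<lambda>x\<in>carrier X. \<chi> (f x)) \<in> ext_hom X (field_units :: 'k monoid)"
    using \<chi>(1) by (auto simp: ext_hom_field_units_iff)
  then show "\<exists>\<chi>\<in>ext_hom X (field_units :: 'k monoid). \<chi> x \<noteq> 1" using \<chi>(2) x(1) by (metis restrict_apply')
qed

text \<open>
  A group appears among the quotients \<open>V/L\<close> only up to isomorphism, as \<open>V/1\<close>, whose elements are
  singletons. This embedding, which is in fact an isomorphism, carries properties of the dual of \<open>V/1\<close>
  to the dual of \<open>V\<close>.
\<close>

lemma dual_group_embeds_mod_trivial:
  fixes A :: "('a, 'c) monoid_scheme" and V :: "('g, 'b) monoid_scheme"
  assumes A: "comm_group A" and V: "group V"
  shows "\<exists>f. f \<in> hom (dual_group A V) (dual_group A (V Mod {\<one>\<^bsub>V\<^esub>})) \<and> inj_on f (carrier (dual_group A V))"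
proof -
  interpret V: group V by fact
  let ?W = "V Mod {\<one>\<^bsub>V\<^esub>}"
  have car: "carrier ?W = (\<lambda>v. {v}) ` carrier V"
    unfolding carrier_FactGroup by (rule image_cong) (auto simp: r_coset_def)
  define f where "f \<phi> = (\<lambda>X\<in>carrier ?W. \<phi> (the_elem X))" for \<phi> :: "'g \<Rightarrow> 'a"
  have "f \<phi> \<in> carrier (dual_group A ?W)" if "\<phi> \<in> carrier (dual_group A V)" for \<phi>
    using that by (auto simp: f_def dual_group_def ext_hom_def hom_def car set_mult_def)
  moreover have "f (\<phi> \<otimes>\<^bsub>dual_group A V\<^esub> \<psi>) = f \<phi> \<otimes>\<^bsub>dual_group A ?W\<^esub> f \<psi>" for \<phi> \<psi>
    by (auto simp: f_def dual_group_def car restrict_def fun_eq_iff)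
  moreover have "inj_on f (carrier (dual_group A V))"
  proof (rule inj_onI)
    fix \<phi> \<psi> assume \<phi>: "\<phi> \<in> carrier (dual_group A V)" and \<psi>: "\<psi> \<in> carrier (dual_group A V)" and eq: "f \<phi> = f \<psi>"
    have "\<phi> v = \<psi> v" if "v \<in> carrier V" for v
      using fun_cong[OF eq, of "{v}"] that by (simp add: f_def car)
    then show "\<phi> = \<psi>" using \<phi> \<psi> by (auto simp: dual_group_def ext_hom_def intro: extensionalityI)
  qed
  ultimately show ?thesis by (intro exI[of _ f]) (simp add: hom_def)
qed

section \<open>Characters of finite abelian groups\<close>

lemma comm_group_field_units: "comm_group (field_units :: 'k::field monoid)"
  by (rule comm_groupI) (auto simp: field_units_def mult.assoc intro!: bexI[of _ "inverse x" for x])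

context
  fixes A :: "('a, 'c) monoid_scheme" and H :: "('g, 'b) monoid_scheme"
  assumes A: "comm_group A" and H: "group H"
begin

interpretation A: comm_group A by (rule A)
interpretation H: group H by (rule H)

lemma dual_groupI:
  assumes "\<And>x. x \<in> carrier H \<Longrightarrow> f x \<in> carrier A"
    "\<And>x y. x \<in> carrier H \<Longrightarrow> y \<in> carrier H \<Longrightarrow> f (x \<otimes>\<^bsub>H\<^esub> y) = f x \<otimes>\<^bsub>A\<^esub> f y"
  shows "restrict f (carrier H) \<in> carrier (dual_group A H)"
  using assms by (auto simp: dual_group_def ext_hom_def hom_def)

lemma comm_group_dual_group: "comm_group (dual_group A H)"
proof (rule comm_groupI)
  fix \<phi> assume \<phi>: "\<phi> \<in> carrier (dual_group A H)"
  then have c: "\<And>x. x \<in> carrier H \<Longrightarrow> \<phi> x \<in> carrier A"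
    and m: "\<And>x y. x \<in> carrier H \<Longrightarrow> y \<in> carrier H \<Longrightarrow> \<phi> (x \<otimes>\<^bsub>H\<^esub> y) = \<phi> x \<otimes>\<^bsub>A\<^esub> \<phi> y"
    and e: "\<phi> \<in> extensional (carrier H)"
    by (auto simp: dual_group_def ext_hom_def hom_def)
  show "\<one>\<^bsub>dual_group A H\<^esub> \<otimes>\<^bsub>dual_group A H\<^esub> \<phi> = \<phi>"
    using c e by (auto simp: dual_group_def fun_eq_iff extensional_def)
  have "(\<lambda>x\<in>carrier H. inv\<^bsub>A\<^esub> \<phi> x) \<in> carrier (dual_group A H)"
    by (rule dual_groupI) (auto simp: c m A.inv_mult)
  moreover have "(\<lambda>x\<in>carrier H. inv\<^bsub>A\<^esub> \<phi> x) \<otimes>\<^bsub>dual_group A H\<^esub> \<phi> = \<one>\<^bsub>dual_group A H\<^esub>"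
    by (auto simp: dual_group_def fun_eq_iff c)
  ultimately show "\<exists>\<psi>\<in>carrier (dual_group A H). \<psi> \<otimes>\<^bsub>dual_group A H\<^esub> \<phi> = \<one>\<^bsub>dual_group A H\<^esub>" by blast
qed (auto simp: dual_group_def ext_hom_def hom_def Pi_iff A.m_ac fun_eq_iff restrict_def extensional_def)

end

text \<open>
  Translation by \<open>z\<close> permutes the group and multiplies the sum by \<open>\<chi> z \<noteq> 1\<close>.
\<close>

lemma sum_nontrivial_character:
  fixes \<chi> :: "'x \<Rightarrow> 'k::field"
  assumes "group X" and mult: "\<And>x y. x \<in> carrier X \<Longrightarrow> y \<in> carrier X \<Longrightarrow> \<chi> (x \<otimes>\<^bsub>X\<^esub> y) = \<chi> x * \<chi> y"
    and z: "z \<in> carrier X" "\<chi> z \<noteq> 1"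
  shows "(\<Sum>x\<in>carrier X. \<chi> x) = 0"
proof -
  interpret X: group X by fact
  have "(\<Sum>x\<in>carrier X. \<chi> x) = (\<Sum>x\<in>carrier X. \<chi> (z \<otimes>\<^bsub>X\<^esub> x))"
    by (rule sum.reindex_bij_witness[of _ "\<lambda>x. z \<otimes>\<^bsub>X\<^esub> x" "\<lambda>x. inv\<^bsub>X\<^esub> z \<otimes>\<^bsub>X\<^esub> x"])
       (use z in \<open>auto simp flip: X.m_assoc\<close>)
  also have "\<dots> = \<chi> z * (\<Sum>x\<in>carrier X. \<chi> x)"
    using mult z by (simp add: sum_distrib_left)
  finally show ?thesis using z(2) by simp
qed

lemma character_one:
  assumes "group X" "\<chi> \<in> ext_hom X (field_units :: 'k::field monoid)"
  shows "\<chi> \<one>\<^bsub>X\<^esub> = 1"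
proof -
  interpret X: group X by fact
  have "\<chi> \<one>\<^bsub>X\<^esub> * \<chi> \<one>\<^bsub>X\<^esub> = \<chi> (\<one>\<^bsub>X\<^esub> \<otimes>\<^bsub>X\<^esub> \<one>\<^bsub>X\<^esub>)" "\<chi> \<one>\<^bsub>X\<^esub> \<noteq> 0"
    using assms(2) X.one_closed unfolding ext_hom_field_units_iff by metis+
  then show ?thesis by simp
qed

text \<open>
  The values of a character are roots of \<open>T\<^sup>n - 1\<close>, where \<open>n\<close> is the order of the group.
\<close>

lemma finite_characters:
  fixes X :: "('x, 'b) monoid_scheme"
  assumes "group X" "finite (carrier X)"
  shows "finite (ext_hom X (field_units :: 'k::field monoid))"
proof -
  interpret X: group X by fact
  define n where "n = Coset.order X"
  have n: "n > 0" using assms(2) unfolding n_def by (simp add: X.order_gt_0_iff_finite)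
  define p :: "'k poly" where "p = Polynomial.monom 1 n - 1"
  have "Polynomial.coeff p n \<noteq> 0" using n by (simp add: p_def)
  then have "p \<noteq> 0" by auto
  have "\<chi> x \<in> {a. poly p a = 0}" if \<chi>: "\<chi> \<in> ext_hom X field_units" and x: "x \<in> carrier X" for \<chi> x
  proof -
    have "\<chi> (x [^]\<^bsub>X\<^esub> (m::nat)) = \<chi> x ^ m" for m
      using \<chi> x character_one[OF assms(1) \<chi>] unfolding ext_hom_field_units_iff by (induction m) auto
    from this[of n] have "\<chi> x ^ n = 1"
      using X.pow_order_eq_1[OF x] character_one[OF assms(1) \<chi>] by (simp add: n_def)
    then show ?thesis by (simp add: p_def poly_monom)
  qed
  then have "ext_hom X field_units \<subseteq> carrier X \<rightarrow>\<^sub>E {a. poly p a = 0}"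
    unfolding ext_hom_def by (auto simp: PiE_def)
  moreover have "finite (carrier X \<rightarrow>\<^sub>E {a. poly p a = 0})"
    using assms(2) poly_roots_finite[OF \<open>p \<noteq> 0\<close>] by (intro finite_PiE) auto
  ultimately show ?thesis by (rule finite_subset)
qed

text \<open>
  Evaluation at \<open>x\<^sup>-\<^sup>1 y\<close> is a character of the group of characters, and it is nontrivial for \<open>x \<noteq> y\<close>
  exactly because characters separate points.
\<close>

lemma second_orthogonality:
  fixes X :: "('x, 'b) monoid_scheme"
  assumes "group X" "separates_points TYPE('k::field) X" and x: "x \<in> carrier X" and y: "y \<in> carrier X"
  shows "(\<Sum>\<chi>\<in>ext_hom X (field_units :: 'k monoid). \<chi> (inv\<^bsub>X\<^esub> x) * \<chi> y) =
     (if x = y then of_nat (card (ext_hom X (field_units :: 'k monoid))) else 0)"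
proof -
  interpret X: group X by fact
  have eq: "(\<Sum>\<chi>\<in>ext_hom X (field_units :: 'k monoid). \<chi> (inv\<^bsub>X\<^esub> x) * \<chi> y) =
    (\<Sum>\<chi>\<in>ext_hom X (field_units :: 'k monoid). \<chi> (inv\<^bsub>X\<^esub> x \<otimes>\<^bsub>X\<^esub> y))"
    using x y by (intro sum.cong) (auto simp: ext_hom_field_units_iff)
  show ?thesis
  proof (cases "x = y")
    case True
    then show ?thesis unfolding eq using y by (simp add: character_one[OF assms(1)] cong: sum.cong)
  next
    case False
    let ?z = "inv\<^bsub>X\<^esub> x \<otimes>\<^bsub>X\<^esub> y"
    have "?z \<in> carrier X" "?z \<noteq> \<one>\<^bsub>X\<^esub>" using x y False by (auto simp: X.inv_solve_left')
    then obtain \<chi> where \<chi>: "\<chi> \<in> ext_hom X (field_units :: 'k monoid)" "\<chi> ?z \<noteq> 1"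
      using assms(2) unfolding separates_points_def by blast
    have car: "carrier (dual_group (field_units :: 'k monoid) X) = ext_hom X field_units"
      by (simp add: dual_group_def)
    interpret D: comm_group "dual_group (field_units :: 'k monoid) X"
      by (rule comm_group_dual_group) (fact comm_group_field_units assms(1))+
    have "(\<Sum>\<chi>\<in>carrier (dual_group (field_units :: 'k monoid) X). \<chi> ?z) = 0"
      by (rule sum_nontrivial_character[OF D.group_axioms, of _ \<chi>])
         (use \<chi> x y in \<open>auto simp: dual_group_def field_units_def\<close>)
    then show ?thesis unfolding eq using False by (simp add: car)
  qed
qed

lemma first_orthogonality:
  fixes X :: "('x, 'b) monoid_scheme"
  assumes "comm_group X" and \<chi>: "\<chi> \<in> ext_hom X (field_units :: 'k::field monoid)"
    and \<psi>: "\<psi> \<in> ext_hom X (field_units :: 'k monoid)"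
  shows "(\<Sum>x\<in>carrier X. \<chi> (inv\<^bsub>X\<^esub> x) * \<psi> x) = (if \<chi> = \<psi> then of_nat (card (carrier X)) else 0)"
proof -
  interpret X: comm_group X by fact
  have inv: "\<chi> (inv\<^bsub>X\<^esub> x) * \<chi> x = 1" if "x \<in> carrier X" for x
    using that \<chi> character_one[OF X.group_axioms \<chi>] unfolding ext_hom_field_units_iff
    by (metis X.inv_closed X.l_inv)
  show ?thesis
  proof (cases "\<chi> = \<psi>")
    case True
    then show ?thesis using inv by simp
  next
    case False
    then obtain z where z: "\<chi> z \<noteq> \<psi> z" by auto
    then have zc: "z \<in> carrier X"
      using \<chi> \<psi> unfolding ext_hom_def by (metis IntD2 extensional_arb)
    have "\<chi> (inv\<^bsub>X\<^esub> z) * \<psi> z \<noteq> 1"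
    proof
      assume "\<chi> (inv\<^bsub>X\<^esub> z) * \<psi> z = 1"
      then have "\<chi> (inv\<^bsub>X\<^esub> z) * \<psi> z = \<chi> (inv\<^bsub>X\<^esub> z) * \<chi> z" using inv[OF zc] by simp
      moreover have "\<chi> (inv\<^bsub>X\<^esub> z) \<noteq> 0" using inv[OF zc] by auto
      ultimately show False using z by simp
    qed
    then have "(\<Sum>x\<in>carrier X. \<chi> (inv\<^bsub>X\<^esub> x) * \<psi> x) = 0"
      using \<chi> \<psi> zc by (intro sum_nontrivial_character[OF X.group_axioms])
        (auto simp: ext_hom_field_units_iff X.inv_mult)
    then show ?thesis using False by simp
  qed
qed

section \<open>Linear extension from a basis\<close>

lemma lookup_bscale: "Poly_Mapping.lookup (bscale a x) c = (a :: 'k::field) * Poly_Mapping.lookup x c"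
  by (simp add: map.rep_eq when_def)

lemma lin_form_superset:
  assumes "finite B" "Poly_Mapping.keys x \<subseteq> B"
  shows "lin_form f x = (\<Sum>c\<in>B. Poly_Mapping.lookup x c * f c)"
  unfolding lin_form_def
  by (rule sum.mono_neutral_left) (use assms in \<open>auto simp: in_keys_iff\<close>)

lemma lin_form_0 [simp]: "lin_form f 0 = 0"
  by (simp add: lin_form_def)

lemma lin_form_add: "lin_form f (x + y) = lin_form f x + lin_form f y"
proof -
  let ?B = "Poly_Mapping.keys x \<union> Poly_Mapping.keys y"
  have "Poly_Mapping.keys (x + y) \<subseteq> ?B" by (rule keys_add)
  then have "lin_form f (x + y) = (\<Sum>c\<in>?B. Poly_Mapping.lookup (x + y) c * f c)"
    by (intro lin_form_superset) auto
  also have "\<dots> = (\<Sum>c\<in>?B. Poly_Mapping.lookup x c * f c) + (\<Sum>c\<in>?B. Poly_Mapping.lookup y c * f c)"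
    by (simp add: lookup_add distrib_right sum.distrib)
  also have "\<dots> = lin_form f x + lin_form f y"
    by (intro arg_cong2[of _ _ _ _ "(+)"] lin_form_superset[symmetric]) auto
  finally show ?thesis .
qed

lemma lin_form_bscale: "lin_form f (bscale a x) = a * lin_form f x"
proof -
  have "Poly_Mapping.keys (bscale a x) \<subseteq> Poly_Mapping.keys x"
    by (auto simp: in_keys_iff lookup_bscale)
  then have "lin_form f (bscale a x) = (\<Sum>c\<in>Poly_Mapping.keys x. Poly_Mapping.lookup (bscale a x) c * f c)"
    by (intro lin_form_superset) auto
  then show ?thesis by (simp add: lookup_bscale lin_form_def sum_distrib_left mult.assoc)
qed

lemma lin_form_sum: "lin_form f (\<Sum>i\<in>I. x i) = (\<Sum>i\<in>I. lin_form f (x i))"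
  by (induction I rule: infinite_finite_induct) (auto simp: lin_form_add)

lemma lin_form_single [simp]: "lin_form f (Poly_Mapping.single c a) = a * f c"
  by (simp add: lin_form_def)

lemma lin_form_cong: "(\<And>c. c \<in> Poly_Mapping.keys x \<Longrightarrow> f c = g c) \<Longrightarrow> lin_form f x = lin_form g x"
  by (simp add: lin_form_def)

lemma lin_form_lin_ext: "lin_form f (lin_ext h x) = lin_form (\<lambda>c. lin_form f (h c)) x"
  by (simp add: lin_ext_def lin_form_sum lin_form_bscale) (simp add: lin_form_def)

lemma lin_form_product: "lin_form (\<lambda>c. lin_form (\<lambda>d. f c * g d) y) x = lin_form f x * lin_form g y"
  unfolding lin_form_def sum_product by (intro sum.cong refl) (simp add: sum_distrib_left mult_ac)

lemma keys_sum_subset: "Poly_Mapping.keys (\<Sum>i\<in>I. x i) \<subseteq> (\<Union>i\<in>I. Poly_Mapping.keys (x i))"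
proof (induction I rule: infinite_finite_induct)
  case (insert i I)
  then show ?case using keys_add[of "x i" "\<Sum>i\<in>I. x i"] by auto
qed auto

lemma keys_lin_ext_subset:
  "Poly_Mapping.keys (lin_ext h x :: 'j \<Rightarrow>\<^sub>0 'k::field) \<subseteq> (\<Union>c\<in>Poly_Mapping.keys x. Poly_Mapping.keys (h c))"
proof -
  have "Poly_Mapping.keys (bscale a y) \<subseteq> Poly_Mapping.keys y" for a :: 'k and y :: "'j \<Rightarrow>\<^sub>0 'k"
    by (auto simp: in_keys_iff lookup_bscale)
  then show ?thesis unfolding lin_ext_def using keys_sum_subset by fastforce
qed

lemma lin_form_sum_fun: "lin_form (\<lambda>c. \<Sum>i\<in>I. a i * f i c) x = (\<Sum>i\<in>I. a i * lin_form (f i) x)"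
  unfolding lin_form_def by (simp add: sum_distrib_left mult.left_commute) (rule sum.swap)

section \<open>Conjugation of monomial pairs\<close>

definition mconj :: "('g, 'b) monoid_scheme \<Rightarrow> 'g \<Rightarrow> ('g, 'a) mpair \<Rightarrow> ('g, 'a) mpair" where
  "mconj S g q = (conj_set S g (fst q), conj_char S g (fst q) (snd q))"

lemma mclass_eq: "mclass S q = (\<lambda>g. mconj S g q) ` carrier S"
  by (auto simp: mclass_def mconj_def)

text \<open>
  The summand at \<open>g\<close> of the species of the class of \<open>q = (U, \<phi>)\<close> at \<open>p = (H, \<Phi>)\<close>: it is
  \<open>\<Phi> ((g\<phi>)|\<^sub>H)\<close> if \<open>H \<le> gUg\<^sup>-\<^sup>1\<close>, and \<open>0\<close> otherwise.
\<close>

definition local_value :: "('g, 'b) monoid_scheme \<Rightarrow> ('g, 'a, 'k::field) spair \<Rightarrow> ('g, 'a) mpair \<Rightarrow> 'g \<Rightarrow> 'k" where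
  "local_value S p q g =
     (if \<forall>x\<in>fst p. inv\<^bsub>S\<^esub> g \<otimes>\<^bsub>S\<^esub> x \<otimes>\<^bsub>S\<^esub> g \<in> fst q
      then snd p (\<lambda>x\<in>fst p. snd q (inv\<^bsub>S\<^esub> g \<otimes>\<^bsub>S\<^esub> x \<otimes>\<^bsub>S\<^esub> g)) else 0)"

text \<open>
  The name alludes to the table of marks of the Burnside ring: for trivial \<open>A\<close> this is the number of
  fixed points of \<open>H\<close> on \<open>S/U\<close>.
\<close>

definition mark :: "('g, 'b) monoid_scheme \<Rightarrow> ('g, 'a, 'k::field) spair \<Rightarrow> ('g, 'a) mpair \<Rightarrow> 'k" where
  "mark S p q = (\<Sum>g\<in>carrier S. local_value S p q g) / of_nat (card (fst q))"

lemma dual_iff: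
  "\<phi> \<in> carrier (dual_group A (S\<lparr>carrier := H\<rparr>)) \<longleftrightarrow>
     (\<forall>x\<in>H. \<phi> x \<in> carrier A) \<and> (\<forall>x\<in>H. \<forall>y\<in>H. \<phi> (x \<otimes>\<^bsub>S\<^esub> y) = \<phi> x \<otimes>\<^bsub>A\<^esub> \<phi> y) \<and> \<phi> \<in> extensional H"
  by (auto simp: dual_group_def ext_hom_def hom_def)

locale finite_monomial = A: comm_group A + group S
  for A :: "('a, 'c) monoid_scheme" and S :: "('g, 'b) monoid_scheme" (structure) +
  assumes finite_S: "finite (carrier S)"
begin

lemma cancel_left: "g \<in> carrier S \<Longrightarrow> x \<in> carrier S \<Longrightarrow> g \<otimes> (inv g \<otimes> x) = x"
  "g \<in> carrier S \<Longrightarrow> x \<in> carrier S \<Longrightarrow> inv g \<otimes> (g \<otimes> x) = x"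
  by (simp_all flip: m_assoc)

lemmas group_simps = m_assoc inv_mult_group cancel_left

lemma mem_conj_set:
  assumes "U \<subseteq> carrier S" "g \<in> carrier S"
  shows "x \<in> conj_set S g U \<longleftrightarrow> x \<in> carrier S \<and> inv g \<otimes> x \<otimes> g \<in> U"
proof
  assume "x \<in> conj_set S g U"
  then obtain u where u: "u \<in> U" "x = g \<otimes> u \<otimes> inv g" by (auto simp: conj_set_def)
  then show "x \<in> carrier S \<and> inv g \<otimes> x \<otimes> g \<in> U" using assms by (auto simp: group_simps)
next
  assume x: "x \<in> carrier S \<and> inv g \<otimes> x \<otimes> g \<in> U"
  then have "x = g \<otimes> (inv g \<otimes> x \<otimes> g) \<otimes> inv g" using assms by (simp add: group_simps)
  then show "x \<in> conj_set S g U" using x unfolding conj_set_def by blast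
qed

lemma conj_set_subset: "U \<subseteq> carrier S \<Longrightarrow> g \<in> carrier S \<Longrightarrow> conj_set S g U \<subseteq> carrier S"
  by (auto simp: mem_conj_set)

lemma conj_set_one: "U \<subseteq> carrier S \<Longrightarrow> conj_set S \<one> U = U"
  by (auto simp: mem_conj_set subset_iff)

lemma conj_set_mult:
  "U \<subseteq> carrier S \<Longrightarrow> g \<in> carrier S \<Longrightarrow> h \<in> carrier S \<Longrightarrow> conj_set S g (conj_set S h U) = conj_set S (g \<otimes> h) U"
  by (auto simp: mem_conj_set conj_set_subset group_simps)

lemma conj_set_inv:
  assumes "U \<subseteq> carrier S" "g \<in> carrier S"
  shows "conj_set S (inv g) (conj_set S g U) = U" "conj_set S g (conj_set S (inv g) U) = U"
  using assms by (simp_all add: conj_set_mult conj_set_one)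

lemma card_conj_set: "U \<subseteq> carrier S \<Longrightarrow> g \<in> carrier S \<Longrightarrow> card (conj_set S g U) = card U"
  unfolding conj_set_def by (rule card_image) (auto simp: inj_on_def subset_iff)

lemma subgroup_conj_set:
  assumes "subgroup U S" "g \<in> carrier S"
  shows "subgroup (conj_set S g U) S"
proof -
  interpret U: subgroup U S by fact
  have sub: "U \<subseteq> carrier S" by (rule U.subset)
  show ?thesis
  proof (rule subgroupI)
    show "conj_set S g U \<subseteq> carrier S" using sub assms(2) by (rule conj_set_subset)
    show "conj_set S g U \<noteq> {}" using U.one_closed unfolding conj_set_def by blast
    fix x assume "x \<in> conj_set S g U"
    then have x: "x \<in> carrier S" "inv g \<otimes> x \<otimes> g \<in> U" using assms(2) sub by (auto simp: mem_conj_set)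
    have "inv g \<otimes> inv x \<otimes> g = inv (inv g \<otimes> x \<otimes> g)" using x assms(2) by (simp add: group_simps)
    then show "inv x \<in> conj_set S g U" using x assms(2) sub by (simp add: mem_conj_set)
    fix y assume "y \<in> conj_set S g U"
    then have y: "y \<in> carrier S" "inv g \<otimes> y \<otimes> g \<in> U" using assms(2) sub by (auto simp: mem_conj_set)
    have "inv g \<otimes> (x \<otimes> y) \<otimes> g = (inv g \<otimes> x \<otimes> g) \<otimes> (inv g \<otimes> y \<otimes> g)"
      using x y assms(2) by (simp add: group_simps)
    then show "x \<otimes> y \<in> conj_set S g U" using x y assms(2) sub by (simp add: mem_conj_set)
  qed
qed

abbreviation Dual :: "'g set \<Rightarrow> ('g \<Rightarrow> 'a) set" where
  "Dual H \<equiv> carrier (dual_group A (S\<lparr>carrier := H\<rparr>))"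

lemma comm_group_Dual: "subgroup H S \<Longrightarrow> comm_group (dual_group A (S\<lparr>carrier := H\<rparr>))"
  by (intro comm_group_dual_group A.comm_group_axioms subgroup_imp_group)

lemma pullback_in_Dual:
  assumes H: "subgroup H S" and g: "g \<in> carrier S" and U: "\<phi> \<in> Dual U"
    and sub: "\<And>x. x \<in> H \<Longrightarrow> inv g \<otimes> x \<otimes> g \<in> U"
  shows "(\<lambda>x\<in>H. \<phi> (inv g \<otimes> x \<otimes> g)) \<in> Dual H"
proof -
  interpret H: subgroup H S by fact
  have "\<phi> (inv g \<otimes> (x \<otimes> y) \<otimes> g) = \<phi> (inv g \<otimes> x \<otimes> g) \<otimes>\<^bsub>A\<^esub> \<phi> (inv g \<otimes> y \<otimes> g)" if "x \<in> H" "y \<in> H" for x y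
  proof -
    have "inv g \<otimes> (x \<otimes> y) \<otimes> g = (inv g \<otimes> x \<otimes> g) \<otimes> (inv g \<otimes> y \<otimes> g)"
      using that g H.subset by (auto simp: group_simps)
    then show ?thesis using U sub that by (simp add: dual_iff)
  qed
  then show ?thesis using U sub by (simp add: dual_iff)
qed

lemma mpairs_iff: "q \<in> mpairs A S \<longleftrightarrow> subgroup (fst q) S \<and> snd q \<in> Dual (fst q)"
  by (cases q) (auto simp: mpairs_def)

lemma conj_char_in_Dual:
  assumes "subgroup U S" "g \<in> carrier S" "\<phi> \<in> Dual U"
  shows "conj_char S g U \<phi> \<in> Dual (conj_set S g U)"
  unfolding conj_char_def
  by (rule pullback_in_Dual) (use assms in \<open>auto simp: subgroup_conj_set mem_conj_set subgroup.subset\<close>)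

lemma mconj_in_mpairs: "q \<in> mpairs A S \<Longrightarrow> g \<in> carrier S \<Longrightarrow> mconj S g q \<in> mpairs A S"
  by (simp add: mpairs_iff mconj_def subgroup_conj_set conj_char_in_Dual)

lemma conj_char_mult:
  assumes "U \<subseteq> carrier S" "g \<in> carrier S" "h \<in> carrier S"
  shows "conj_char S g (conj_set S h U) (conj_char S h U \<phi>) = conj_char S (g \<otimes> h) U \<phi>"
  unfolding conj_char_def conj_set_mult[OF assms]
  by (rule restrict_ext) (use assms in \<open>auto simp: mem_conj_set group_simps\<close>)

lemma conj_char_one:
  assumes "U \<subseteq> carrier S" "\<phi> \<in> extensional U"
  shows "conj_char S \<one> U \<phi> = \<phi>"
proof (rule extensionalityI)
  show "conj_char S \<one> U \<phi> \<in> extensional U" using assms(1) by (simp add: conj_char_def conj_set_one)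
  show "conj_char S \<one> U \<phi> x = \<phi> x" if "x \<in> U" for x
    using that assms(1) by (auto simp: conj_char_def conj_set_one subset_iff)
qed (fact assms(2))

lemma mconj_mult:
  "q \<in> mpairs A S \<Longrightarrow> g \<in> carrier S \<Longrightarrow> h \<in> carrier S \<Longrightarrow> mconj S g (mconj S h q) = mconj S (g \<otimes> h) q"
  by (simp add: mconj_def conj_set_mult conj_char_mult mpairs_iff subgroup.subset)

lemma mconj_one: "q \<in> mpairs A S \<Longrightarrow> mconj S \<one> q = q"
  by (simp add: mconj_def mpairs_iff dual_iff subgroup.subset conj_set_one conj_char_one)

lemma mclass_mconj:
  assumes q: "q \<in> mpairs A S" and g: "g \<in> carrier S"
  shows "mclass S (mconj S g q) = mclass S q"
proof -
  have 1: "mconj S h (mconj S g q) \<in> mclass S q" if "h \<in> carrier S" for h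
    using that q g by (auto simp: mclass_eq mconj_mult)
  have "mconj S h q \<in> mclass S (mconj S g q)" if h: "h \<in> carrier S" for h
  proof -
    have "mconj S h q = mconj S (h \<otimes> inv g) (mconj S g q)"
      using h q g by (simp add: mconj_mult group_simps)
    then show ?thesis unfolding mclass_eq by (rule image_eqI) (use h g in simp)
  qed
  then have "mclass S q \<subseteq> mclass S (mconj S g q)" unfolding mclass_eq[of S q] by (rule image_subsetI)
  moreover have "mclass S (mconj S g q) \<subseteq> mclass S q"
    unfolding mclass_eq[of S "mconj S g q"] using 1 by (rule image_subsetI)
  ultimately show ?thesis by (rule subset_antisym[rotated])
qed

lemma mem_mclass: "q \<in> mpairs A S \<Longrightarrow> q \<in> mclass S q"
  unfolding mclass_eq by (rule image_eqI[of _ _ \<one>]) (simp_all add: mconj_one)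

lemma rep_mclass:
  assumes "q \<in> mpairs A S"
  obtains g where "g \<in> carrier S" "rep (mclass S q) = mconj S g q"
proof -
  have "rep (mclass S q) \<in> mclass S q"
    unfolding rep_def by (rule someI) (rule mem_mclass[OF assms])
  then show thesis using that unfolding mclass_eq by blast
qed

lemma rep_mclass_in_mpairs: "q \<in> mpairs A S \<Longrightarrow> rep (mclass S q) \<in> mpairs A S"
proof -
  assume q: "q \<in> mpairs A S"
  from rep_mclass[OF q] show ?thesis using mconj_in_mpairs[OF q] by metis
qed

lemma mclass_rep: "q \<in> mpairs A S \<Longrightarrow> mclass S (rep (mclass S q)) = mclass S q"
proof -
  assume q: "q \<in> mpairs A S"
  from rep_mclass[OF q] show ?thesis using mclass_mconj[OF q] by metis
qed

lemma conj_set_self: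
  assumes U: "subgroup U S" and u: "u \<in> U"
  shows "conj_set S u U = U"
proof -
  interpret U: subgroup U S by fact
  have uc: "u \<in> carrier S" using u by (rule U.mem_carrier)
  have "inv u \<otimes> x \<otimes> u \<in> U \<longleftrightarrow> x \<in> U" if "x \<in> carrier S" for x
  proof
    assume "inv u \<otimes> x \<otimes> u \<in> U"
    then have "u \<otimes> (inv u \<otimes> x \<otimes> u) \<otimes> inv u \<in> U" using u by simp
    then show "x \<in> U" using that uc by (simp add: group_simps)
  qed (use u in simp)
  then show ?thesis using uc U.subset by (auto simp: mem_conj_set)
qed

text \<open>
  Inner automorphisms act trivially on homomorphisms into an abelian group.
\<close>

lemma hom_conj_invariant:
  assumes U: "subgroup U S" and u: "u \<in> U" and \<phi>: "\<phi> \<in> Dual U" and x: "x \<in> U"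
  shows "\<phi> (inv u \<otimes> x \<otimes> u) = \<phi> x"
proof -
  interpret U: subgroup U S by fact
  have c: "\<phi> x \<in> carrier A" "\<phi> u \<in> carrier A" "\<phi> (inv u) \<in> carrier A" using \<phi> x u by (auto simp: dual_iff)
  have "\<phi> (inv u \<otimes> x \<otimes> u) = \<phi> (inv u) \<otimes>\<^bsub>A\<^esub> \<phi> x \<otimes>\<^bsub>A\<^esub> \<phi> u" using \<phi> x u by (simp add: dual_iff)
  also have "\<dots> = \<phi> x \<otimes>\<^bsub>A\<^esub> (\<phi> (inv u) \<otimes>\<^bsub>A\<^esub> \<phi> u)" using c by (simp add: A.m_ac)
  also have "\<phi> (inv u) \<otimes>\<^bsub>A\<^esub> \<phi> u = \<phi> x \<otimes>\<^bsub>A\<^esub> inv\<^bsub>A\<^esub> \<phi> x"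
  proof -
    have "\<phi> \<one> \<otimes>\<^bsub>A\<^esub> \<phi> \<one> = \<phi> (\<one> \<otimes> \<one>)" using \<phi> U.one_closed unfolding dual_iff by metis
    then have "\<phi> \<one> = \<one>\<^bsub>A\<^esub>" using \<phi> U.one_closed by (simp add: dual_iff)
    moreover have "\<phi> (inv u) \<otimes>\<^bsub>A\<^esub> \<phi> u = \<phi> (inv u \<otimes> u)"
      using \<phi> u U.m_inv_closed[OF u] unfolding dual_iff by metis
    ultimately show ?thesis using c u U.subset by auto
  qed
  finally show ?thesis using c by simp
qed

lemma mconj_self:
  assumes "q \<in> mpairs A S" "u \<in> fst q"
  shows "mconj S u q = q"
proof -
  obtain U \<phi> where q: "q = (U, \<phi>)" by (cases q)
  have U: "subgroup U S" and \<phi>: "\<phi> \<in> Dual U" and u: "u \<in> U" using assms by (auto simp: q mpairs_iff)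
  have "conj_char S u U \<phi> = \<phi>"
    unfolding conj_char_def conj_set_self[OF U u]
  proof (rule extensionalityI)
    show "(\<lambda>x\<in>U. \<phi> (inv u \<otimes> x \<otimes> u)) \<in> extensional U" by (rule restrict_extensional)
    show "\<phi> \<in> extensional U" using \<phi> by (simp add: dual_iff)
  qed (simp add: hom_conj_invariant[OF U u \<phi>])
  then show ?thesis by (simp add: q mconj_def conj_set_self[OF U u])
qed

lemma local_value_mconj:
  assumes p: "fst p \<subseteq> carrier S" and q: "q \<in> mpairs A S" and k: "k \<in> carrier S" and g: "g \<in> carrier S"
  shows "local_value S p (mconj S k q) g = local_value S p q (g \<otimes> k)"
proof -
  have U: "fst q \<subseteq> carrier S" using q by (simp add: mpairs_iff subgroup.subset)
  have mem: "inv g \<otimes> x \<otimes> g \<in> conj_set S k (fst q) \<longleftrightarrow> inv (g \<otimes> k) \<otimes> x \<otimes> (g \<otimes> k) \<in> fst q" if "x \<in> fst p" for x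
    using that p k g U by (subst mem_conj_set) (auto simp: group_simps)
  show ?thesis
  proof (cases "\<forall>x\<in>fst p. inv (g \<otimes> k) \<otimes> x \<otimes> (g \<otimes> k) \<in> fst q")
    case True
    have "(\<lambda>x\<in>fst p. conj_char S k (fst q) (snd q) (inv g \<otimes> x \<otimes> g)) =
       (\<lambda>x\<in>fst p. snd q (inv (g \<otimes> k) \<otimes> x \<otimes> (g \<otimes> k)))"
    proof (rule restrict_ext)
      fix x assume x: "x \<in> fst p"
      have "inv k \<otimes> (inv g \<otimes> x \<otimes> g) \<otimes> k = inv (g \<otimes> k) \<otimes> x \<otimes> (g \<otimes> k)"
        using x p g k by (auto simp: group_simps)
      then show "conj_char S k (fst q) (snd q) (inv g \<otimes> x \<otimes> g) = snd q (inv (g \<otimes> k) \<otimes> x \<otimes> (g \<otimes> k))"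
        using mem[OF x] True x by (simp add: conj_char_def)
    qed
    then show ?thesis using True mem by (simp add: local_value_def mconj_def)
  next
    case False
    then show ?thesis using mem by (auto simp: local_value_def mconj_def)
  qed
qed

lemma mark_mconj:
  assumes p: "fst p \<subseteq> carrier S" and q: "q \<in> mpairs A S" and k: "k \<in> carrier S"
  shows "mark S p (mconj S k q) = mark S p q"
proof -
  have "(\<Sum>g\<in>carrier S. local_value S p (mconj S k q) g) = (\<Sum>g\<in>carrier S. local_value S p q (g \<otimes> k))"
    using assms by (simp add: local_value_mconj)
  also have "\<dots> = (\<Sum>g\<in>carrier S. local_value S p q g)"
    by (rule sum.reindex_bij_witness[of _ "\<lambda>g. g \<otimes> inv k" "\<lambda>g. g \<otimes> k"]) (use k in \<open>auto simp: group_simps\<close>)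
  finally show ?thesis using q k by (simp add: mark_def mconj_def card_conj_set mpairs_iff subgroup.subset)
qed

lemma mark_rep: "fst p \<subseteq> carrier S \<Longrightarrow> q \<in> mpairs A S \<Longrightarrow> mark S p (rep (mclass S q)) = mark S p q"
proof -
  assume p: "fst p \<subseteq> carrier S" and q: "q \<in> mpairs A S"
  from rep_mclass[OF q] show ?thesis using mark_mconj[OF p q] by metis
qed

text \<open>
  An element \<open>u\<close> of \<open>U\<close> fixes the pair \<open>(U, \<phi>)\<close>, so \<open>gu\<close> and \<open>g\<close> conjugate it to the same pair.
\<close>

lemma local_value_right_invariant:
  assumes "fst p \<subseteq> carrier S" "q \<in> mpairs A S" "g \<in> carrier S" "u \<in> fst q"
  shows "local_value S p q (g \<otimes> u) = local_value S p q g"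
proof -
  have "u \<in> carrier S" using assms by (auto simp: mpairs_iff dest: subgroup.subset)
  then show ?thesis using local_value_mconj[of p q u g] assms by (simp add: mconj_self)
qed

text \<open>
  Multiplying \<open>g\<close> by \<open>h\<close> conjugates \<open>(g\<phi>)|\<^sub>H\<close> by \<open>h\<close>, which lies in \<open>H\<close>.
\<close>

lemma local_value_left_invariant:
  assumes H: "subgroup H S" and q: "q \<in> mpairs A S" and g: "g \<in> carrier S" and h: "h \<in> H"
  shows "local_value S (H, \<Phi>) q (h \<otimes> g) = local_value S (H, \<Phi>) q g"
proof -
  interpret H: subgroup H S by fact
  have hc: "h \<in> carrier S" using h by (rule H.mem_carrier)
  have eq: "inv (h \<otimes> g) \<otimes> x \<otimes> (h \<otimes> g) = inv g \<otimes> (inv h \<otimes> x \<otimes> h) \<otimes> g" if "x \<in> H" for x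
    using that hc g H.subset by (auto simp: group_simps)
  have cond: "(\<forall>x\<in>H. inv (h \<otimes> g) \<otimes> x \<otimes> (h \<otimes> g) \<in> fst q) \<longleftrightarrow> (\<forall>x\<in>H. inv g \<otimes> x \<otimes> g \<in> fst q)"
  proof
    assume *: "\<forall>x\<in>H. inv (h \<otimes> g) \<otimes> x \<otimes> (h \<otimes> g) \<in> fst q"
    show "\<forall>x\<in>H. inv g \<otimes> x \<otimes> g \<in> fst q"
    proof
      fix x assume x: "x \<in> H"
      have "inv h \<otimes> (h \<otimes> x \<otimes> inv h) \<otimes> h = x" using x hc H.subset by (auto simp: group_simps)
      moreover have "h \<otimes> x \<otimes> inv h \<in> H" using x h by simp
      ultimately show "inv g \<otimes> x \<otimes> g \<in> fst q" using * eq[of "h \<otimes> x \<otimes> inv h"] by auto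
    qed
  next
    assume "\<forall>x\<in>H. inv g \<otimes> x \<otimes> g \<in> fst q"
    then show "\<forall>x\<in>H. inv (h \<otimes> g) \<otimes> x \<otimes> (h \<otimes> g) \<in> fst q" using h eq by simp
  qed
  show ?thesis
  proof (cases "\<forall>x\<in>H. inv g \<otimes> x \<otimes> g \<in> fst q")
    case True
    let ?\<theta> = "\<lambda>x\<in>H. snd q (inv g \<otimes> x \<otimes> g)"
    have \<theta>: "?\<theta> \<in> Dual H" using True q by (intro pullback_in_Dual[OF H g]) (auto simp: mpairs_iff)
    have "(\<lambda>x\<in>H. snd q (inv (h \<otimes> g) \<otimes> x \<otimes> (h \<otimes> g))) = ?\<theta>"
    proof (rule restrict_ext)
      fix x assume x: "x \<in> H"
      have "inv h \<otimes> x \<otimes> h \<in> H" using x h by simp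
      then show "snd q (inv (h \<otimes> g) \<otimes> x \<otimes> (h \<otimes> g)) = snd q (inv g \<otimes> x \<otimes> g)"
        using hom_conj_invariant[OF H h \<theta> x] x by (simp add: eq)
    qed
    then show ?thesis using True cond by (simp add: local_value_def)
  next
    case False
    then show ?thesis using cond unfolding local_value_def by (metis fst_conv)
  qed
qed

section \<open>Double cosets and the values of species on a basis\<close>

lemma subgroup_finite: "subgroup U S \<Longrightarrow> finite U"
  by (rule finite_subset[OF subgroup.subset finite_S])

lemma of_nat_card_subgroup: "subgroup U S \<Longrightarrow> of_nat (card U) \<noteq> (0 :: 'k::field_char_0)"
  using subgroup_finite[of U] subgroup.one_closed[of U S] by (auto simp: card_eq_0_iff)

lemma dcoset_eq: "(U #> g) <#> V = (\<lambda>(u, v). u \<otimes> g \<otimes> v) ` (U \<times> V)"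
  unfolding r_coset_def set_mult_def by auto

text \<open>
  The double coset is the image of \<open>U \<times> V\<close> under \<open>(u, v) \<mapsto> ugv\<close>, and the fibre through \<open>(a, b)\<close>
  consists of the pairs \<open>(aw, g\<^sup>-\<^sup>1w\<^sup>-\<^sup>1gb)\<close> with \<open>w\<close> in \<open>U \<inter> gVg\<^sup>-\<^sup>1\<close>.
\<close>

lemma card_dcoset:
  assumes U: "subgroup U S" and V: "subgroup V S" and g: "g \<in> carrier S"
  shows "card ((U #> g) <#> V) * card (U \<inter> conj_set S g V) = card U * card V"
proof -
  interpret U: subgroup U S by fact
  interpret V: subgroup V S by fact
  let ?f = "\<lambda>(u, v). u \<otimes> g \<otimes> v" and ?W = "U \<inter> conj_set S g V"
  have fin: "finite (U \<times> V)" using U V by (simp add: subgroup_finite)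
  have fibre: "card {x \<in> U \<times> V. ?f x = d} = card ?W" if d: "d \<in> ?f ` (U \<times> V)" for d
  proof -
    obtain a b where a: "a \<in> U" and b: "b \<in> V" and d: "d = a \<otimes> g \<otimes> b" using d by auto
    have ac: "a \<in> carrier S" and bc: "b \<in> carrier S" using a b by auto
    have "bij_betw (\<lambda>w. (a \<otimes> w, inv g \<otimes> inv w \<otimes> g \<otimes> b)) ?W {x \<in> U \<times> V. ?f x = d}"
    proof (rule bij_betw_byWitness[where f' = "\<lambda>(u, v). inv a \<otimes> u"])
      show "\<forall>w\<in>?W. (case (a \<otimes> w, inv g \<otimes> inv w \<otimes> g \<otimes> b) of (u, v) \<Rightarrow> inv a \<otimes> u) = w"
        using ac by (auto simp: group_simps)
      show "\<forall>x\<in>{x \<in> U \<times> V. ?f x = d}. (a \<otimes> (case x of (u, v) \<Rightarrow> inv a \<otimes> u),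
          inv g \<otimes> inv (case x of (u, v) \<Rightarrow> inv a \<otimes> u) \<otimes> g \<otimes> b) = x"
      proof (clarsimp simp: d, intro conjI)
        fix u v assume u: "u \<in> U" and v: "v \<in> V" and eq: "u \<otimes> g \<otimes> v = a \<otimes> g \<otimes> b"
        have uc: "u \<in> carrier S" and vc: "v \<in> carrier S" using u v by auto
        show "a \<otimes> (inv a \<otimes> u) = u" using ac uc by (simp add: group_simps)
        have "inv g \<otimes> inv (inv a \<otimes> u) \<otimes> g \<otimes> b = inv g \<otimes> inv u \<otimes> (a \<otimes> g \<otimes> b)"
          using ac uc bc g by (simp add: group_simps)
        also have "\<dots> = v" unfolding eq[symmetric] using uc vc g by (simp add: group_simps)
        finally show "inv g \<otimes> inv (inv a \<otimes> u) \<otimes> g \<otimes> b = v" .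
      qed
      show "(\<lambda>w. (a \<otimes> w, inv g \<otimes> inv w \<otimes> g \<otimes> b)) ` ?W \<subseteq> {x \<in> U \<times> V. ?f x = d}"
      proof (rule image_subsetI)
        fix w assume "w \<in> ?W"
        then have w: "w \<in> U" "w \<in> conj_set S g V" by auto
        have wc: "w \<in> carrier S" using w by auto
        have m: "inv g \<otimes> w \<otimes> g \<in> V" using w(2) g V.subset by (simp add: mem_conj_set)
        have "inv (inv g \<otimes> w \<otimes> g) \<otimes> b \<in> V" using m b by blast
        then have "inv g \<otimes> inv w \<otimes> g \<otimes> b \<in> V" using wc g bc by (simp add: group_simps)
        moreover have "a \<otimes> w \<otimes> g \<otimes> (inv g \<otimes> inv w \<otimes> g \<otimes> b) = d"
          using ac wc g bc by (simp add: group_simps d)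
        ultimately show "(a \<otimes> w, inv g \<otimes> inv w \<otimes> g \<otimes> b) \<in> {x \<in> U \<times> V. ?f x = d}"
          using a w(1) by simp
      qed
      show "(\<lambda>(u, v). inv a \<otimes> u) ` {x \<in> U \<times> V. ?f x = d} \<subseteq> ?W"
      proof (rule image_subsetI)
        fix x assume "x \<in> {x \<in> U \<times> V. ?f x = d}"
        then obtain u v where x: "x = (u, v)" and u: "u \<in> U" and v: "v \<in> V" and eq: "u \<otimes> g \<otimes> v = d" by auto
        have uc: "u \<in> carrier S" and vc: "v \<in> carrier S" using u v by auto
        have "inv g \<otimes> (inv a \<otimes> u) \<otimes> g = inv g \<otimes> inv a \<otimes> (u \<otimes> g \<otimes> v) \<otimes> inv v"
          using ac uc vc g by (simp add: group_simps)
        also have "\<dots> = b \<otimes> inv v" unfolding eq d using ac bc vc g by (simp add: group_simps)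
        also have "\<dots> \<in> V" using b v by simp
        finally have "inv g \<otimes> (inv a \<otimes> u) \<otimes> g \<in> V" .
        then show "(case x of (u, v) \<Rightarrow> inv a \<otimes> u) \<in> ?W"
          using a u ac uc g V.subset by (simp add: x mem_conj_set)
      qed
    qed
    from bij_betw_same_card[OF this] show ?thesis by (rule sym)
  qed
  have "card U * card V = (\<Sum>x\<in>U \<times> V. 1)" by (simp add: card_cartesian_product)
  also have "\<dots> = (\<Sum>d\<in>?f ` (U \<times> V). \<Sum>x\<in>{x \<in> U \<times> V. ?f x = d}. 1)"
    by (rule sum.image_gen[OF fin])
  also have "\<dots> = (\<Sum>d\<in>?f ` (U \<times> V). card ?W)" using fibre by (intro sum.cong) simp_all
  finally show ?thesis by (simp add: dcoset_eq)
qed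

lemma dcoset_absorb:
  assumes "subgroup U S" "subgroup V S" "g \<in> carrier S" "x \<in> (U #> g) <#> V"
  shows "(U #> x) <#> V = (U #> g) <#> V"
proof -
  interpret U: subgroup U S by fact
  interpret V: subgroup V S by fact
  obtain a b where a: "a \<in> U" and b: "b \<in> V" and x: "x = a \<otimes> g \<otimes> b" using assms(4) by (auto simp: dcoset_eq)
  have ac: "a \<in> carrier S" and bc: "b \<in> carrier S" using a b by auto
  have 1: "u \<otimes> x \<otimes> v = (u \<otimes> a) \<otimes> g \<otimes> (b \<otimes> v)" if "u \<in> U" "v \<in> V" for u v
    using that ac bc assms(3) by (simp add: x group_simps)
  have 2: "u \<otimes> g \<otimes> v = (u \<otimes> inv a) \<otimes> x \<otimes> (inv b \<otimes> v)" if "u \<in> U" "v \<in> V" for u v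
    using that ac bc assms(3) by (simp add: x group_simps)
  show ?thesis unfolding dcoset_eq
  proof (intro subset_antisym image_subsetI; clarify)
    fix u v assume uv: "u \<in> U" "v \<in> V"
    show "u \<otimes> x \<otimes> v \<in> (\<lambda>(u, v). u \<otimes> g \<otimes> v) ` (U \<times> V)"
      by (rule image_eqI[of _ _ "(u \<otimes> a, b \<otimes> v)"]) (use uv a b 1[OF uv] in auto)
    show "u \<otimes> g \<otimes> v \<in> (\<lambda>(u, v). u \<otimes> x \<otimes> v) ` (U \<times> V)"
      by (rule image_eqI[of _ _ "(u \<otimes> inv a, inv b \<otimes> v)"]) (use uv a b 2[OF uv] in auto)
  qed
qed

lemma dcoset_self:
  assumes "subgroup U S" "subgroup V S" "g \<in> carrier S"
  shows "g \<in> (U #> g) <#> V"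
proof -
  have "g = \<one> \<otimes> g \<otimes> \<one>" using assms(3) by simp
  then show ?thesis using assms(1,2)[THEN subgroup.one_closed] unfolding dcoset_eq by (intro image_eqI[of _ _ "(\<one>, \<one>)"]) auto
qed

lemma dcoset_subset: "subgroup U S \<Longrightarrow> subgroup V S \<Longrightarrow> g \<in> carrier S \<Longrightarrow> (U #> g) <#> V \<subseteq> carrier S"
  by (auto simp: dcoset_eq dest: subgroup.mem_carrier)

lemma double_cosetsE:
  assumes "subgroup U S" "subgroup V S" "D \<in> double_cosets S U V"
  obtains "rep D \<in> carrier S" "D = (U #> rep D) <#> V"
proof -
  obtain g where g: "g \<in> carrier S" and D: "D = (U #> g) <#> V" using assms(3) by (auto simp: double_cosets_def)
  have "rep D \<in> D" unfolding rep_def by (rule someI[of _ g]) (use D dcoset_self[OF assms(1,2) g] in simp)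
  then show thesis using that dcoset_subset[OF assms(1,2) g] dcoset_absorb[OF assms(1,2) g, of "rep D"] D by auto
qed

text \<open>
  Turns a sum over representatives of double cosets into a sum over the whole group. It is what makes
  restriction and multiplication of basis elements accessible to substitutions.
\<close>

lemma sum_double_cosets:
  fixes F :: "'g \<Rightarrow> 'k::field"
  assumes U: "subgroup U S" and V: "subgroup V S"
    and inv: "\<And>u g v. u \<in> U \<Longrightarrow> g \<in> carrier S \<Longrightarrow> v \<in> V \<Longrightarrow> F (u \<otimes> g \<otimes> v) = F g"
  shows "(\<Sum>D\<in>double_cosets S U V. of_nat (card D) * F (rep D)) = (\<Sum>g\<in>carrier S. F g)"
proof -
  have un: "\<Union>(double_cosets S U V) = carrier S"
    using dcoset_self[OF U V] dcoset_subset[OF U V] unfolding double_cosets_def by blast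
  have fin: "\<forall>D\<in>double_cosets S U V. finite D" using finite_S un by (metis Union_upper finite_subset)
  have disj: "D \<inter> D' = {}" if "D \<in> double_cosets S U V" "D' \<in> double_cosets S U V" "D \<noteq> D'" for D D'
    using that dcoset_absorb[OF U V] unfolding double_cosets_def by blast
  have "(\<Sum>g\<in>carrier S. F g) = (\<Sum>D\<in>double_cosets S U V. \<Sum>g\<in>D. F g)"
    using sum.Union_disjoint[of "double_cosets S U V" F] fin disj un by simp
  also have "\<dots> = (\<Sum>D\<in>double_cosets S U V. of_nat (card D) * F (rep D))"
  proof (rule sum.cong[OF refl])
    fix D assume D: "D \<in> double_cosets S U V"
    have r: "rep D \<in> carrier S" "D = (U #> rep D) <#> V" using double_cosetsE[OF U V D] by blast+
    have "F g = F (rep D)" if "g \<in> D" for g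
    proof -
      from that have "g \<in> (U #> rep D) <#> V" by (subst (asm) r(2))
      then obtain u v where "u \<in> U" "v \<in> V" "g = u \<otimes> rep D \<otimes> v" unfolding dcoset_eq by auto
      then show ?thesis using inv r(1) by simp
    qed
    then show "(\<Sum>g\<in>D. F g) = of_nat (card D) * F (rep D)" by simp
  qed
  finally show ?thesis by simp
qed

lemma card_rep_dcoset:
  assumes "subgroup U S" "subgroup V S" "D \<in> double_cosets S U V"
  shows "card D * card (U \<inter> conj_set S (rep D) V) = card U * card V"
  using card_dcoset[OF assms(1,2)] double_cosetsE[OF assms] by metis

lemma mclass_subgroup:
  assumes H: "subgroup H S" and W: "W \<subseteq> H"
  shows "mclass (S\<lparr>carrier := H\<rparr>) (W, \<theta>) = (\<lambda>h. mconj S h (W, \<theta>)) ` H"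
proof -
  interpret H: subgroup H S by fact
  have "mconj (S\<lparr>carrier := H\<rparr>) h (W, \<theta>) = mconj S h (W, \<theta>)" if "h \<in> H" for h
    using m_inv_consistent[OF H that] by (simp add: mconj_def conj_set_def conj_char_def)
  then show ?thesis by (simp add: mclass_eq)
qed

text \<open>
  The projection \<open>\<pi>\<^sub>H\<close> does not depend on the representative that it inspects: an \<open>H\<close>-conjugate of \<open>W\<close>
  equals \<open>H\<close> only if \<open>W = H\<close>, and then \<open>H\<close> fixes \<open>\<theta>\<close>.
\<close>

lemma proj_top_term:
  assumes H: "subgroup H S" and W: "subgroup W S" "W \<subseteq> H" and \<theta>: "\<theta> \<in> Dual W"
  shows "(let (U, \<phi>) = rep (mclass (S\<lparr>carrier := H\<rparr>) (W, \<theta>)) in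
      if U = H then Poly_Mapping.single \<phi> (1::'k::field) else 0) =
    (if W = H then Poly_Mapping.single \<theta> 1 else 0)"
proof -
  interpret H: subgroup H S by fact
  have "rep (mclass (S\<lparr>carrier := H\<rparr>) (W, \<theta>)) \<in> mclass (S\<lparr>carrier := H\<rparr>) (W, \<theta>)"
    unfolding rep_def 
    by (rule someI[of _ "mconj S \<one> (W, \<theta>)"]) (use H.one_closed in \<open>auto simp: mclass_subgroup[OF H W(2)]\<close>)
  then obtain h where h: "h \<in> H" and r: "rep (mclass (S\<lparr>carrier := H\<rparr>) (W, \<theta>)) = mconj S h (W, \<theta>)"
    unfolding mclass_subgroup[OF H W(2)] by blast
  have hc: "h \<in> carrier S" using h by simp
  show ?thesis
  proof (cases "W = H")
    case True
    have "mconj S h (W, \<theta>) = (W, \<theta>)" by (rule mconj_self) (use W(1) \<theta> h True in \<open>auto simp: mpairs_iff\<close>)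
    then show ?thesis unfolding r by (simp add: True)
  next
    case False
    have "card W < card H" using False W(2) subgroup_finite[OF H] by (intro psubset_card_mono) auto
    then have "conj_set S h W \<noteq> H" using card_conj_set[OF subgroup.subset[OF W(1)] hc] by auto
    then show ?thesis using False by (simp add: r mconj_def)
  qed
qed

lemma inter_conj_subgroup:
  "subgroup H S \<Longrightarrow> subgroup U S \<Longrightarrow> g \<in> carrier S \<Longrightarrow> subgroup (H \<inter> conj_set S g U) S"
  by (intro subgroups_Inter_pair subgroup_conj_set)

lemma restrict_in_Dual:
  "\<phi> \<in> Dual U \<Longrightarrow> W \<subseteq> U \<Longrightarrow> subgroup W S \<Longrightarrow> restrict \<phi> W \<in> Dual W"
  by (auto simp: dual_iff subset_iff subgroup.m_closed)

lemma burnside_keys: "x \<in> burnside A S \<Longrightarrow> c \<in> Poly_Mapping.keys x \<Longrightarrow> \<exists>q\<in>mpairs A S. c = mclass S q"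
  by (auto simp: burnside_def)

lemma burnside_rep:
  assumes "x \<in> burnside A S" "c \<in> Poly_Mapping.keys x"
  shows "rep c \<in> mpairs A S" "mclass S (rep c) = c"
  using burnside_keys[OF assms] rep_mclass_in_mpairs mclass_rep by auto

text \<open>
  Only double cosets with \<open>H \<inter> gUg\<^sup>-\<^sup>1 = H\<close> survive
  the projection, and these have exactly \<open>\<bar>U\<bar>\<close> elements. The function \<open>\<Phi>\<close> is arbitrary here, since the
  proof of injectivity needs the formula for indicator functions, too.
\<close>

lemma species_eq_lin_form_mark:
  fixes \<Phi> :: "('g \<Rightarrow> 'a) \<Rightarrow> 'k::field_char_0"
  assumes x: "x \<in> burnside A S" and H: "subgroup H S"
  shows "species S (H, \<Phi>) x = lin_form (\<lambda>c. mark S (H, \<Phi>) (rep c)) x"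
proof -
  have "lin_form (\<lambda>c. lin_form \<Phi> (let (U, \<phi>) = rep c in if U = H then Poly_Mapping.single \<phi> 1 else 0))
        (let (U, \<phi>) = rep c in \<Sum>D\<in>double_cosets S H U. let g = rep D; W = H \<inter> conj_set S g U in
           Poly_Mapping.single (mclass (S\<lparr>carrier := H\<rparr>) (W, restrict (conj_char S g U \<phi>) W)) 1) =
      mark S (H, \<Phi>) (rep c)" if c: "c \<in> Poly_Mapping.keys x" for c
  proof -
    obtain U \<phi> where q: "rep c = (U, \<phi>)" by (cases "rep c")
    have mp: "(U, \<phi>) \<in> mpairs A S" using burnside_rep[OF x c] q by simp
    then have U: "subgroup U S" and \<phi>: "\<phi> \<in> Dual U" by (auto simp: mpairs_iff)
    let ?lv = "local_value S (H, \<Phi>) (U, \<phi>)"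
    have value_at: "lin_form \<Phi> (let (U', \<phi>') = rep (mclass (S\<lparr>carrier := H\<rparr>)
          (H \<inter> conj_set S g U, restrict (conj_char S g U \<phi>) (H \<inter> conj_set S g U))) in
            if U' = H then Poly_Mapping.single \<phi>' 1 else 0) = ?lv g \<and>
        (?lv g \<noteq> 0 \<longrightarrow> H \<inter> conj_set S g U = H)" if g: "g \<in> carrier S" for g
    proof -
      let ?W = "H \<inter> conj_set S g U"
      have W: "subgroup ?W S" by (rule inter_conj_subgroup[OF H U g])
      have \<theta>: "restrict (conj_char S g U \<phi>) ?W \<in> Dual ?W"
        by (rule restrict_in_Dual[OF conj_char_in_Dual[OF U g \<phi>] _ W]) auto
      have cond: "?W = H \<longleftrightarrow> (\<forall>x\<in>H. inv g \<otimes> x \<otimes> g \<in> U)"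
        using mem_conj_set[OF subgroup.subset[OF U] g] subgroup.subset[OF H] by blast
      have "restrict (conj_char S g U \<phi>) ?W = (\<lambda>x\<in>H. \<phi> (inv g \<otimes> x \<otimes> g))" if "?W = H"
        unfolding that by (rule restrict_ext) (use that in \<open>auto simp: conj_char_def\<close>)
      then show ?thesis
        using cond by (subst proj_top_term[OF H W _ \<theta>]) (auto simp: local_value_def)
    qed
    have "(\<Sum>D\<in>double_cosets S H U. ?lv (rep D)) = mark S (H, \<Phi>) (U, \<phi>)"
    proof -
      have "of_nat (card U) * ?lv (rep D) = of_nat (card D) * ?lv (rep D)"
        if D: "D \<in> double_cosets S H U" for D
      proof (cases "?lv (rep D) = 0")
        case False
        have "rep D \<in> carrier S" using double_cosetsE[OF H U D] by blast
        with False have "H \<inter> conj_set S (rep D) U = H" using value_at by blast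
        with card_rep_dcoset[OF H U D] have "card D * card H = card U * card H"
          by (simp only: mult.commute)
        moreover have "card H \<noteq> 0" using of_nat_card_subgroup[OF H, where 'k = 'k] by (metis of_nat_0)
        ultimately show ?thesis by simp
      qed simp
      then have "of_nat (card U) * (\<Sum>D\<in>double_cosets S H U. ?lv (rep D)) =
          (\<Sum>D\<in>double_cosets S H U. of_nat (card D) * ?lv (rep D))"
        unfolding sum_distrib_left by (intro sum.cong refl)
      also have "\<dots> = (\<Sum>g\<in>carrier S. ?lv g)"
      proof (rule sum_double_cosets[OF H U])
        fix h g u assume h: "h \<in> H" and g: "g \<in> carrier S" and u: "u \<in> U"
        have hc: "h \<in> carrier S" and uc: "u \<in> carrier S" using h u H U by (auto dest: subgroup.mem_carrier)
        have "?lv (h \<otimes> g \<otimes> u) = ?lv (h \<otimes> g)"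
          by (rule local_value_right_invariant) (use H mp hc g u in \<open>auto simp: subgroup.mem_carrier\<close>)
        also have "\<dots> = ?lv g" by (rule local_value_left_invariant[OF H mp g h])
        finally show "?lv (h \<otimes> g \<otimes> u) = ?lv g" .
      qed
      finally show ?thesis using of_nat_card_subgroup[OF U, where 'k = 'k]
        by (simp add: mark_def field_simps)
    qed
    moreover have "(\<Sum>D\<in>double_cosets S H U. lin_form \<Phi> (let (U', \<phi>') = rep (mclass (S\<lparr>carrier := H\<rparr>)
          (H \<inter> conj_set S (rep D) U, restrict (conj_char S (rep D) U \<phi>) (H \<inter> conj_set S (rep D) U))) in
            if U' = H then Poly_Mapping.single \<phi>' 1 else 0)) = (\<Sum>D\<in>double_cosets S H U. ?lv (rep D))"
    proof (rule sum.cong[OF refl])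
      fix D assume D: "D \<in> double_cosets S H U"
      have "rep D \<in> carrier S" using double_cosetsE[OF H U D] by blast
      from value_at[OF this] show "lin_form \<Phi> (let (U', \<phi>') = rep (mclass (S\<lparr>carrier := H\<rparr>)
          (H \<inter> conj_set S (rep D) U, restrict (conj_char S (rep D) U \<phi>) (H \<inter> conj_set S (rep D) U))) in
            if U' = H then Poly_Mapping.single \<phi>' 1 else 0) = ?lv (rep D)" by blast
    qed
    ultimately show ?thesis by (simp add: q lin_form_sum Let_def)
  qed
  then show ?thesis
    unfolding species_def comp_def fst_conv snd_conv proj_top_def res_def lin_form_lin_ext
    by (intro lin_form_cong) simp
qed

lemma burnside_single: "q \<in> mpairs A S \<Longrightarrow> Poly_Mapping.single (mclass S q) a \<in> burnside A S"
  by (auto simp: burnside_def)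

lemma burnside_closed_sum: "(\<And>i. i \<in> I \<Longrightarrow> x i \<in> burnside A S) \<Longrightarrow> (\<Sum>i\<in>I. x i) \<in> burnside A S"
  using keys_sum_subset[of x I] unfolding burnside_def by fastforce

lemma burnside_closed_bscale: "x \<in> burnside A S \<Longrightarrow> bscale a x \<in> burnside A S"
  unfolding burnside_def by (auto simp: in_keys_iff lookup_bscale)

lemma burnside_closed_diff: "x \<in> burnside A S \<Longrightarrow> y \<in> burnside A S \<Longrightarrow> x - y \<in> burnside A S"
proof -
  have "Poly_Mapping.keys (x - y) \<subseteq> Poly_Mapping.keys x \<union> Poly_Mapping.keys y"
    by (rule subsetI) (auto simp: in_keys_iff lookup_minus)
  then show "x \<in> burnside A S \<Longrightarrow> y \<in> burnside A S \<Longrightarrow> ?thesis" unfolding burnside_def by blast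
qed

lemma burnside_closed_lin_ext:
  "(\<And>c. c \<in> Poly_Mapping.keys x \<Longrightarrow> f c \<in> burnside A S) \<Longrightarrow> lin_ext f x \<in> burnside A S"
  using keys_lin_ext_subset[of f x] unfolding burnside_def by fastforce

lemma species_single:
  fixes \<Phi> :: "('g \<Rightarrow> 'a) \<Rightarrow> 'k::field_char_0"
  assumes "q \<in> mpairs A S" "subgroup H S"
  shows "species S (H, \<Phi>) (Poly_Mapping.single (mclass S q) 1) = mark S (H, \<Phi>) q"
  using assms by (simp add: species_eq_lin_form_mark burnside_single mark_rep subgroup.subset)

lemma species_lin_ext:
  fixes \<Phi> :: "('g \<Rightarrow> 'a) \<Rightarrow> 'k::field_char_0"
  assumes H: "subgroup H S" and f: "\<And>c. c \<in> Poly_Mapping.keys x \<Longrightarrow> f c \<in> burnside A S"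
  shows "species S (H, \<Phi>) (lin_ext f x) = lin_form (\<lambda>c. species S (H, \<Phi>) (f c)) x"
proof -
  have "species S (H, \<Phi>) (lin_ext f x) = lin_form (\<lambda>c. mark S (H, \<Phi>) (rep c)) (lin_ext f x)"
    by (rule species_eq_lin_form_mark[OF burnside_closed_lin_ext H]) (rule f)
  also have "\<dots> = lin_form (\<lambda>c. species S (H, \<Phi>) (f c)) x"
    unfolding lin_form_lin_ext by (rule lin_form_cong) (simp add: species_eq_lin_form_mark[OF f H])
  finally show ?thesis .
qed

lemma species_sum: "species S p (\<Sum>i\<in>I. x i) = (\<Sum>i\<in>I. species S p (x i))"
  by (simp add: species_def proj_top_def res_def lin_form_lin_ext lin_form_sum)

lemma species_bscale: "species S p (bscale a x) = a * species S p x"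
  by (simp add: species_def proj_top_def res_def lin_form_lin_ext lin_form_bscale)

lemma species_add: "species S p (x + y) = species S p x + species S p y"
  by (simp add: species_def proj_top_def res_def lin_form_lin_ext lin_form_add)

lemma species_diff: "species S p (x - y) = species S p x - species S p y"
  using species_add[of p "x - y" y] by simp

section \<open>Species are multiplicative\<close>

lemma mult_pair_in_mpairs:
  assumes "(U, \<phi>) \<in> mpairs A S" "(V, \<psi>) \<in> mpairs A S" "g \<in> carrier S"
  shows "(U \<inter> conj_set S g V, \<lambda>x\<in>U \<inter> conj_set S g V. \<phi> x \<otimes>\<^bsub>A\<^esub> conj_char S g V \<psi> x) \<in> mpairs A S"
proof -
  have U: "subgroup U S" "\<phi> \<in> Dual U" and V: "subgroup V S" "\<psi> \<in> Dual V"
    using assms by (auto simp: mpairs_iff)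
  let ?W = "U \<inter> conj_set S g V"
  have W: "subgroup ?W S" by (rule inter_conj_subgroup) (use U V assms in auto)
  have \<psi>': "conj_char S g V \<psi> \<in> Dual (conj_set S g V)" by (rule conj_char_in_Dual[OF V(1) assms(3) V(2)])
  have "(\<lambda>x\<in>?W. \<phi> x \<otimes>\<^bsub>A\<^esub> conj_char S g V \<psi> x) \<in> Dual ?W"
    using U(2) \<psi>' subgroup.m_closed[OF W] by (auto simp: dual_iff A.m_ac)
  with W show ?thesis by (simp add: mpairs_iff)
qed

lemma local_value_mult:
  fixes \<Phi> :: "('g \<Rightarrow> 'a) \<Rightarrow> 'k::field"
  assumes p: "(H, \<Phi>) \<in> spairs A S" and q: "(U, \<phi>) \<in> mpairs A S" and r: "(V, \<psi>) \<in> mpairs A S"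
    and g: "g \<in> carrier S" and k: "k \<in> carrier S"
  shows "local_value S (H, \<Phi>) (U \<inter> conj_set S g V, \<lambda>x\<in>U \<inter> conj_set S g V. \<phi> x \<otimes>\<^bsub>A\<^esub> conj_char S g V \<psi> x) k =
    local_value S (H, \<Phi>) (U, \<phi>) k * local_value S (H, \<Phi>) (V, \<psi>) (k \<otimes> g)"
proof -
  have H: "subgroup H S" and \<Phi>: "\<Phi> \<in> ext_hom (dual_group A (S\<lparr>carrier := H\<rparr>)) field_units"
    using p by (auto simp: spairs_def)
  have conj: "local_value S (H, \<Phi>) (V, \<psi>) (k \<otimes> g) = local_value S (H, \<Phi>) (conj_set S g V, conj_char S g V \<psi>) k"
    using local_value_mconj[of "(H, \<Phi>)" "(V, \<psi>)" g k] r g k subgroup.subset[OF H] by (simp add: mconj_def)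
  show ?thesis
  proof (cases "\<forall>x\<in>H. inv k \<otimes> x \<otimes> k \<in> U \<inter> conj_set S g V")
    case True
    let ?\<alpha> = "\<lambda>x\<in>H. \<phi> (inv k \<otimes> x \<otimes> k)" and ?\<beta> = "\<lambda>x\<in>H. conj_char S g V \<psi> (inv k \<otimes> x \<otimes> k)"
    have "?\<alpha> \<in> Dual H" by (rule pullback_in_Dual[OF H k]) (use True q in \<open>auto simp: mpairs_iff\<close>)
    moreover have "?\<beta> \<in> Dual H"
      by (rule pullback_in_Dual[OF H k conj_char_in_Dual]) (use True r g in \<open>auto simp: mpairs_iff\<close>)
    ultimately have "\<Phi> (?\<alpha> \<otimes>\<^bsub>dual_group A (S\<lparr>carrier := H\<rparr>)\<^esub> ?\<beta>) = \<Phi> ?\<alpha> * \<Phi> ?\<beta>"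
      using \<Phi> by (auto simp: ext_hom_field_units_iff)
    moreover have "?\<alpha> \<otimes>\<^bsub>dual_group A (S\<lparr>carrier := H\<rparr>)\<^esub> ?\<beta> =
        (\<lambda>x\<in>H. (\<lambda>x\<in>U \<inter> conj_set S g V. \<phi> x \<otimes>\<^bsub>A\<^esub> conj_char S g V \<psi> x) (inv k \<otimes> x \<otimes> k))"
      unfolding dual_group_def by simp (rule restrict_ext, use True in auto)
    ultimately show ?thesis unfolding conj using True by (simp add: local_value_def)
  next
    case False
    then show ?thesis unfolding conj by (auto simp: local_value_def)
  qed
qed

text \<open>
  The summand at \<open>k\<close> for the product pair at \<open>g\<close> is the product of the summands at \<open>k\<close> and \<open>kg\<close>. The
  weights \<open>1/\<bar>U \<inter> gVg\<^sup>-\<^sup>1\<bar> = \<bar>UgV\<bar> / (\<bar>U\<bar> \<bar>V\<bar>)\<close> turn the sum over double cosets into a sum over all \<open>g\<close>,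
  and the substitution of \<open>kg\<close> by \<open>g\<close> separates the two factors.
\<close>

lemma sum_mark_double_cosets:
  fixes \<Phi> :: "('g \<Rightarrow> 'a) \<Rightarrow> 'k::field_char_0"
  assumes p: "(H, \<Phi>) \<in> spairs A S" and q: "(U, \<phi>) \<in> mpairs A S" and r: "(V, \<psi>) \<in> mpairs A S"
  shows "(\<Sum>D\<in>double_cosets S U V. mark S (H, \<Phi>) (U \<inter> conj_set S (rep D) V,
      \<lambda>x\<in>U \<inter> conj_set S (rep D) V. \<phi> x \<otimes>\<^bsub>A\<^esub> conj_char S (rep D) V \<psi> x)) =
    mark S (H, \<Phi>) (U, \<phi>) * mark S (H, \<Phi>) (V, \<psi>)"
proof -
  have U: "subgroup U S" and V: "subgroup V S" and H: "subgroup H S"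
    using p q r by (auto simp: mpairs_iff spairs_def)
  have Hc: "H \<subseteq> carrier S" by (rule subgroup.subset[OF H])
  let ?a = "local_value S (H, \<Phi>) (U, \<phi>)" and ?b = "local_value S (H, \<Phi>) (V, \<psi>)"
  let ?u = "of_nat (card U) :: 'k" and ?v = "of_nat (card V) :: 'k"
  define F where "F g = (\<Sum>k\<in>carrier S. ?a k * ?b (k \<otimes> g))" for g
  have nz: "?u \<noteq> 0" "?v \<noteq> 0" using of_nat_card_subgroup U V by auto
  \<comment> \<open>Invariance on the left is not termwise: it needs the substitution of \<open>ku\<close> for \<open>k\<close>.\<close>
  have inv: "F (u \<otimes> g \<otimes> v) = F g" if u: "u \<in> U" and g: "g \<in> carrier S" and v: "v \<in> V" for u g v
  proof -
    have uc: "u \<in> carrier S" and vc: "v \<in> carrier S" using u v U V by (auto dest: subgroup.mem_carrier)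
    have "F (u \<otimes> g \<otimes> v) = (\<Sum>k\<in>carrier S. ?a (k \<otimes> u) * ?b (k \<otimes> u \<otimes> g))"
      unfolding F_def
    proof (rule sum.cong[OF refl])
      fix k assume k: "k \<in> carrier S"
      have "?a (k \<otimes> u) = ?a k" by (rule local_value_right_invariant) (use Hc q k u in auto)
      moreover have "?b (k \<otimes> u \<otimes> g \<otimes> v) = ?b (k \<otimes> u \<otimes> g)"
        by (rule local_value_right_invariant) (use Hc r k uc g v in auto)
      ultimately show "?a k * ?b (k \<otimes> (u \<otimes> g \<otimes> v)) = ?a (k \<otimes> u) * ?b (k \<otimes> u \<otimes> g)"
        using k uc g vc by (simp add: m_assoc)
    qed
    also have "\<dots> = F g" unfolding F_def
      by (rule sum.reindex_bij_witness[of _ "\<lambda>k. k \<otimes> inv u" "\<lambda>k. k \<otimes> u"]) (use uc in \<open>auto simp: group_simps\<close>)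
    finally show ?thesis .
  qed
  have "mark S (H, \<Phi>) (U \<inter> conj_set S (rep D) V,
      \<lambda>x\<in>U \<inter> conj_set S (rep D) V. \<phi> x \<otimes>\<^bsub>A\<^esub> conj_char S (rep D) V \<psi> x) = of_nat (card D) * F (rep D) / (?u * ?v)"
    if D: "D \<in> double_cosets S U V" for D
  proof -
    let ?W = "U \<inter> conj_set S (rep D) V"
    have g: "rep D \<in> carrier S" using double_cosetsE[OF U V D] by blast
    have W: "of_nat (card ?W) \<noteq> (0::'k)" by (rule of_nat_card_subgroup) (rule inter_conj_subgroup[OF U V g])
    have "of_nat (card D) * of_nat (card ?W) = ?u * ?v"
      using card_rep_dcoset[OF U V D] by (metis of_nat_mult)
    then have "F (rep D) / of_nat (card ?W) = of_nat (card D) * F (rep D) / (?u * ?v)"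
      using W nz by (simp add: frac_eq_eq)
    moreover have "mark S (H, \<Phi>) (?W, \<lambda>x\<in>?W. \<phi> x \<otimes>\<^bsub>A\<^esub> conj_char S (rep D) V \<psi> x) = F (rep D) / of_nat (card ?W)"
      using local_value_mult[OF p q r g] by (simp add: mark_def F_def)
    ultimately show ?thesis by simp
  qed
  then have "(\<Sum>D\<in>double_cosets S U V. mark S (H, \<Phi>) (U \<inter> conj_set S (rep D) V,
      \<lambda>x\<in>U \<inter> conj_set S (rep D) V. \<phi> x \<otimes>\<^bsub>A\<^esub> conj_char S (rep D) V \<psi> x)) =
      (\<Sum>D\<in>double_cosets S U V. of_nat (card D) * F (rep D)) / (?u * ?v)"
    by (simp add: sum_divide_distrib)
  also have "\<dots> = (\<Sum>g\<in>carrier S. F g) / (?u * ?v)" using sum_double_cosets[OF U V inv] by simp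
  also have "(\<Sum>g\<in>carrier S. F g) = (\<Sum>k\<in>carrier S. ?a k * (\<Sum>g\<in>carrier S. ?b (k \<otimes> g)))"
    unfolding F_def by (subst sum.swap) (simp add: sum_distrib_left)
  also have "\<dots> = (\<Sum>k\<in>carrier S. ?a k * (\<Sum>g\<in>carrier S. ?b g))"
  proof (rule sum.cong[OF refl])
    fix k assume k: "k \<in> carrier S"
    have "(\<Sum>g\<in>carrier S. ?b (k \<otimes> g)) = (\<Sum>g\<in>carrier S. ?b g)"
      by (rule sum.reindex_bij_witness[of _ "\<lambda>g. inv k \<otimes> g" "\<lambda>g. k \<otimes> g"]) (use k in \<open>auto simp: group_simps\<close>)
    then show "?a k * (\<Sum>g\<in>carrier S. ?b (k \<otimes> g)) = ?a k * (\<Sum>g\<in>carrier S. ?b g)" by simp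
  qed
  also have "\<dots> / (?u * ?v) = mark S (H, \<Phi>) (U, \<phi>) * mark S (H, \<Phi>) (V, \<psi>)"
    by (simp add: mark_def sum_distrib_right)
  finally show ?thesis .
qed

lemma basis_mult_in_burnside:
  assumes "rep c \<in> mpairs A S" "rep d \<in> mpairs A S"
  shows "basis_mult A S c d \<in> burnside A S"
proof -
  obtain U \<phi> V \<psi> where q: "rep c = (U, \<phi>)" "rep d = (V, \<psi>)" by fastforce
  have U: "subgroup U S" and V: "subgroup V S" using assms q by (auto simp: mpairs_iff)
  show ?thesis unfolding basis_mult_def q Let_def prod.case
    by (intro burnside_closed_sum burnside_single mult_pair_in_mpairs)
       (use assms q double_cosetsE[OF U V] in auto)
qed

lemma bmult_in_burnside:
  assumes "x \<in> burnside A S" "y \<in> burnside A S"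
  shows "bmult A S x y \<in> burnside A S"
  unfolding bmult_def
  by (intro burnside_closed_lin_ext basis_mult_in_burnside burnside_rep(1)[OF assms(1)] burnside_rep(1)[OF assms(2)])

lemma species_bmult:
  fixes x y :: "('g, 'a) mpair set \<Rightarrow>\<^sub>0 'k::field_char_0"
  assumes p: "p \<in> spairs A S" and x: "x \<in> burnside A S" and y: "y \<in> burnside A S"
  shows "species S p (bmult A S x y) = species S p x * species S p y"
proof -
  obtain H \<Phi> where pp: "p = (H, \<Phi>)" by (cases p)
  have H: "subgroup H S" using p by (simp add: pp spairs_def)
  have basis: "species S (H, \<Phi>) (basis_mult A S c d) = mark S (H, \<Phi>) (rep c) * mark S (H, \<Phi>) (rep d)"
    if c: "c \<in> Poly_Mapping.keys x" and d: "d \<in> Poly_Mapping.keys y" for c d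
  proof -
    obtain U \<phi> V \<psi> where q: "rep c = (U, \<phi>)" "rep d = (V, \<psi>)" by fastforce
    have mp: "(U, \<phi>) \<in> mpairs A S" "(V, \<psi>) \<in> mpairs A S" using burnside_rep(1)[OF x c] burnside_rep(1)[OF y d] q by auto
    then have U: "subgroup U S" and V: "subgroup V S" by (auto simp: mpairs_iff)
    have "species S (H, \<Phi>) (basis_mult A S c d) = (\<Sum>D\<in>double_cosets S U V. mark S (H, \<Phi>) (U \<inter> conj_set S (rep D) V,
      \<lambda>x\<in>U \<inter> conj_set S (rep D) V. \<phi> x \<otimes>\<^bsub>A\<^esub> conj_char S (rep D) V \<psi> x))"
      unfolding basis_mult_def q Let_def prod.case species_sum
      by (intro sum.cong refl species_single mult_pair_in_mpairs mp H) (use double_cosetsE[OF U V] in blast)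
    then show ?thesis using sum_mark_double_cosets[OF p[unfolded pp] mp] q by simp
  qed
  have "species S (H, \<Phi>) (bmult A S x y) =
    lin_form (\<lambda>c. lin_form (\<lambda>d. mark S (H, \<Phi>) (rep c) * mark S (H, \<Phi>) (rep d)) y) x"
    unfolding bmult_def
    by (subst species_lin_ext[OF H], intro burnside_closed_lin_ext basis_mult_in_burnside burnside_rep(1)[OF x] burnside_rep(1)[OF y], assumption, assumption)
       (intro lin_form_cong, subst species_lin_ext[OF H], intro basis_mult_in_burnside burnside_rep(1)[OF x] burnside_rep(1)[OF y], assumption, assumption, intro lin_form_cong basis)
  also have "\<dots> = lin_form (\<lambda>c. mark S (H, \<Phi>) (rep c)) x * lin_form (\<lambda>c. mark S (H, \<Phi>) (rep c)) y"
    by (rule lin_form_product)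
  finally show ?thesis unfolding pp by (simp add: species_eq_lin_form_mark[OF x H] species_eq_lin_form_mark[OF y H])
qed

section \<open>Conjugation of species\<close>

lemma conj_spair_in_spairs:
  fixes p :: "('g, 'a, 'k::field) spair"
  assumes p: "p \<in> spairs A S" and g: "g \<in> carrier S"
  shows "conj_spair A S g p \<in> spairs A S"
proof -
  obtain H \<Phi> where pp: "p = (H, \<Phi>)" by (cases p)
  have H: "subgroup H S" and \<Phi>: "\<Phi> \<in> ext_hom (dual_group A (S\<lparr>carrier := H\<rparr>)) field_units"
    using p by (auto simp: spairs_def pp)
  have Hc: "H \<subseteq> carrier S" by (rule subgroup.subset[OF H])
  let ?K = "conj_set S g H"
  have K: "subgroup ?K S" by (rule subgroup_conj_set[OF H g])
  have pulled: "conj_char S (inv g) ?K \<phi> \<in> Dual H" if "\<phi> \<in> Dual ?K" for \<phi>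
    using conj_char_in_Dual[OF K inv_closed[OF g] that] by (simp add: conj_set_inv[OF Hc g])
  have mult: "conj_char S (inv g) ?K (\<phi> \<otimes>\<^bsub>dual_group A (S\<lparr>carrier := ?K\<rparr>)\<^esub> \<psi>) =
      conj_char S (inv g) ?K \<phi> \<otimes>\<^bsub>dual_group A (S\<lparr>carrier := H\<rparr>)\<^esub> conj_char S (inv g) ?K \<psi>" for \<phi> \<psi>
  proof -
    have "inv (inv g) \<otimes> x \<otimes> inv g \<in> ?K" if "x \<in> H" for x
      using that g Hc by (auto simp: conj_set_def)
    then show ?thesis by (simp add: conj_char_def conj_set_inv[OF Hc g] dual_group_def restrict_def fun_eq_iff)
  qed
  interpret DK: comm_group "dual_group A (S\<lparr>carrier := ?K\<rparr>)" by (rule comm_group_Dual[OF K])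
  show ?thesis
    using \<Phi> K pulled DK.m_closed unfolding spairs_def conj_spair_def pp Let_def
    by (auto simp: ext_hom_field_units_iff mult)
qed

lemma conj_spair_mult:
  fixes p :: "('g, 'a, 'k::field) spair"
  assumes p: "p \<in> spairs A S" and g: "g \<in> carrier S" and h: "h \<in> carrier S"
  shows "conj_spair A S g (conj_spair A S h p) = conj_spair A S (g \<otimes> h) p"
proof -
  obtain H \<Phi> where pp: "p = (H, \<Phi>)" by (cases p)
  have H: "subgroup H S" using p by (auto simp: spairs_def pp)
  have Hc: "H \<subseteq> carrier S" by (rule subgroup.subset[OF H])
  let ?K = "conj_set S (g \<otimes> h) H"
  have K: "subgroup ?K S" using H g h by (simp add: subgroup_conj_set)
  have Kc: "?K \<subseteq> carrier S" by (rule subgroup.subset[OF K])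
  have gK: "conj_set S (inv g) ?K = conj_set S h H"
    using Hc g h by (simp add: conj_set_mult group_simps)
  have "conj_char S (inv g) ?K \<phi> \<in> Dual (conj_set S h H)" if "\<phi> \<in> Dual ?K" for \<phi>
    using conj_char_in_Dual[OF K inv_closed[OF g] that] gK by simp
  moreover have "conj_char S (inv h) (conj_set S h H) (conj_char S (inv g) ?K \<phi>) = conj_char S (inv (g \<otimes> h)) ?K \<phi>" for \<phi> :: "'g \<Rightarrow> 'a"
    using conj_char_mult[OF Kc inv_closed[OF h] inv_closed[OF g], of \<phi>] g h by (simp add: gK inv_mult_group)
  ultimately show ?thesis unfolding conj_spair_def Let_def pp fst_conv snd_conv conj_set_mult[OF Hc g h]
    by (intro arg_cong2[of _ _ _ _ Pair] refl restrict_ext) (simp add: gK)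
qed

lemma conj_spair_one:
  fixes p :: "('g, 'a, 'k::field) spair"
  assumes p: "p \<in> spairs A S"
  shows "conj_spair A S \<one> p = p"
proof -
  obtain H \<Phi> where pp: "p = (H, \<Phi>)" by (cases p)
  have H: "subgroup H S" and e: "\<Phi> \<in> extensional (Dual H)" using p by (auto simp: spairs_def pp ext_hom_def)
  have Hc: "H \<subseteq> carrier S" by (rule subgroup.subset[OF H])
  have "(\<lambda>\<phi>\<in>Dual H. \<Phi> (conj_char S \<one> H \<phi>)) = \<Phi>"
  proof (rule extensionalityI)
    show "(\<lambda>\<phi>\<in>Dual H. \<Phi> (conj_char S \<one> H \<phi>)) \<in> extensional (Dual H)" by (rule restrict_extensional)
    show "(\<lambda>\<phi>\<in>Dual H. \<Phi> (conj_char S \<one> H \<phi>)) \<phi> = \<Phi> \<phi>" if \<phi>: "\<phi> \<in> Dual H" for \<phi>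
    proof -
      have "\<phi> \<in> extensional H" using \<phi> by (simp only: dual_iff)
      then show ?thesis using \<phi> by (simp add: conj_char_one[OF Hc])
    qed
  qed (rule e)
  then show ?thesis by (simp add: conj_spair_def pp conj_set_one[OF Hc])
qed

lemma conj_spair_inv:
  fixes p :: "('g, 'a, 'k::field) spair"
  assumes "p \<in> spairs A S" "q \<in> spairs A S" "g \<in> carrier S"
  shows "conj_spair A S (inv g) q = p \<longleftrightarrow> q = conj_spair A S g p"
proof
  assume "conj_spair A S (inv g) q = p"
  then show "q = conj_spair A S g p"
    using conj_spair_mult[OF assms(2,3) inv_closed[OF assms(3)]] assms by (simp add: conj_spair_one)
next
  assume "q = conj_spair A S g p"
  then show "conj_spair A S (inv g) q = p"
    using conj_spair_mult[OF assms(1) inv_closed[OF assms(3)] assms(3)] assms by (simp add: conj_spair_one)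
qed

lemma spair_conjugate_sym:
  fixes p q :: "('g, 'a, 'k::field) spair"
  assumes p: "p \<in> spairs A S" and c: "spair_conjugate A S p q"
  shows "spair_conjugate A S q p"
proof -
  obtain g where g: "g \<in> carrier S" "q = conj_spair A S g p" using c by (auto simp: spair_conjugate_def)
  then have "p = conj_spair A S (inv g) q"
    using conj_spair_inv[OF p _ g(1), of q] conj_spair_in_spairs[OF p g(1)] by simp
  then show ?thesis using g unfolding spair_conjugate_def by blast
qed

lemma local_value_conj_spair:
  fixes p :: "('g, 'a, 'k::field) spair"
  assumes p: "p \<in> spairs A S" and q: "q \<in> mpairs A S" and g: "g \<in> carrier S" and k: "k \<in> carrier S"
  shows "local_value S (conj_spair A S g p) q k = local_value S p q (inv g \<otimes> k)"
proof -
  obtain H \<Phi> where pp: "p = (H, \<Phi>)" by (cases p)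
  have H: "subgroup H S" using p by (auto simp: spairs_def pp)
  have Hc: "H \<subseteq> carrier S" by (rule subgroup.subset[OF H])
  let ?K = "conj_set S g H"
  have K: "subgroup ?K S" by (rule subgroup_conj_set[OF H g])
  have eq: "inv k \<otimes> (g \<otimes> y \<otimes> inv g) \<otimes> k = inv (inv g \<otimes> k) \<otimes> y \<otimes> (inv g \<otimes> k)" if "y \<in> H" for y
    using that Hc g k by (auto simp: group_simps)
  have cond: "(\<forall>x\<in>?K. inv k \<otimes> x \<otimes> k \<in> fst q) \<longleftrightarrow> (\<forall>y\<in>H. inv (inv g \<otimes> k) \<otimes> y \<otimes> (inv g \<otimes> k) \<in> fst q)"
    using eq by (simp add: conj_set_def)
  show ?thesis
  proof (cases "\<forall>x\<in>?K. inv k \<otimes> x \<otimes> k \<in> fst q")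
    case True
    let ?\<theta> = "\<lambda>x\<in>?K. snd q (inv k \<otimes> x \<otimes> k)"
    have "?\<theta> \<in> Dual ?K" by (rule pullback_in_Dual[OF K k]) (use True q in \<open>auto simp: mpairs_iff\<close>)
    moreover have "conj_char S (inv g) ?K ?\<theta> = (\<lambda>y\<in>H. snd q (inv (inv g \<otimes> k) \<otimes> y \<otimes> (inv g \<otimes> k)))"
      unfolding conj_char_def conj_set_inv[OF Hc g]
    proof (rule restrict_ext)
      fix y assume y: "y \<in> H"
      have "inv (inv g) \<otimes> y \<otimes> inv g = g \<otimes> y \<otimes> inv g" using g by simp
      moreover have "g \<otimes> y \<otimes> inv g \<in> ?K" using y by (simp add: conj_set_def)
      ultimately show "?\<theta> (inv (inv g) \<otimes> y \<otimes> inv g) = snd q (inv (inv g \<otimes> k) \<otimes> y \<otimes> (inv g \<otimes> k))"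
        using eq[OF y] by simp
    qed
    ultimately show ?thesis using True cond by (simp add: local_value_def conj_spair_def pp Let_def)
  next
    case False
    then show ?thesis using cond by (auto simp: local_value_def conj_spair_def pp Let_def)
  qed
qed

text \<open>
  Conjugating \<open>p\<close> by \<open>g\<close> only permutes the summands, by left translation.
\<close>

lemma species_conj_spair:
  fixes p :: "('g, 'a, 'k::field_char_0) spair"
  assumes p: "p \<in> spairs A S" and x: "x \<in> burnside A S" and g: "g \<in> carrier S"
  shows "species S (conj_spair A S g p) x = species S p x"
proof -
  have mark: "mark S (conj_spair A S g p) q = mark S p q" if q: "q \<in> mpairs A S" for q
  proof -
    have "(\<Sum>k\<in>carrier S. local_value S (conj_spair A S g p) q k) = (\<Sum>k\<in>carrier S. local_value S p q (inv g \<otimes> k))"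
      by (intro sum.cong refl local_value_conj_spair p q g)
    also have "\<dots> = (\<Sum>k\<in>carrier S. local_value S p q k)"
      by (rule sum.reindex_bij_witness[of _ "\<lambda>k. g \<otimes> k" "\<lambda>k. inv g \<otimes> k"]) (use g in \<open>auto simp: group_simps\<close>)
    finally show ?thesis by (simp add: mark_def)
  qed
  have sub: "subgroup (fst r) S" if "r \<in> spairs A S" for r :: "('g, 'a, 'k) spair" using that by (auto simp: spairs_def)
  have exp: "species S r x = lin_form (\<lambda>c. mark S r (rep c)) x" if "r \<in> spairs A S" for r
    using species_eq_lin_form_mark[OF x sub[OF that], of "snd r"] by simp
  show ?thesis unfolding exp[OF p] exp[OF conj_spair_in_spairs[OF p g]]
    by (rule lin_form_cong) (rule mark[OF burnside_rep(1)[OF x]])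
qed

section \<open>Moebius inversion over subgroups\<close>

text \<open>
  The species of \<open>\<bar>U\<bar> [U, \<phi>]\<close> sums over all \<open>g\<close> with \<open>H \<le> gUg\<^sup>-\<^sup>1\<close>. Sorting these by the subgroup
  \<open>W = g\<^sup>-\<^sup>1Hg\<close> of \<open>U\<close> expresses it through sums over \<open>gWg\<^sup>-\<^sup>1 = H\<close>, so that elements with the latter
  species arise by recursion on \<open>\<bar>U\<bar>\<close>.
\<close>

lemma moebius_element_exists:
  assumes "q \<in> mpairs A S"
  shows "\<exists>y :: ('g, 'a) mpair set \<Rightarrow>\<^sub>0 'k::field_char_0. y \<in> burnside A S \<and>
    (\<forall>H \<Phi>. subgroup H S \<longrightarrow> species S (H, \<Phi>) y =
       (\<Sum>g\<in>carrier S. if conj_set S g (fst q) = H then \<Phi> (conj_char S g (fst q) (snd q)) else 0))"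
  using assms
proof (induction "card (fst q)" arbitrary: q rule: less_induct)
  case less
  obtain U \<phi> where q: "q = (U, \<phi>)" by (cases q)
  have U: "subgroup U S" and \<phi>: "\<phi> \<in> Dual U" using less.prems by (auto simp: q mpairs_iff)
  have Uc: "U \<subseteq> carrier S" by (rule subgroup.subset[OF U])
  let ?top = "\<lambda>H \<Phi> W g. if conj_set S g W = H then \<Phi> (conj_char S g W (restrict \<phi> W)) else (0 :: 'k)"
  \<comment> \<open>The proper subgroups of \<open>U\<close>, for which the element is known by induction.\<close>
  define Ws where "Ws = {W. subgroup W S \<and> W \<subset> U}"
  have fin: "finite Ws" by (rule finite_subset[of _ "Pow U"]) (use subgroup_finite[OF U] in \<open>auto simp: Ws_def\<close>)
  define P where "P W y \<longleftrightarrow> y \<in> burnside A S \<and> (\<forall>H \<Phi>. subgroup H S \<longrightarrow>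
      species S (H, \<Phi>) y = (\<Sum>g\<in>carrier S. ?top H \<Phi> W g))" for W and y :: "('g, 'a) mpair set \<Rightarrow>\<^sub>0 'k"
  have "\<exists>y. P W y" if W: "W \<in> Ws" for W
  proof -
    have "card W < card U" using W subgroup_finite[OF U] by (auto simp: Ws_def intro: psubset_card_mono)
    moreover have "(W, restrict \<phi> W) \<in> mpairs A S"
      using W restrict_in_Dual[OF \<phi>, of W] by (auto simp: Ws_def mpairs_iff)
    ultimately show ?thesis using less.hyps[of "(W, restrict \<phi> W)", unfolded q fst_conv snd_conv]
      unfolding P_def by blast
  qed
  then obtain y where "\<And>W. W \<in> Ws \<Longrightarrow> P W (y W)" by metis
  then have y: "\<And>W. W \<in> Ws \<Longrightarrow> y W \<in> burnside A S"
    "\<And>W H \<Phi>. W \<in> Ws \<Longrightarrow> subgroup H S \<Longrightarrow> species S (H, \<Phi>) (y W) = (\<Sum>g\<in>carrier S. ?top H \<Phi> W g)"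
    by (simp_all add: P_def)
  define z where "z = bscale (of_nat (card U)) (Poly_Mapping.single (mclass S (U, \<phi>)) (1 :: 'k)) - (\<Sum>W\<in>Ws. y W)"
  have "z \<in> burnside A S" unfolding z_def
    by (intro burnside_closed_diff burnside_closed_bscale burnside_single burnside_closed_sum y less.prems[unfolded q])
  moreover have "species S (H, \<Phi>) z = (\<Sum>g\<in>carrier S. if conj_set S g U = H then \<Phi> (conj_char S g U \<phi>) else 0)"
    if H: "subgroup H S" for H \<Phi>
  proof -
    have Hc: "H \<subseteq> carrier S" by (rule subgroup.subset[OF H])
    have r: "restrict \<phi> U = \<phi>" using \<phi> by (simp add: dual_iff extensional_restrict)
    have lv: "local_value S (H, \<Phi>) (U, \<phi>) g = ?top H \<Phi> U g + (\<Sum>W\<in>Ws. ?top H \<Phi> W g)" if g: "g \<in> carrier S" for g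
    proof -
      let ?V = "conj_set S (inv g) H"
      have V: "subgroup ?V S" by (rule subgroup_conj_set[OF H inv_closed[OF g]])
      have iff: "conj_set S g W = H \<longleftrightarrow> W = ?V" if "W \<subseteq> carrier S" for W
        using conj_set_inv[OF that g] conj_set_inv[OF Hc g] by auto
      have val: "conj_char S g ?V (restrict \<phi> ?V) = (\<lambda>x\<in>H. \<phi> (inv g \<otimes> x \<otimes> g))"
        unfolding conj_char_def conj_set_inv[OF Hc g]
      proof (rule restrict_ext)
        fix x assume x: "x \<in> H"
        then have "inv g \<otimes> x \<otimes> g \<in> ?V" using g by (auto simp: conj_set_def)
        then show "restrict \<phi> ?V (inv g \<otimes> x \<otimes> g) = \<phi> (inv g \<otimes> x \<otimes> g)" by simp
      qed
      have top: "?top H \<Phi> W g = (if W = ?V then \<Phi> (\<lambda>x\<in>H. \<phi> (inv g \<otimes> x \<otimes> g)) else 0)" if "W \<subseteq> carrier S" for W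
        using iff[OF that] val by auto
      have "(\<Sum>W\<in>Ws. ?top H \<Phi> W g) = (\<Sum>W\<in>Ws. if W = ?V then \<Phi> (\<lambda>x\<in>H. \<phi> (inv g \<otimes> x \<otimes> g)) else 0)"
        by (intro sum.cong refl top) (use Uc in \<open>auto simp: Ws_def\<close>)
      also have "\<dots> = (if ?V \<in> Ws then \<Phi> (\<lambda>x\<in>H. \<phi> (inv g \<otimes> x \<otimes> g)) else 0)"
        using fin by (rule sum.delta)
      finally have 1: "(\<Sum>W\<in>Ws. ?top H \<Phi> W g) = (if ?V \<in> Ws then \<Phi> (\<lambda>x\<in>H. \<phi> (inv g \<otimes> x \<otimes> g)) else 0)" .
      have 2: "(\<forall>x\<in>H. inv g \<otimes> x \<otimes> g \<in> U) \<longleftrightarrow> ?V \<subseteq> U"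
        using g by (auto simp: conj_set_def)
      show ?thesis unfolding 1 top[OF Uc] local_value_def fst_conv snd_conv 2 using V by (auto simp: Ws_def)
    qed
    have "species S (H, \<Phi>) z = of_nat (card U) * mark S (H, \<Phi>) (U, \<phi>) - (\<Sum>W\<in>Ws. \<Sum>g\<in>carrier S. ?top H \<Phi> W g)"
      unfolding z_def species_diff species_bscale species_sum species_single[OF less.prems[unfolded q] H]
      by (simp add: y(2)[OF _ H])
    also have "of_nat (card U) * mark S (H, \<Phi>) (U, \<phi>) = (\<Sum>g\<in>carrier S. local_value S (H, \<Phi>) (U, \<phi>) g)"
      using of_nat_card_subgroup[OF U, where 'k = 'k] by (simp add: mark_def)
    also have "\<dots> = (\<Sum>g\<in>carrier S. ?top H \<Phi> U g) + (\<Sum>g\<in>carrier S. \<Sum>W\<in>Ws. ?top H \<Phi> W g)"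
      unfolding sum.distrib[symmetric] by (intro sum.cong refl lv)
    also have "(\<Sum>g\<in>carrier S. \<Sum>W\<in>Ws. ?top H \<Phi> W g) = (\<Sum>W\<in>Ws. \<Sum>g\<in>carrier S. ?top H \<Phi> W g)" by (rule sum.swap)
    finally show ?thesis unfolding r by simp
  qed
  ultimately show ?case unfolding q fst_conv snd_conv by blast
qed

end

section \<open>Species determine elements and idempotents exist\<close>

text \<open>
  The parameter \<open>K\<close> fixes the field in which characters take their values, since its type occurs in
  none of the other parameters.
\<close>

locale split_monomial = finite_monomial A S
  for A :: "('a, 'c) monoid_scheme" and S :: "('g, 'b) monoid_scheme" (structure) +
  fixes K :: "'k::field_char_0 itself"
  assumes finite_Dual: "subgroup H S \<Longrightarrow> finite (Dual H)"
    and separates_Dual: "subgroup H S \<Longrightarrow> separates_points TYPE('k) (dual_group A (S\<lparr>carrier := H\<rparr>))"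
begin

text \<open>
  Fourier inversion on the finite abelian group \<open>H\<^sup>*\<close>: the indicator of \<open>\<theta>\<close> is a combination of
  characters, so species at indicators are combinations of species at characters.
\<close>

lemma species_indicator_eq_0:
  assumes x: "x \<in> burnside A S" and zero: "\<And>p. p \<in> spairs A S \<Longrightarrow> species S p x = (0::'k)"
    and H: "subgroup H S" and \<theta>: "\<theta> \<in> Dual H"
  shows "species S (H, \<lambda>\<phi>. if \<theta> = \<phi> then 1 else (0::'k)) x = 0"
proof -
  let ?X = "dual_group A (S\<lparr>carrier := H\<rparr>)"
  interpret X: comm_group ?X by (rule comm_group_Dual[OF H])
  define C where "C = ext_hom ?X (field_units :: 'k monoid)"
  have C0: "of_nat (card C) \<noteq> (0::'k)"
  proof -
    have "(\<lambda>\<phi>\<in>carrier ?X. 1) \<in> C" by (auto simp: C_def ext_hom_field_units_iff)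
    moreover have "finite C" unfolding C_def by (rule finite_characters[OF X.group_axioms finite_Dual[OF H]])
    ultimately show ?thesis by (auto simp: card_eq_0_iff)
  qed
  let ?\<delta> = "\<lambda>\<phi>. if \<theta> = \<phi> then 1 else (0::'k)"
  have "of_nat (card C) * mark S (H, ?\<delta>) q = (\<Sum>\<chi>\<in>C. \<chi> (inv\<^bsub>?X\<^esub> \<theta>) * mark S (H, \<chi>) q)"
    if q: "q \<in> mpairs A S" for q
  proof -
    have "of_nat (card C) * local_value S (H, ?\<delta>) q g = (\<Sum>\<chi>\<in>C. \<chi> (inv\<^bsub>?X\<^esub> \<theta>) * local_value S (H, \<chi>) q g)"
      if g: "g \<in> carrier S" for g
    proof (cases "\<forall>x\<in>H. inv g \<otimes> x \<otimes> g \<in> fst q")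
      case True
      let ?\<eta> = "\<lambda>x\<in>H. snd q (inv g \<otimes> x \<otimes> g)"
      have "?\<eta> \<in> Dual H" by (rule pullback_in_Dual[OF H g]) (use True q in \<open>auto simp: mpairs_iff\<close>)
      then have "(\<Sum>\<chi>\<in>C. \<chi> (inv\<^bsub>?X\<^esub> \<theta>) * \<chi> ?\<eta>) = (if \<theta> = ?\<eta> then of_nat (card C) else 0)"
        unfolding C_def by (intro second_orthogonality X.group_axioms separates_Dual H \<theta>)
      then show ?thesis using True by (simp add: local_value_def)
    next
      case False
      then have "local_value S (H, \<Psi>) q g = 0" for \<Psi> :: "('g \<Rightarrow> 'a) \<Rightarrow> 'k"
        unfolding local_value_def fst_conv by (rule if_not_P)
      then show ?thesis by simp
    qed
    then have "of_nat (card C) * (\<Sum>g\<in>carrier S. local_value S (H, ?\<delta>) q g) =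
        (\<Sum>g\<in>carrier S. \<Sum>\<chi>\<in>C. \<chi> (inv\<^bsub>?X\<^esub> \<theta>) * local_value S (H, \<chi>) q g)"
      unfolding sum_distrib_left by (intro sum.cong refl)
    also have "\<dots> = (\<Sum>\<chi>\<in>C. \<chi> (inv\<^bsub>?X\<^esub> \<theta>) * (\<Sum>g\<in>carrier S. local_value S (H, \<chi>) q g))"
      unfolding sum_distrib_left by (rule sum.swap)
    finally show ?thesis by (simp add: mark_def flip: sum_divide_distrib)
  qed
  then have marks: "of_nat (card C) * mark S (H, ?\<delta>) (rep c) = (\<Sum>\<chi>\<in>C. \<chi> (inv\<^bsub>?X\<^esub> \<theta>) * mark S (H, \<chi>) (rep c))"
    if "c \<in> Poly_Mapping.keys x" for c using burnside_rep(1)[OF x that] .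
  have "of_nat (card C) * species S (H, ?\<delta>) x = lin_form (\<lambda>c. of_nat (card C) * mark S (H, ?\<delta>) (rep c)) x"
    by (simp add: species_eq_lin_form_mark[OF x H] lin_form_def sum_distrib_left mult.left_commute)
  also have "\<dots> = lin_form (\<lambda>c. \<Sum>\<chi>\<in>C. \<chi> (inv\<^bsub>?X\<^esub> \<theta>) * mark S (H, \<chi>) (rep c)) x"
    by (rule lin_form_cong) (rule marks)
  also have "\<dots> = (\<Sum>\<chi>\<in>C. \<chi> (inv\<^bsub>?X\<^esub> \<theta>) * species S (H, \<chi>) x)"
    by (simp add: lin_form_sum_fun species_eq_lin_form_mark[OF x H])
  also have "\<dots> = 0"
    using zero H by (intro sum.neutral ballI) (simp add: C_def spairs_def)
  finally show ?thesis using C0 by simp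
qed

text \<open>
  Among the classes in the support of \<open>x\<close> take \<open>[U, \<phi>]\<close> with \<open>\<bar>U\<bar>\<close> maximal. For the indicator of \<open>\<phi>\<close>
  on \<open>U\<^sup>*\<close>, another class \<open>[V, \<psi>]\<close> of the support has a nonzero mark only if \<open>(U, \<phi>)\<close> is the restriction of
  a conjugate of \<open>(V, \<psi>)\<close>; by maximality it is then equal to that conjugate. So only the coefficient of
  \<open>[U, \<phi>]\<close> contributes, and it must vanish.
\<close>

theorem species_separate:
  assumes x: "x \<in> burnside A S" and zero: "\<And>p. p \<in> spairs A S \<Longrightarrow> species S p x = (0::'k)"
  shows "x = 0"
proof (rule ccontr)
  assume "x \<noteq> 0"
  then have ne: "Poly_Mapping.keys x \<noteq> {}" by simp
  let ?m = "\<lambda>c. card (fst (rep c))"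
  obtain c where c: "c \<in> Poly_Mapping.keys x" and max: "\<And>d. d \<in> Poly_Mapping.keys x \<Longrightarrow> ?m d \<le> ?m c"
  proof -
    have "Max (?m ` Poly_Mapping.keys x) \<in> ?m ` Poly_Mapping.keys x" using ne by (intro Max_in) auto
    then obtain c where "c \<in> Poly_Mapping.keys x" "?m c = Max (?m ` Poly_Mapping.keys x)" by auto
    then show thesis using that[of c] by simp
  qed
  obtain U \<phi> where q: "rep c = (U, \<phi>)" by (cases "rep c")
  have mp: "(U, \<phi>) \<in> mpairs A S" and cls: "mclass S (U, \<phi>) = c" using burnside_rep[OF x c] q by auto
  have U: "subgroup U S" and \<phi>: "\<phi> \<in> Dual U" using mp by (auto simp: mpairs_iff)
  have Uc: "U \<subseteq> carrier S" by (rule subgroup.subset[OF U])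
  let ?\<delta> = "\<lambda>\<theta>. if \<phi> = \<theta> then 1 else (0::'k)"
  have other: "mark S (U, ?\<delta>) (rep d) = 0" if d: "d \<in> Poly_Mapping.keys x" and dc: "d \<noteq> c" for d
  proof -
    obtain V \<psi> where r: "rep d = (V, \<psi>)" by (cases "rep d")
    have mr: "(V, \<psi>) \<in> mpairs A S" and clr: "mclass S (V, \<psi>) = d" using burnside_rep[OF x d] r by auto
    have V: "subgroup V S" and \<psi>: "\<psi> \<in> Dual V" using mr by (auto simp: mpairs_iff)
    have "local_value S (U, ?\<delta>) (V, \<psi>) g = 0" if g: "g \<in> carrier S" for g
    proof (rule ccontr)
      assume "local_value S (U, ?\<delta>) (V, \<psi>) g \<noteq> 0"
      then have sub: "\<forall>x\<in>U. inv g \<otimes> x \<otimes> g \<in> V" and val: "\<phi> = (\<lambda>x\<in>U. \<psi> (inv g \<otimes> x \<otimes> g))"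
        by (auto simp: local_value_def split: if_splits)
      have Vc: "V \<subseteq> carrier S" by (rule subgroup.subset[OF V])
      have "U \<subseteq> conj_set S g V" using sub Uc by (auto simp: mem_conj_set[OF Vc g])
      moreover have "card (conj_set S g V) \<le> card U"
        using max[OF d] card_conj_set[OF Vc g] by (simp add: q r)
      moreover have "finite (conj_set S g V)" by (rule subgroup_finite[OF subgroup_conj_set[OF V g]])
      ultimately have UV: "U = conj_set S g V" by (metis card_seteq)
      then have "mconj S g (V, \<psi>) = (U, \<phi>)" using val by (simp add: mconj_def conj_char_def)
      then have "c = d" using mclass_mconj[OF mr g] clr cls by simp
      with dc show False by simp
    qed
    then show ?thesis by (simp add: mark_def r)
  qed
  have self: "mark S (U, ?\<delta>) (U, \<phi>) \<noteq> 0"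
  proof -
    let ?G = "{g \<in> carrier S. (\<forall>x\<in>U. inv g \<otimes> x \<otimes> g \<in> U) \<and> \<phi> = (\<lambda>x\<in>U. \<phi> (inv g \<otimes> x \<otimes> g))}"
    have "(\<Sum>g\<in>carrier S. local_value S (U, ?\<delta>) (U, \<phi>) g) = (\<Sum>g\<in>carrier S. if g \<in> ?G then 1 else 0)"
      by (intro sum.cong refl) (auto simp: local_value_def)
    also have "\<dots> = of_nat (card ?G)"
      using finite_S by (simp add: sum.If_cases Int_def)
    finally have 1: "(\<Sum>g\<in>carrier S. local_value S (U, ?\<delta>) (U, \<phi>) g) = of_nat (card ?G)" .
    have "\<phi> = (\<lambda>x\<in>U. \<phi> (inv \<one> \<otimes> x \<otimes> \<one>))"
    proof (rule extensionalityI)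
      show "\<phi> \<in> extensional U" using \<phi> by (simp only: dual_iff)
    qed (use Uc in auto)
    then have "\<one> \<in> ?G" using Uc by auto
    then have "card ?G \<noteq> 0" using finite_S by (auto simp: card_eq_0_iff)
    then show ?thesis using 1 of_nat_card_subgroup[OF U, where 'k = 'k] by (simp add: mark_def)
  qed
  have "0 = lin_form (\<lambda>d. mark S (U, ?\<delta>) (rep d)) x"
    using species_indicator_eq_0[OF x zero U \<phi>] species_eq_lin_form_mark[OF x U, of ?\<delta>] by simp
  also have "\<dots> = (\<Sum>d\<in>Poly_Mapping.keys x. if d = c then Poly_Mapping.lookup x c * mark S (U, ?\<delta>) (U, \<phi>) else 0)"
    unfolding lin_form_def by (intro sum.cong refl) (auto simp: other q)
  also have "\<dots> = Poly_Mapping.lookup x c * mark S (U, ?\<delta>) (U, \<phi>)" using c by simp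
  finally show False using self c by (simp add: in_keys_iff)
qed

corollary species_eqI:
  assumes "x \<in> burnside A S" "y \<in> burnside A S" and "\<And>p. p \<in> spairs A S \<Longrightarrow> species S p x = (species S p y :: 'k)"
  shows "x = y"
  using species_separate[of "x - y"] assms by (simp add: burnside_closed_diff species_diff)

text \<open>
  Let \<open>y \<theta>\<close> be the element from \<open>moebius_element_exists\<close> for \<open>(H, \<theta>)\<close>. In the species of
  \<open>z = (\<Sum>\<theta>. \<Phi> (\<theta>\<^sup>-\<^sup>1) y \<theta>)\<close> at \<open>(L, \<Psi>)\<close>, orthogonality leaves \<open>\<bar>H\<^sup>*\<bar>\<close> for each \<open>g\<close> that conjugates
  \<open>(H, \<Phi>)\<close> to \<open>(L, \<Psi>)\<close>. The number of these \<open>g\<close> is constant on the orbit and zero elsewhere, so a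
  multiple of \<open>z\<close> is the required element.
\<close>

lemma orbit_indicator_exists:
  assumes p: "p \<in> spairs A S"
  shows "\<exists>e\<in>burnside A S. \<forall>q\<in>spairs A S. species S q e = (if spair_conjugate A S q p then 1 else (0::'k))"
proof -
  obtain H \<Phi> where pp: "p = (H, \<Phi>)" by (cases p)
  have H: "subgroup H S" and \<Phi>: "\<Phi> \<in> ext_hom (dual_group A (S\<lparr>carrier := H\<rparr>)) (field_units :: 'k monoid)"
    using p by (auto simp: spairs_def pp)
  let ?X = "dual_group A (S\<lparr>carrier := H\<rparr>)"
  interpret X: comm_group ?X by (rule comm_group_Dual[OF H])
  \<comment> \<open>For \<open>q\<close> in the orbit of \<open>p\<close> this is the order of the stabilizer of \<open>p\<close>.\<close>
  define N where "N q = card {g \<in> carrier S. q = conj_spair A S g p}" for q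
  define P where "P \<theta> y \<longleftrightarrow> y \<in> burnside A S \<and> (\<forall>L \<Psi>. subgroup L S \<longrightarrow> species S (L, \<Psi>) y =
       (\<Sum>g\<in>carrier S. if conj_set S g H = L then \<Psi> (conj_char S g H \<theta>) else 0))"
    for \<theta> and y :: "('g, 'a) mpair set \<Rightarrow>\<^sub>0 'k"
  have "\<exists>y. P \<theta> y" if "\<theta> \<in> Dual H" for \<theta>
  proof -
    have "(H, \<theta>) \<in> mpairs A S" using that H by (simp add: mpairs_iff)
    from moebius_element_exists[OF this, unfolded fst_conv snd_conv] show ?thesis unfolding P_def .
  qed
  then obtain y where Py: "\<And>\<theta>. \<theta> \<in> Dual H \<Longrightarrow> P \<theta> (y \<theta>)" by metis
  have y: "\<And>\<theta>. \<theta> \<in> Dual H \<Longrightarrow> y \<theta> \<in> burnside A S"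
    and sy: "\<And>\<theta> L \<Psi>. \<theta> \<in> Dual H \<Longrightarrow> subgroup L S \<Longrightarrow> species S (L, \<Psi>) (y \<theta>) =
       (\<Sum>g\<in>carrier S. if conj_set S g H = L then \<Psi> (conj_char S g H \<theta>) else 0)"
    using Py unfolding P_def by blast+
  define z where "z = (\<Sum>\<theta>\<in>Dual H. bscale (\<Phi> (inv\<^bsub>?X\<^esub> \<theta>)) (y \<theta>))"
  have z: "z \<in> burnside A S" unfolding z_def by (intro burnside_closed_sum burnside_closed_bscale y)
  have sz: "species S q z = of_nat (card (Dual H)) * of_nat (N q)" if q: "q \<in> spairs A S" for q
  proof -
    obtain L \<Psi> where qq: "q = (L, \<Psi>)" by (cases q)
    have L: "subgroup L S" using q by (auto simp: spairs_def qq)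
    have Lc: "L \<subseteq> carrier S" and Hc: "H \<subseteq> carrier S" using subgroup.subset L H by auto
    have inner: "(\<Sum>\<theta>\<in>Dual H. \<Phi> (inv\<^bsub>?X\<^esub> \<theta>) * (if conj_set S g H = L then \<Psi> (conj_char S g H \<theta>) else 0)) =
        (if q = conj_spair A S g p then of_nat (card (Dual H)) else 0)" if g: "g \<in> carrier S" for g
    proof (cases "conj_set S g H = L")
      case True
      then have backward: "conj_set S (inv g) L = H" using conj_set_inv[OF Hc g] by simp
      let ?r = "conj_spair A S (inv g) q"
      have r: "?r \<in> spairs A S" by (rule conj_spair_in_spairs[OF q inv_closed[OF g]])
      have fst_r: "fst ?r = H" using backward by (simp add: conj_spair_def qq Let_def)
      have snd_r: "snd ?r \<theta> = \<Psi> (conj_char S g H \<theta>)" if "\<theta> \<in> Dual H" for \<theta>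
        using that backward g by (simp add: conj_spair_def qq Let_def)
      have r2: "snd ?r \<in> ext_hom ?X (field_units :: 'k monoid)" using r fst_r by (auto simp: spairs_def)
      have "(\<Sum>\<theta>\<in>Dual H. \<Phi> (inv\<^bsub>?X\<^esub> \<theta>) * (if conj_set S g H = L then \<Psi> (conj_char S g H \<theta>) else 0)) =
        (\<Sum>\<theta>\<in>Dual H. \<Phi> (inv\<^bsub>?X\<^esub> \<theta>) * snd ?r \<theta>)"
        using True snd_r by (intro sum.cong) auto
      also have "\<dots> = (if \<Phi> = snd ?r then of_nat (card (Dual H)) else 0)"
        by (rule first_orthogonality[OF X.comm_group_axioms \<Phi> r2])
      also have "\<Phi> = snd ?r \<longleftrightarrow> ?r = p" using fst_r by (auto simp: pp prod_eq_iff)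
      also have "\<dots> \<longleftrightarrow> q = conj_spair A S g p" by (rule conj_spair_inv[OF p q g])
      finally show ?thesis .
    next
      case False
      then show ?thesis by (auto simp: conj_spair_def pp qq Let_def)
    qed
    have "species S q z = (\<Sum>\<theta>\<in>Dual H. \<Phi> (inv\<^bsub>?X\<^esub> \<theta>) *
        (\<Sum>g\<in>carrier S. if conj_set S g H = L then \<Psi> (conj_char S g H \<theta>) else 0))"
      unfolding z_def qq species_sum species_bscale by (intro sum.cong refl) (simp add: sy[OF _ L])
    also have "\<dots> = (\<Sum>g\<in>carrier S. \<Sum>\<theta>\<in>Dual H. \<Phi> (inv\<^bsub>?X\<^esub> \<theta>) *
        (if conj_set S g H = L then \<Psi> (conj_char S g H \<theta>) else 0))"
      unfolding sum_distrib_left by (rule sum.swap)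
    also have "\<dots> = (\<Sum>g\<in>carrier S. if q = conj_spair A S g p then of_nat (card (Dual H)) else 0)"
      by (intro sum.cong refl inner)
    also have "\<dots> = of_nat (card (Dual H)) * of_nat (N q)"
      using finite_S by (simp add: sum.If_cases Int_def N_def mult.commute)
    finally show ?thesis .
  qed
  have nz: "of_nat (card (Dual H)) * of_nat (N p) \<noteq> (0::'k)"
  proof -
    have "\<one> \<in> {g \<in> carrier S. p = conj_spair A S g p}" using p by (simp add: conj_spair_one)
    then have "N p \<noteq> 0" using finite_S unfolding N_def by (auto simp: card_eq_0_iff)
    moreover have "card (Dual H) \<noteq> 0" using finite_Dual[OF H] X.one_closed by (auto simp: card_eq_0_iff)
    ultimately show ?thesis by simp
  qed
  let ?e = "bscale (1 / (of_nat (card (Dual H)) * of_nat (N p))) z"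
  have "species S q ?e = (if spair_conjugate A S q p then 1 else 0)" if q: "q \<in> spairs A S" for q
  proof (cases "spair_conjugate A S q p")
    case True
    then obtain g where g: "g \<in> carrier S" "p = conj_spair A S g q" by (auto simp: spair_conjugate_def)
    have "species S q z = species S p z" using species_conj_spair[OF q z g(1)] g(2) by simp
    then show ?thesis using True sz[OF p] nz by (simp add: species_bscale)
  next
    case False
    have "N q = 0"
    proof -
      have "{g \<in> carrier S. q = conj_spair A S g p} = {}"
        using False spair_conjugate_sym[OF p, of q] unfolding spair_conjugate_def by blast
      then show ?thesis unfolding N_def by (simp only: card.empty)
    qed
    then show ?thesis using False sz[OF q] by (simp add: species_bscale)
  qed
  moreover have "?e \<in> burnside A S" by (rule burnside_closed_bscale[OF z])
  ultimately show ?thesis by blast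
qed

text \<open>
  Any element whose species form an orbit indicator is idempotent, since its square has the same
  species. Hence the definite description of \<open>idem\<close> is fulfilled.
\<close>

theorem idem_characterization:
  assumes p: "p \<in> spairs A S"
  shows "idem A S p \<in> burnside A S"
    and "\<And>q. q \<in> spairs A S \<Longrightarrow> species S q (idem A S p) = (if spair_conjugate A S q p then 1 else (0::'k))"
proof -
  obtain e where e: "e \<in> burnside A S" and se: "\<And>q. q \<in> spairs A S \<Longrightarrow> species S q e = (if spair_conjugate A S q p then 1 else (0::'k))"
    using orbit_indicator_exists[OF p] by blast
  let ?P = "\<lambda>e. e \<in> burnside A S \<and> bmult A S e e = e \<and>
     (\<forall>q\<in>spairs A S. species S q e = (if spair_conjugate A S q p then 1 else (0::'k)))"
  have "bmult A S e e = e"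
    by (rule species_eqI[OF bmult_in_burnside[OF e e] e]) (simp add: species_bmult[OF _ e e] se)
  then have "?P e" using e se by blast
  moreover have "e' = e" if "?P e'" for e'
    using that se by (intro species_eqI[OF _ e]) auto
  ultimately have "?P (idem A S p)" unfolding idem_def by (rule theI)
  then show "idem A S p \<in> burnside A S"
    "\<And>q. q \<in> spairs A S \<Longrightarrow> species S q (idem A S p) = (if spair_conjugate A S q p then 1 else (0::'k))" by blast+
qed

lemma finite_spairs: "finite (spairs A S :: ('g, 'a, 'k) spair set)"
proof -
  have eq: "spairs A S = Sigma {H. subgroup H S} (\<lambda>H. ext_hom (dual_group A (S\<lparr>carrier := H\<rparr>)) (field_units :: 'k monoid))"
    by (auto simp: spairs_def)
  have fin: "finite {H. subgroup H S}"
    by (rule finite_subset[of _ "Pow (carrier S)"]) (use finite_S subgroup.subset in auto)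
  have "finite (ext_hom (dual_group A (S\<lparr>carrier := H\<rparr>)) (field_units :: 'k monoid))" if "subgroup H S" for H
    by (rule finite_characters) (use comm_group_Dual[OF that] finite_Dual[OF that] in \<open>auto simp: comm_group_def\<close>)
  then show ?thesis unfolding eq by (intro finite_SigmaI fin) blast
qed

end

section \<open>Inflation\<close>

text \<open>
  A normal subgroup \<open>N\<close> of a finite group, where both \<open>G\<close> and \<open>G/N\<close> carry the theory above. Products
  in \<open>G/N\<close> are computed from representatives (\<open>coset_mult\<close>), not as products of sets.
\<close>

locale quotient_monomial = finite_monomial A G + normal N G
  for A :: "('a, 'c) monoid_scheme" and G :: "('g, 'b) monoid_scheme" (structure) and N
begin

abbreviation "Q \<equiv> G Mod N"

lemma finite_quotient: "finite (carrier Q)"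
  unfolding carrier_FactGroup using finite_S by simp

sublocale Q: finite_monomial A Q
  by (intro finite_monomial.intro finite_monomial_axioms.intro factorgroup_is_group A.comm_group_axioms finite_quotient)

lemma coset_mult: "x \<in> carrier G \<Longrightarrow> y \<in> carrier G \<Longrightarrow> (N #> x) \<otimes>\<^bsub>Q\<^esub> (N #> y) = N #> (x \<otimes> y)"
  by (simp add: rcos_sum)

lemma coset_in_quotient: "x \<in> carrier G \<Longrightarrow> N #> x \<in> carrier Q"
  by (simp add: carrier_FactGroup)

lemma coset_inv: "x \<in> carrier G \<Longrightarrow> inv\<^bsub>Q\<^esub> (N #> x) = N #> inv x"
  using coset_in_quotient[of x] by (simp add: inv_FactGroup rcos_inv)

lemma coset_conj:
  "g \<in> carrier G \<Longrightarrow> x \<in> carrier G \<Longrightarrow> inv\<^bsub>Q\<^esub> (N #> g) \<otimes>\<^bsub>Q\<^esub> (N #> x) \<otimes>\<^bsub>Q\<^esub> (N #> g) = N #> (inv g \<otimes> x \<otimes> g)"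
  by (simp add: coset_inv coset_mult del: mult_FactGroup)

text \<open>
  The preimage of \<open>P\<close> under the projection to \<open>G/N\<close> is \<open>\<Union>P\<close>.
\<close>

lemma mem_Union_iff:
  assumes P: "P \<subseteq> carrier Q" and x: "x \<in> carrier G"
  shows "x \<in> \<Union>P \<longleftrightarrow> N #> x \<in> P"
proof
  assume "x \<in> \<Union>P"
  then obtain Y where Y: "Y \<in> P" "x \<in> Y" by blast
  then obtain y where y: "y \<in> carrier G" "Y = N #> y" using P by (auto simp: carrier_FactGroup)
  have "N #> y = N #> x" by (rule repr_independence[OF _ y(1) is_subgroup]) (use Y y in simp)
  then show "N #> x \<in> P" using Y y by simp
next
  assume "N #> x \<in> P"
  then show "x \<in> \<Union>P" using rcos_self[OF x is_subgroup] by blast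
qed

lemma Union_subset: "P \<subseteq> carrier Q \<Longrightarrow> \<Union>P \<subseteq> carrier G"
  by (auto simp: carrier_FactGroup subset_iff dest!: elemrcos_carrier[OF group_axioms, rotated])

lemma subgroup_Union:
  assumes P: "subgroup P Q"
  shows "subgroup (\<Union>P) G"
proof -
  interpret P: subgroup P Q by fact
  note mem = mem_Union_iff[OF P.subset]
  have sub: "\<Union>P \<subseteq> carrier G" by (rule Union_subset[OF P.subset])
  show ?thesis
  proof (rule subgroupI[OF sub])
    have "N \<in> P" using P.one_closed by simp
    then show "\<Union>P \<noteq> {}" using is_subgroup subgroup.one_closed by blast
    fix x assume x: "x \<in> \<Union>P"
    then have xc: "x \<in> carrier G" using sub by blast
    have "inv\<^bsub>Q\<^esub> (N #> x) \<in> P" by (rule P.m_inv_closed) (use x mem[OF xc] in blast)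
    then show "inv x \<in> \<Union>P" using mem[of "inv x"] coset_inv[OF xc] xc by simp
    fix y assume y: "y \<in> \<Union>P"
    then have yc: "y \<in> carrier G" using sub by blast
    have "(N #> x) \<otimes>\<^bsub>Q\<^esub> (N #> y) \<in> P"
      by (rule P.m_closed) (use x y mem[OF xc] mem[OF yc] in blast)+
    then show "x \<otimes> y \<in> \<Union>P" unfolding coset_mult[OF xc yc] using mem[of "x \<otimes> y"] xc yc by simp
  qed
qed

lemma sum_cosets:
  fixes F :: "'g set \<Rightarrow> 'k::field"
  assumes P: "P \<subseteq> carrier Q"
  shows "(\<Sum>g\<in>\<Union>P. F (N #> g)) = of_nat (card N) * (\<Sum>X\<in>P. F X)"
proof -
  have fin: "\<forall>X\<in>P. finite X" using Union_subset[OF P] finite_S by (meson Union_upper finite_subset)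
  have disj: "\<forall>X\<in>P. \<forall>Y\<in>P. X \<noteq> Y \<longrightarrow> X \<inter> Y = {}"
    using rcos_disjoint[OF is_subgroup] P unfolding pairwise_def disjnt_def FactGroup_def by auto
  have "(\<Sum>g\<in>\<Union>P. F (N #> g)) = (\<Sum>X\<in>P. \<Sum>g\<in>X. F (N #> g))"
    using sum.Union_disjoint[OF fin disj, of "\<lambda>g. F (N #> g)"] by simp
  also have "\<dots> = (\<Sum>X\<in>P. of_nat (card N) * F X)"
  proof (rule sum.cong[OF refl])
    fix X assume X: "X \<in> P"
    then obtain x where x: "x \<in> carrier G" "X = N #> x" using P by (auto simp: carrier_FactGroup)
    have "N #> g = X" if "g \<in> X" for g
      using repr_independence[of g N x] that x is_subgroup by simp
    moreover have "card X = card N"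
      using card_rcosets_equal[of X N] X P subset by (auto simp: FactGroup_def)
    ultimately show "(\<Sum>g\<in>X. F (N #> g)) = of_nat (card N) * F X" by simp
  qed
  finally show ?thesis by (simp add: sum_distrib_left)
qed

lemma Union_quotient: "\<Union>(carrier Q) = carrier G"
  using rcosets_part_G[OF is_subgroup] by (simp add: FactGroup_def)

definition inflate :: "('g set, 'a) mpair \<Rightarrow> ('g, 'a) mpair" where
  "inflate q = (\<Union>(fst q), \<lambda>x\<in>\<Union>(fst q). snd q (N #> x))"

lemma inflation_eq: "inflation G N = lin_ext (\<lambda>c. Poly_Mapping.single (mclass G (inflate (rep c))) 1)"
  unfolding inflation_def inflate_def dual_map_def compose_def Let_def
  by (simp add: case_prod_beta)

lemma Dual_quotient_mult:
  assumes "\<phi> \<in> Q.Dual P" "x \<in> carrier G" "y \<in> carrier G" "N #> x \<in> P" "N #> y \<in> P"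
  shows "\<phi> (N #> (x \<otimes> y)) = \<phi> (N #> x) \<otimes>\<^bsub>A\<^esub> \<phi> (N #> y)"
  using assms unfolding dual_iff by (metis coset_mult)

lemma pullback_coset_in_Dual:
  assumes \<phi>: "\<phi> \<in> Q.Dual P" and H: "subgroup H G" and sub: "\<And>h. h \<in> H \<Longrightarrow> N #> h \<in> P"
  shows "(\<lambda>h\<in>H. \<phi> (N #> h)) \<in> Dual H"
proof -
  interpret H: subgroup H G by fact
  have "\<phi> (N #> h) \<in> carrier A" if "h \<in> H" for h using \<phi> sub[OF that] unfolding dual_iff by blast
  then show ?thesis using Dual_quotient_mult[OF \<phi>] sub by (simp add: dual_iff)
qed

lemma inflate_in_mpairs:
  assumes q: "q \<in> mpairs A Q"
  shows "inflate q \<in> mpairs A G"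
proof -
  have P: "subgroup (fst q) Q" and \<phi>: "snd q \<in> Q.Dual (fst q)" using q by (simp_all add: Q.mpairs_iff)
  have U: "subgroup (\<Union>(fst q)) G" by (rule subgroup_Union[OF P])
  have "N #> h \<in> fst q" if "h \<in> \<Union>(fst q)" for h
    using that mem_Union_iff[OF subgroup.subset[OF P]] subgroup.subset[OF U] by blast
  from pullback_coset_in_Dual[OF \<phi> U this] U show ?thesis by (simp add: mpairs_iff inflate_def)
qed

lemma inflation_in_burnside:
  assumes x: "x \<in> burnside A Q"
  shows "inflation G N x \<in> burnside A G"
  unfolding inflation_eq
  by (intro burnside_closed_lin_ext burnside_single inflate_in_mpairs Q.burnside_rep(1)[OF x])

lemma quot_eq: "quot G U N = (\<lambda>x. N #> x) ` U"
  unfolding quot_def carrier_FactGroup by (simp add: r_coset_def)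

lemma quot_set_mult:
  assumes H: "subgroup H G"
  shows "quot G (H <#> N) N = (\<lambda>h. N #> h) ` H"
proof -
  have eq: "N #> (h \<otimes> n) = N #> h" if h: "h \<in> H" and n: "n \<in> N" for h n
  proof -
    have hc: "h \<in> carrier G" and nc: "n \<in> carrier G" using h n subgroup.subset[OF H] subset by auto
    have "N #> n = N" by (rule coset_join2[OF nc is_subgroup n])
    then have "N #> (h \<otimes> n) = (N #> h) \<otimes>\<^bsub>Q\<^esub> \<one>\<^bsub>Q\<^esub>"
      using coset_mult[OF hc nc] by (simp del: mult_FactGroup)
    then show ?thesis using Q.r_one[OF coset_in_quotient[OF hc]] by simp
  qed
  show ?thesis
  proof (intro subset_antisym image_subsetI subsetI)
    fix X assume "X \<in> quot G (H <#> N) N"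
    then obtain h n where "h \<in> H" "n \<in> N" "X = N #> (h \<otimes> n)" unfolding quot_eq set_mult_def by auto
    then show "X \<in> (\<lambda>h. N #> h) ` H" using eq by auto
  next
    fix h assume h: "h \<in> H"
    have "h \<otimes> \<one> \<in> H <#> N" using h subgroup.one_closed[OF is_subgroup] unfolding set_mult_def by blast
    then have "h \<in> H <#> N" using h subgroup.subset[OF H] by auto
    then show "N #> h \<in> quot G (H <#> N) N" unfolding quot_eq by (rule imageI)
  qed
qed

lemma subgroup_quot:
  assumes H: "subgroup H G"
  shows "subgroup ((\<lambda>h. N #> h) ` H) Q"
proof -
  interpret H: subgroup H G by fact
  show ?thesis
  proof (rule Q.subgroupI)
    show "(\<lambda>h. N #> h) ` H \<subseteq> carrier Q" using coset_in_quotient by auto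
    show "(\<lambda>h. N #> h) ` H \<noteq> {}" using H.one_closed by blast
    fix X assume "X \<in> (\<lambda>h. N #> h) ` H"
    then obtain h where h: "h \<in> H" "X = N #> h" by blast
    show "inv\<^bsub>Q\<^esub> X \<in> (\<lambda>h. N #> h) ` H" unfolding h(2) using h(1) by (subst coset_inv) auto
    fix Y assume "Y \<in> (\<lambda>h. N #> h) ` H"
    then obtain k where k: "k \<in> H" "Y = N #> k" by blast
    show "X \<otimes>\<^bsub>Q\<^esub> Y \<in> (\<lambda>h. N #> h) ` H" unfolding h(2) k(2) using h(1) k(1) by (subst coset_mult) auto
  qed
qed

text \<open>
  The composite of the canonical maps \<open>H \<rightarrow> H/(H \<inter> N) \<rightarrow> HN/N\<close> is \<open>h \<mapsto> Nh\<close>, so pulling \<open>\<phi>\<close> back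
  along it gives \<open>h \<mapsto> \<phi> (Nh)\<close>.
\<close>

lemma spair_quot_eq:
  assumes H: "subgroup H G"
  shows "spair_quot A G N (H, \<Phi>) =
    ((\<lambda>h. N #> h) ` H, \<lambda>\<phi>\<in>Q.Dual ((\<lambda>h. N #> h) ` H). \<Phi> (\<lambda>h\<in>H. \<phi> (N #> h)))"
proof -
  interpret H: subgroup H G by fact
  have coset: "(H \<inter> N) #> h \<in> carrier (G\<lparr>carrier := H\<rparr> Mod (H \<inter> N))" if "h \<in> H" for h
    using that unfolding carrier_FactGroup by (auto simp: r_coset_def)
  have \<alpha>: "N <#> ((H \<inter> N) #> h) = N #> h" if h: "h \<in> H" for h
  proof (intro subset_antisym subsetI)
    fix y assume "y \<in> N <#> ((H \<inter> N) #> h)"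
    then obtain n m where nm: "n \<in> N" "m \<in> N" "y = n \<otimes> (m \<otimes> h)"
      unfolding set_mult_def r_coset_def by blast
    then have "y = (n \<otimes> m) \<otimes> h" using h subset by (simp add: m_assoc subset_iff)
    moreover have "n \<otimes> m \<in> N" using nm subgroup.m_closed[OF is_subgroup] by blast
    ultimately show "y \<in> N #> h" unfolding r_coset_def by blast
  next
    fix y assume "y \<in> N #> h"
    then obtain n where "n \<in> N" "y = n \<otimes> h" unfolding r_coset_def by blast
    then have n: "n \<in> N" "y = n \<otimes> (\<one> \<otimes> h)" using h by simp_all
    moreover have "\<one> \<in> H \<inter> N" using H.one_closed subgroup.one_closed[OF is_subgroup] by blast
    ultimately show "y \<in> N <#> ((H \<inter> N) #> h)" unfolding set_mult_def r_coset_def by blast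
  qed
  have "dual_map (G\<lparr>carrier := H\<rparr>) (\<lambda>h. (H \<inter> N) #> h)
      (dual_map (G\<lparr>carrier := H\<rparr> Mod (H \<inter> N)) (\<lambda>X. N <#> X) \<phi>) = (\<lambda>h\<in>H. \<phi> (N #> h))" for \<phi> :: "'g set \<Rightarrow> 'a"
    unfolding dual_map_def compose_def by (simp add: coset \<alpha> cong: restrict_cong)
  then show ?thesis unfolding spair_quot_def Let_def fst_conv snd_conv quot_set_mult[OF H] by simp
qed

lemma spair_quot_in_spairs:
  fixes p :: "('g, 'a, 'k::field) spair"
  assumes p: "p \<in> spairs A G"
  shows "spair_quot A G N p \<in> spairs A Q"
proof -
  obtain H \<Phi> where pp: "p = (H, \<Phi>)" by (cases p)
  have H: "subgroup H G" and \<Phi>: "\<Phi> \<in> ext_hom (dual_group A (G\<lparr>carrier := H\<rparr>)) (field_units :: 'k monoid)"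
    using p by (auto simp: spairs_def pp)
  let ?P = "(\<lambda>h. N #> h) ` H"
  let ?f = "\<lambda>\<phi>. \<lambda>h\<in>H. \<phi> (N #> h)"
  have P: "subgroup ?P Q" by (rule subgroup_quot[OF H])
  interpret D: comm_group "dual_group A (Q\<lparr>carrier := ?P\<rparr>)" by (rule Q.comm_group_Dual[OF P])
  have f: "?f \<phi> \<in> Dual H" if "\<phi> \<in> Q.Dual ?P" for \<phi>
    by (rule pullback_coset_in_Dual[OF that H]) blast
  have mult: "?f (\<phi> \<otimes>\<^bsub>dual_group A (Q\<lparr>carrier := ?P\<rparr>)\<^esub> \<psi>) = ?f \<phi> \<otimes>\<^bsub>dual_group A (G\<lparr>carrier := H\<rparr>)\<^esub> ?f \<psi>" for \<phi> \<psi>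
    by (simp add: dual_group_def restrict_def fun_eq_iff)
  have "(\<lambda>\<phi>\<in>Q.Dual ?P. \<Phi> (?f \<phi>)) \<in> ext_hom (dual_group A (Q\<lparr>carrier := ?P\<rparr>)) (field_units :: 'k monoid)"
    unfolding ext_hom_field_units_iff
  proof (intro conjI ballI)
    fix \<phi> \<psi> assume \<phi>: "\<phi> \<in> Q.Dual ?P" and \<psi>: "\<psi> \<in> Q.Dual ?P"
    have "\<Phi> (?f (\<phi> \<otimes>\<^bsub>dual_group A (Q\<lparr>carrier := ?P\<rparr>)\<^esub> \<psi>)) = \<Phi> (?f \<phi>) * \<Phi> (?f \<psi>)"
      unfolding mult using \<Phi> f[OF \<phi>] f[OF \<psi>] unfolding ext_hom_field_units_iff by blast
    then show "(\<lambda>\<phi>\<in>Q.Dual ?P. \<Phi> (?f \<phi>)) (\<phi> \<otimes>\<^bsub>dual_group A (Q\<lparr>carrier := ?P\<rparr>)\<^esub> \<psi>) =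
        (\<lambda>\<phi>\<in>Q.Dual ?P. \<Phi> (?f \<phi>)) \<phi> * (\<lambda>\<phi>\<in>Q.Dual ?P. \<Phi> (?f \<phi>)) \<psi>"
      using \<phi> \<psi> D.m_closed[OF \<phi> \<psi>] by simp
  next
    fix \<phi> assume \<phi>: "\<phi> \<in> Q.Dual ?P"
    have "\<Phi> (?f \<phi>) \<noteq> 0" using \<Phi> f[OF \<phi>] unfolding ext_hom_field_units_iff by blast
    then show "(\<lambda>\<phi>\<in>Q.Dual ?P. \<Phi> (?f \<phi>)) \<phi> \<noteq> 0" using \<phi> by simp
  qed (rule restrict_extensional)
  then show ?thesis unfolding pp spair_quot_eq[OF H] using P by (simp add: spairs_def)
qed

text \<open>
  This is part (a) summand by summand. Since \<open>\<Union>P\<close> is a union of cosets of \<open>N\<close>, both the condition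
  \<open>g\<^sup>-\<^sup>1Hg \<le> \<Union>P\<close> and the character depend on \<open>g\<close> and \<open>H\<close> only modulo \<open>N\<close>.
\<close>

lemma local_value_inflate:
  fixes p :: "('g, 'a, 'k::field) spair"
  assumes p: "p \<in> spairs A G" and q: "q \<in> mpairs A Q" and g: "g \<in> carrier G"
  shows "local_value G p (inflate q) g = local_value Q (spair_quot A G N p) q (N #> g)"
proof -
  obtain H \<Phi> where pp: "p = (H, \<Phi>)" by (cases p)
  have H: "subgroup H G" using p by (auto simp: spairs_def pp)
  have Hc: "H \<subseteq> carrier G" by (rule subgroup.subset[OF H])
  let ?HN = "(\<lambda>h. N #> h) ` H"
  have HN: "subgroup ?HN Q" by (rule subgroup_quot[OF H])
  have P: "subgroup (fst q) Q" and \<phi>: "snd q \<in> Q.Dual (fst q)" using q by (simp_all add: Q.mpairs_iff)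
  have conj: "inv\<^bsub>Q\<^esub> (N #> g) \<otimes>\<^bsub>Q\<^esub> (N #> h) \<otimes>\<^bsub>Q\<^esub> (N #> g) = N #> (inv g \<otimes> h \<otimes> g)" if "h \<in> H" for h
    using coset_conj[OF g] that Hc by blast
  have closed: "inv g \<otimes> h \<otimes> g \<in> carrier G" if "h \<in> H" for h using that Hc g by auto
  have memU: "inv g \<otimes> h \<otimes> g \<in> \<Union>(fst q) \<longleftrightarrow> N #> (inv g \<otimes> h \<otimes> g) \<in> fst q" if "h \<in> H" for h
    by (rule mem_Union_iff[OF subgroup.subset[OF P] closed[OF that]])
  have cond: "(\<forall>X\<in>?HN. inv\<^bsub>Q\<^esub> (N #> g) \<otimes>\<^bsub>Q\<^esub> X \<otimes>\<^bsub>Q\<^esub> (N #> g) \<in> fst q) \<longleftrightarrow>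
      (\<forall>h\<in>H. inv g \<otimes> h \<otimes> g \<in> \<Union>(fst q))"
  proof -
    have "(\<forall>X\<in>?HN. inv\<^bsub>Q\<^esub> (N #> g) \<otimes>\<^bsub>Q\<^esub> X \<otimes>\<^bsub>Q\<^esub> (N #> g) \<in> fst q) \<longleftrightarrow>
      (\<forall>h\<in>H. inv\<^bsub>Q\<^esub> (N #> g) \<otimes>\<^bsub>Q\<^esub> (N #> h) \<otimes>\<^bsub>Q\<^esub> (N #> g) \<in> fst q)" by blast
    also have "\<dots> \<longleftrightarrow> (\<forall>h\<in>H. inv g \<otimes> h \<otimes> g \<in> \<Union>(fst q))"
      by (rule ball_cong[OF refl]) (simp only: conj memU)
    finally show ?thesis .
  qed
  show ?thesis
  proof (cases "\<forall>h\<in>H. inv g \<otimes> h \<otimes> g \<in> \<Union>(fst q)")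
    case True
    let ?\<theta> = "\<lambda>X\<in>?HN. snd q (inv\<^bsub>Q\<^esub> (N #> g) \<otimes>\<^bsub>Q\<^esub> X \<otimes>\<^bsub>Q\<^esub> (N #> g))"
    have \<theta>: "?\<theta> \<in> Q.Dual ?HN"
      by (rule Q.pullback_in_Dual[OF HN coset_in_quotient[OF g] \<phi>]) (use True cond in blast)
    have "(\<lambda>h\<in>H. ?\<theta> (N #> h)) = (\<lambda>h\<in>H. snd (inflate q) (inv g \<otimes> h \<otimes> g))"
    proof (rule restrict_ext)
      fix h assume h: "h \<in> H"
      then have "?\<theta> (N #> h) = snd q (inv\<^bsub>Q\<^esub> (N #> g) \<otimes>\<^bsub>Q\<^esub> (N #> h) \<otimes>\<^bsub>Q\<^esub> (N #> g))"
        by (intro restrict_apply' imageI)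
      then show "?\<theta> (N #> h) = snd (inflate q) (inv g \<otimes> h \<otimes> g)"
        unfolding conj[OF h] inflate_def using True h by (simp del: mult_FactGroup Union_iff)
    qed
    then have "snd (spair_quot A G N p) ?\<theta> = \<Phi> (\<lambda>h\<in>H. snd (inflate q) (inv g \<otimes> h \<otimes> g))"
      using \<theta> unfolding pp spair_quot_eq[OF H] by (simp del: mult_FactGroup)
    moreover have "local_value G p (inflate q) g = \<Phi> (\<lambda>h\<in>H. snd (inflate q) (inv g \<otimes> h \<otimes> g))"
      using True unfolding local_value_def pp by (simp add: inflate_def del: Union_iff)
    moreover have "local_value Q (spair_quot A G N p) q (N #> g) = snd (spair_quot A G N p) ?\<theta>"
      unfolding local_value_def pp spair_quot_eq[OF H] fst_conv cond by (rule if_P[OF True])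
    ultimately show ?thesis by simp
  next
    case False
    then have "local_value Q (spair_quot A G N p) q (N #> g) = 0"
      unfolding local_value_def pp spair_quot_eq[OF H] fst_conv cond by (rule if_not_P)
    moreover have "local_value G p (inflate q) g = 0"
      using False unfolding local_value_def pp fst_conv inflate_def by (rule if_not_P)
    ultimately show ?thesis by simp
  qed
qed

lemma mark_inflate:
  fixes p :: "('g, 'a, 'k::field_char_0) spair"
  assumes p: "p \<in> spairs A G" and q: "q \<in> mpairs A Q"
  shows "mark G p (inflate q) = mark Q (spair_quot A G N p) q"
proof -
  let ?F = "local_value Q (spair_quot A G N p) q" and ?n = "of_nat (card N) :: 'k"
  have P: "fst q \<subseteq> carrier Q" using q by (simp add: Q.mpairs_iff subgroup.subset)
  have "(\<Sum>g\<in>carrier G. local_value G p (inflate q) g) = (\<Sum>g\<in>\<Union>(carrier Q). ?F (N #> g))"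
    unfolding Union_quotient by (intro sum.cong refl local_value_inflate p q)
  also have "\<dots> = ?n * (\<Sum>X\<in>carrier Q. ?F X)" by (rule sum_cosets) simp
  finally have num: "(\<Sum>g\<in>carrier G. local_value G p (inflate q) g) = ?n * (\<Sum>X\<in>carrier Q. ?F X)" .
  have den: "of_nat (card (\<Union>(fst q))) = ?n * of_nat (card (fst q))"
    using sum_cosets[OF P, of "\<lambda>_. 1 :: 'k"] by simp
  have "?n \<noteq> 0" by (rule of_nat_card_subgroup[OF is_subgroup])
  then show ?thesis unfolding mark_def num by (simp add: inflate_def den)
qed

theorem species_inflation:
  fixes x :: "('g set, 'a) mpair set \<Rightarrow>\<^sub>0 'k::field_char_0"
  assumes p: "p \<in> spairs A G" and x: "x \<in> burnside A Q"
  shows "species G p (inflation G N x) = species Q (spair_quot A G N p) x"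
proof -
  obtain H \<Phi> where pp: "p = (H, \<Phi>)" by (cases p)
  have H: "subgroup H G" using p by (auto simp: spairs_def pp)
  obtain L \<Psi> where qq: "spair_quot A G N (H, \<Phi>) = (L, \<Psi>)" by (cases "spair_quot A G N (H, \<Phi>)")
  have L: "subgroup L Q" using spair_quot_in_spairs[OF p] by (auto simp: spairs_def qq pp)
  have inf: "inflate (rep c) \<in> mpairs A G" if "c \<in> Poly_Mapping.keys x" for c
    by (rule inflate_in_mpairs[OF Q.burnside_rep(1)[OF x that]])
  have "species G p (inflation G N x) = lin_form (\<lambda>c. species G (H, \<Phi>) (Poly_Mapping.single (mclass G (inflate (rep c))) 1)) x"
    unfolding inflation_eq pp by (intro species_lin_ext[OF H] burnside_single inf)
  also have "\<dots> = lin_form (\<lambda>c. mark Q (L, \<Psi>) (rep c)) x"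
  proof (rule lin_form_cong)
    fix c assume c: "c \<in> Poly_Mapping.keys x"
    show "species G (H, \<Phi>) (Poly_Mapping.single (mclass G (inflate (rep c))) 1) = mark Q (L, \<Psi>) (rep c)"
      using mark_inflate[OF p Q.burnside_rep(1)[OF x c]] unfolding species_single[OF inf[OF c] H] pp qq .
  qed
  also have "\<dots> = species Q (L, \<Psi>) x" by (rule Q.species_eq_lin_form_mark[OF x L, symmetric])
  finally show ?thesis unfolding pp qq .
qed

end

section \<open>The inflation formulas\<close>

theorem proposition4p2:
  fixes A :: "('a, 'c) monoid_scheme"
    and G :: "('g, 'b) monoid_scheme"
    and N :: "'g set"
  assumes "comm_group A"
    and "group G" and "finite (carrier G)"
    and finite_dual: "\<And>V L. subgroup V G \<Longrightarrow> L \<lhd> G\<lparr>carrier := V\<rparr> \<Longrightarrow>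
          finite (carrier (dual_group A (G\<lparr>carrier := V\<rparr> Mod L)))"
    and splitting: "\<And>V L. subgroup V G \<Longrightarrow> L \<lhd> G\<lparr>carrier := V\<rparr> \<Longrightarrow>
          splitting_field TYPE('k::field_char_0) (dual_group A (G\<lparr>carrier := V\<rparr> Mod L))"
    and "N \<lhd> G"
  shows "(\<forall>H (\<Phi> :: ('g \<Rightarrow> 'a) \<Rightarrow> 'k). (H, \<Phi>) \<in> spairs A G \<longrightarrow>
            spair_quot A G N (H, \<Phi>) \<in> spairs A (G Mod N) \<and>
            (\<forall>x\<in>burnside A (G Mod N).
               (species G (H, \<Phi>) \<circ> inflation G N) x
               = species (G Mod N) (spair_quot A G N (H, \<Phi>)) x))
       \<and> (\<forall>U (\<Psi> :: ('g set \<Rightarrow> 'a) \<Rightarrow> 'k) R.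
            subgroup U G \<longrightarrow> N \<subseteq> U \<longrightarrow> (quot G U N, \<Psi>) \<in> spairs A (G Mod N) \<longrightarrow>
            spair_transversal A G R \<longrightarrow>
            inflation G N (idem A (G Mod N) (quot G U N, \<Psi>))
            = (\<Sum>p | p \<in> R \<and>
                   spair_conjugate A (G Mod N) (spair_quot A G N p) (quot G U N, \<Psi>).
                 idem A G p))"
proof -
  interpret quotient_monomial A G N
    by (intro quotient_monomial.intro finite_monomial.intro finite_monomial_axioms.intro assms)
  have sep: "separates_points TYPE('k) (dual_group A (G\<lparr>carrier := V\<rparr> Mod L))"
    if V: "subgroup V G" and L: "L \<lhd> G\<lparr>carrier := V\<rparr>" for V L
    by (intro splitting_field_separates_points splitting finite_dual comm_group_dual_group
        A.comm_group_axioms normal.factorgroup_is_group[OF L] V L)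
  interpret SG: split_monomial A G "TYPE('k)"
  proof
    fix H assume H: "subgroup H G"
    interpret V: group "G\<lparr>carrier := H\<rparr>" by (rule subgroup_imp_group[OF H])
    have one: "{\<one>\<^bsub>G\<lparr>carrier := H\<rparr>\<^esub>} \<lhd> G\<lparr>carrier := H\<rparr>" by (rule V.one_is_normal)
    obtain f where f: "f \<in> hom (dual_group A (G\<lparr>carrier := H\<rparr>)) (dual_group A (G\<lparr>carrier := H\<rparr> Mod {\<one>\<^bsub>G\<lparr>carrier := H\<rparr>\<^esub>}))"
      "inj_on f (Dual H)"
      using dual_group_embeds_mod_trivial[OF A.comm_group_axioms V.group_axioms] by blast
    have "f ` Dual H \<subseteq> carrier (dual_group A (G\<lparr>carrier := H\<rparr> Mod {\<one>\<^bsub>G\<lparr>carrier := H\<rparr>\<^esub>}))"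
      using f(1) by (auto simp: hom_def)
    then show "finite (Dual H)"
      using inj_on_finite[OF f(2)] finite_dual[OF H one] by blast
    show "separates_points TYPE('k) (dual_group A (G\<lparr>carrier := H\<rparr>))"
      by (rule separates_points_inj_hom[OF _ _ f sep[OF H one]])
        (intro comm_group.axioms comm_group_dual_group A.comm_group_axioms V.group_axioms
          normal.factorgroup_is_group[OF one])+
  qed
  \<comment> \<open>A subgroup of \<open>G/N\<close> is itself a subquotient of \<open>G\<close>, so the hypotheses on \<open>G\<close> cover it.\<close>
  have quotient_subgroup: "\<exists>V. subgroup V G \<and> N \<lhd> G\<lparr>carrier := V\<rparr> \<and> G\<lparr>carrier := V\<rparr> Mod N = Q\<lparr>carrier := P\<rparr>"
    if P: "subgroup P Q" for P
  proof (intro exI conjI)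
    show U: "subgroup (\<Union>P) G" by (rule subgroup_Union[OF P])
    have "N \<in> P" using subgroup.one_closed[OF P] by simp
    then show "N \<lhd> G\<lparr>carrier := \<Union>P\<rparr>"
      by (intro normal_restrict_supergroup U normal_axioms) blast
    have "quot G (\<Union>P) N = P"
    proof (intro subset_antisym subsetI)
      fix X assume "X \<in> quot G (\<Union>P) N"
      then obtain x where x: "x \<in> \<Union>P" "X = N #>\<^bsub>G\<^esub> x" unfolding quot_eq by blast
      have "x \<in> carrier G" using x(1) subgroup.subset[OF U] by blast
      then show "X \<in> P" using mem_Union_iff[OF subgroup.subset[OF P]] x by blast
    next
      fix X assume X: "X \<in> P"
      then have "X \<in> carrier Q" using subgroup.subset[OF P] by blast
      then obtain x where x: "x \<in> carrier G" "X = N #>\<^bsub>G\<^esub> x" unfolding carrier_FactGroup by blast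
      then have "x \<in> \<Union>P" using mem_Union_iff[OF subgroup.subset[OF P]] X by blast
      then show "X \<in> quot G (\<Union>P) N" unfolding quot_eq x(2) by (rule imageI)
    qed
    then show "G\<lparr>carrier := \<Union>P\<rparr> Mod N = Q\<lparr>carrier := P\<rparr>"
      by (simp add: FactGroup_def quot_def set_mult_def fun_eq_iff)
  qed
  interpret SQ: split_monomial A Q "TYPE('k)"
  proof
    fix P assume "subgroup P Q"
    from quotient_subgroup[OF this] obtain V where V: "subgroup V G" "N \<lhd> G\<lparr>carrier := V\<rparr>"
      and eq: "G\<lparr>carrier := V\<rparr> Mod N = Q\<lparr>carrier := P\<rparr>" by blast
    show "finite (Q.Dual P)" "separates_points TYPE('k) (dual_group A (Q\<lparr>carrier := P\<rparr>))"
      using finite_dual[OF V] sep[OF V] unfolding eq .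
  qed
  show ?thesis
  proof (intro conjI allI impI)
    fix H and \<Phi> :: "('g \<Rightarrow> 'a) \<Rightarrow> 'k" assume p: "(H, \<Phi>) \<in> spairs A G"
    show "spair_quot A G N (H, \<Phi>) \<in> spairs A Q" by (rule spair_quot_in_spairs[OF p])
    show "\<forall>x\<in>burnside A Q. (species G (H, \<Phi>) \<circ> inflation G N) x = species Q (spair_quot A G N (H, \<Phi>)) x"
      by (simp add: species_inflation[OF p])
  next
    fix U and \<Psi> :: "('g set \<Rightarrow> 'a) \<Rightarrow> 'k" and R :: "('g, 'a, 'k) spair set"
    assume q: "(quot G U N, \<Psi>) \<in> spairs A Q" and R: "spair_transversal A G R"
    let ?q = "(quot G U N, \<Psi>)"
    define T where "T = {p \<in> R. spair_conjugate A Q (spair_quot A G N p) ?q}"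
    have Rsub: "R \<subseteq> spairs A G" using R by (simp add: spair_transversal_def)
    have finT: "finite T" using Rsub by (intro finite_subset[OF _ SG.finite_spairs]) (auto simp: T_def)
    let ?e = "inflation G N (idem A Q ?q)"
    have e: "?e \<in> burnside A G" by (rule inflation_in_burnside[OF SQ.idem_characterization(1)[OF q]])
    have se: "species G s ?e = (if spair_conjugate A Q (spair_quot A G N s) ?q then 1 else 0)" if s: "s \<in> spairs A G" for s
      using species_inflation[OF s SQ.idem_characterization(1)[OF q]]
        SQ.idem_characterization(2)[OF q spair_quot_in_spairs[OF s]] by simp
    have "?e = (\<Sum>p\<in>T. idem A G p)"
    proof (rule SG.species_eqI[OF e])
      show "(\<Sum>p\<in>T. idem A G p) \<in> burnside A G"
        using Rsub by (intro burnside_closed_sum SG.idem_characterization(1)) (auto simp: T_def)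
      fix s :: "('g, 'a, 'k) spair" assume s: "s \<in> spairs A G"
      \<comment> \<open>Exactly one summand can be nonzero at \<open>s\<close>: that of the representative \<open>r\<close> of its orbit.
        Whether \<open>r\<close> occurs in the sum can be read off from the left side at \<open>r\<close>.\<close>
      obtain r where r: "r \<in> R" "spair_conjugate A G s r"
        and uniq: "\<And>r'. r' \<in> R \<Longrightarrow> spair_conjugate A G s r' \<Longrightarrow> r' = r"
        using R s unfolding spair_transversal_def by blast
      have rs: "r \<in> spairs A G" using r(1) Rsub by blast
      obtain g where g: "g \<in> carrier G" "r = conj_spair A G g s" using r(2) by (auto simp: spair_conjugate_def)
      have "species G s (\<Sum>p\<in>T. idem A G p) = (\<Sum>p\<in>T. if p = r then 1 else 0)"
        unfolding species_sum
      proof (rule sum.cong[OF refl])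
        fix p assume p: "p \<in> T"
        then have ps: "p \<in> spairs A G" and pR: "p \<in> R" using Rsub by (auto simp: T_def)
        have "spair_conjugate A G s p \<longleftrightarrow> p = r" using uniq[OF pR] r(2) by blast
        then show "species G s (idem A G p) = (if p = r then 1 else 0)"
          by (simp only: SG.idem_characterization(2)[OF ps s])
      qed
      also have "\<dots> = (if r \<in> T then 1 else 0)" using finT by simp
      also have "\<dots> = species G r ?e" using r(1) by (simp add: se[OF rs] T_def)
      also have "\<dots> = species G s ?e" unfolding g(2) by (rule species_conj_spair[OF s e g(1)])
      finally show "species G s ?e = species G s (\<Sum>p\<in>T. idem A G p)" by simp
    qed
    then show "?e = (\<Sum>p | p \<in> R \<and> spair_conjugate A Q (spair_quot A G N p) ?q. idem A G p)"
      unfolding T_def .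
  qed
qed

end
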